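(* Let $X$ be a closed manifold and let $\xi\in H^1(X;\mathbb{Z})$ be an integral cohomology class. For fixed $q$ the function $a\mapsto\dim_{\mathbb{C}}H^q(X;\mathcal{E}_a)$, $a\in\mathbb{C}^*$, has the following behavior: (a) it is constant except at finitely many jump points $a=a_1,\dots,a_N$; (b) the common value of $\dim_{\mathbb{C}}H^q(X;\mathcal{E}_a)$ for $a\neq a_1,\dots,a_N$ equals the Novikov number $b_q(\xi)$; (c) for $a\in\mathbb{C}^*$ being one of the jump points $a_1,\dots,a_N$, the dimension $\dim_{\mathbb{C}}H^q(X;\mathcal{E}_a)$ is greater than the Novikov number $b_q(\xi)$; (d) the jump points $a_1,\dots,a_N$ are algebraic numbers (not necessarily algebraic integers).
   Context: For $\xi\in H^1(X;\mathbb{Z})$ and $a\in\mathbb{C}^*$, $\mathcal{E}_a\to X$ denotes the complex flat line bundle whose monodromy along any loop $\gamma\in\pi_1(X)$ is multiplication by $a^{\langle\xi,\gamma\rangle}\in\mathbb{C}$. The Novikov number $b_q(\xi)$ is $\dim_{\mathbb{Q}(\tau)}H^q(X;\mathcal{L}_\xi)$, where $\mathbb{Q}(\tau)$ is the field of rational functions in one variable and $\mathcal{L}_\xi$ is the rank 1 local system of $\mathbb{Q}(\tau)$-vector spaces on $X$ whose monodromy along $\gamma\in\pi_1(X)$ is multiplication by $\tau^{\langle\xi,\gamma\rangle}$. (This is equivalent to Novikov's original definition using formal power series.) *)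

theory Defs
  imports
    "HOL-Analysis.Analysis"
    "HOL-Homology.Homology"
    "HOL-Library.Extended_Nat"
    "HOL-Computational_Algebra.Fraction_Field"
    "Jordan_Normal_Form.VS_Connect"
begin

section \<open>Closed manifolds\<close>

definition topological_manifold :: "nat \<Rightarrow> 'x topology \<Rightarrow> bool" where
  "topological_manifold n X \<longleftrightarrow>
     Hausdorff_space X \<and> second_countable X \<and>
     (\<forall>x\<in>topspace X. \<exists>U V. openin X U \<and> x \<in> U \<and> openin (Euclidean_space n) V \<and>
        subtopology X U homeomorphic_space subtopology (Euclidean_space n) V)"

definition closed_manifold :: "nat \<Rightarrow> 'x topology \<Rightarrow> bool" where
  "closed_manifold n X \<longleftrightarrow> topological_manifold n X \<and> compact_space X"


section \<open>Modules and dimension\<close>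

text \<open>The quotient of the module \<open>M\<close> by a submodule \<open>N\<close>. The multiplicative part of the
  underlying ring record carries no meaning for a module; it is filled with the zero element,
  here and below.\<close>

definition quotient_module :: "('k, 'm) module \<Rightarrow> 'm set \<Rightarrow> ('k, 'm set) module" where
  "quotient_module M N =
     \<lparr>carrier = a_rcosets\<^bsub>M\<^esub> N,
      mult = (\<lambda>_ _. N),
      one = N,
      zero = N,
      add = (\<lambda>A B. A <+>\<^bsub>M\<^esub> B),
      smult = (\<lambda>c A. \<Union>a\<in>A. N +>\<^bsub>M\<^esub> (c \<odot>\<^bsub>M\<^esub> a))\<rparr>"

definition regular_module :: "('k::comm_ring_1, 'k) module" where
  "regular_module =
     \<lparr>carrier = UNIV, mult = (\<lambda>_ _. 0), one = 0, zero = 0, add = (+), smult = (*)\<rparr>"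

text \<open>\<^const>\<open>vectorspace.dim\<close> is a natural number and unspecified in the
  infinite-dimensional case, so the dimension is taken as an extended natural number.\<close>

definition vs_dim :: "('k::field, 'v) module \<Rightarrow> enat" where
  "vs_dim V =
     (if vectorspace.fin_dim class_ring V then enat (vectorspace.dim class_ring V) else \<infinity>)"


section \<open>Local systems\<close>

definition path_concat :: "(real \<Rightarrow> 'x) \<Rightarrow> (real \<Rightarrow> 'x) \<Rightarrow> real \<Rightarrow> 'x" where
  "path_concat g h = (\<lambda>t. if t \<le> 1/2 then g (2 * t) else h (2 * t - 1))"

definition path_homotopic :: "'x topology \<Rightarrow> (real \<Rightarrow> 'x) \<Rightarrow> (real \<Rightarrow> 'x) \<Rightarrow> bool" where
  "path_homotopic X g h \<longleftrightarrow>
     homotopic_with (\<lambda>p. p 0 = g 0 \<and> p 1 = g 1) (top_of_set {0..1}) X g h"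

text \<open>A local system of \<open>'k\<close>-modules is a functor from the fundamental groupoid to modules:
  a module at every point and, along every path, a linear parallel transport from the fibre over
  the start to the fibre over the end, invariant under homotopy with fixed end points and
  compatible with constant paths and concatenation. Invertibility of the transport follows.\<close>

record ('x, 'k, 'v) local_system_data =
  fibre :: "'x \<Rightarrow> ('k, 'v) module"
  transport :: "(real \<Rightarrow> 'x) \<Rightarrow> 'v \<Rightarrow> 'v"

definition local_system ::
    "'x topology \<Rightarrow> ('x, 'k::comm_ring_1, 'v) local_system_data \<Rightarrow> bool" where
  "local_system X L \<longleftrightarrow>
     (\<forall>x\<in>topspace X. module class_ring (fibre L x)) \<and>
     (\<forall>g. pathin X g \<longrightarrow>
        transport L g \<in> module_hom class_ring (fibre L (g 0)) (fibre L (g 1))) \<and>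
     (\<forall>g h. path_homotopic X g h \<longrightarrow>
        (\<forall>v\<in>carrier (fibre L (g 0)). transport L g v = transport L h v)) \<and>
     (\<forall>x\<in>topspace X. \<forall>v\<in>carrier (fibre L x). transport L (\<lambda>_. x) v = v) \<and>
     (\<forall>g h. pathin X g \<and> pathin X h \<and> g 1 = h 0 \<longrightarrow>
        (\<forall>v\<in>carrier (fibre L (g 0)).
           transport L (path_concat g h) v = transport L h (transport L g v)))"

definition constant_system :: "('k, 'v) module \<Rightarrow> ('x, 'k, 'v) local_system_data" where
  "constant_system M = \<lparr>fibre = (\<lambda>_. M), transport = (\<lambda>_ v. v)\<rparr>"

definition rank_one_local_system ::
    "'x topology \<Rightarrow> ('x, 'k::field, 'v) local_system_data \<Rightarrow> bool" where
  "rank_one_local_system X L \<longleftrightarrow>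
     local_system X L \<and> (\<forall>x\<in>topspace X. vs_dim (fibre L x) = 1)"


section \<open>Singular cohomology with local coefficients\<close>

definition vertex :: "nat \<Rightarrow> nat \<Rightarrow> real" where
  "vertex i = (\<lambda>j. if j = i then 1 else 0)"

text \<open>A cochain assigns to a singular simplex \<open>s\<close> an element of the fibre over the image of
  its leading vertex, \<open>s (vertex 0)\<close>.\<close>

definition cochains ::
    "'x topology \<Rightarrow> ('x, 'k, 'v) local_system_data \<Rightarrow> nat \<Rightarrow>
     ('k, ((nat \<Rightarrow> real) \<Rightarrow> 'x) \<Rightarrow> 'v) module" where
  "cochains X L q =
     (let S = singular_simplex_set q X; F = (\<lambda>s. fibre L (s (vertex 0))); z = (\<lambda>s\<in>S. \<zero>\<^bsub>F s\<^esub>) in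
      \<lparr>carrier = (\<Pi>\<^sub>E s\<in>S. carrier (F s)),
       mult = (\<lambda>_ _. z),
       one = z,
       zero = z,
       add = (\<lambda>f g. \<lambda>s\<in>S. f s \<oplus>\<^bsub>F s\<^esub> g s),
       smult = (\<lambda>c f. \<lambda>s\<in>S. c \<odot>\<^bsub>F s\<^esub> f s)\<rparr>)"

text \<open>The path in \<open>s\<close> along the edge from vertex \<open>1\<close> back to vertex \<open>0\<close>. All faces
  of \<open>s\<close> other than the one opposite to vertex \<open>0\<close> have the same leading vertex as \<open>s\<close>;
  the value of a cochain on the exceptional face is moved along this path.\<close>

definition leading_edge :: "((nat \<Rightarrow> real) \<Rightarrow> 'x) \<Rightarrow> real \<Rightarrow> 'x" where
  "leading_edge s = (\<lambda>t. s (\<lambda>j. (1 - t) * vertex 1 j + t * vertex 0 j))"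

definition coboundary ::
    "'x topology \<Rightarrow> ('x, 'k::comm_ring_1, 'v) local_system_data \<Rightarrow> nat \<Rightarrow>
     (((nat \<Rightarrow> real) \<Rightarrow> 'x) \<Rightarrow> 'v) \<Rightarrow> ((nat \<Rightarrow> real) \<Rightarrow> 'x) \<Rightarrow> 'v" where
  "coboundary X L q f =
     (\<lambda>s\<in>singular_simplex_set (Suc q) X.
        let F = fibre L (s (vertex 0)) in
        transport L (leading_edge s) (f (singular_face (Suc q) 0 s)) \<oplus>\<^bsub>F\<^esub>
        (\<Oplus>\<^bsub>F\<^esub>i\<in>{1..Suc q}. (- 1) ^ i \<odot>\<^bsub>F\<^esub> f (singular_face (Suc q) i s)))"

definition cocycles ::
    "'x topology \<Rightarrow> ('x, 'k::comm_ring_1, 'v) local_system_data \<Rightarrow> nat \<Rightarrow>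
     (((nat \<Rightarrow> real) \<Rightarrow> 'x) \<Rightarrow> 'v) set" where
  "cocycles X L q =
     {f \<in> carrier (cochains X L q). coboundary X L q f = \<zero>\<^bsub>cochains X L (Suc q)\<^esub>}"

definition coboundaries ::
    "'x topology \<Rightarrow> ('x, 'k::comm_ring_1, 'v) local_system_data \<Rightarrow> nat \<Rightarrow>
     (((nat \<Rightarrow> real) \<Rightarrow> 'x) \<Rightarrow> 'v) set" where
  "coboundaries X L q =
     (case q of
        0 \<Rightarrow> {\<zero>\<^bsub>cochains X L 0\<^esub>}
      | Suc p \<Rightarrow> coboundary X L p ` carrier (cochains X L p))"

definition cohomology ::
    "'x topology \<Rightarrow> ('x, 'k::comm_ring_1, 'v) local_system_data \<Rightarrow> nat \<Rightarrow>
     ('k, (((nat \<Rightarrow> real) \<Rightarrow> 'x) \<Rightarrow> 'v) set) module" where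
  "cohomology X L q =
     quotient_module ((cochains X L q)\<lparr>carrier := cocycles X L q\<rparr>) (coboundaries X L q)"

definition integral_cohomology ::
    "'x topology \<Rightarrow> nat \<Rightarrow> (int, (((nat \<Rightarrow> real) \<Rightarrow> 'x) \<Rightarrow> int) set) module" where
  "integral_cohomology X q = cohomology X (constant_system regular_module) q"


section \<open>Monodromy\<close>

definition path_simplex :: "(real \<Rightarrow> 'x) \<Rightarrow> (nat \<Rightarrow> real) \<Rightarrow> 'x" where
  "path_simplex g = (\<lambda>x\<in>standard_simplex 1. g (x 1))"

text \<open>The value of a class in \<open>H\<^sup>1(X;\<int>)\<close> on a loop; the choice of cocycle does not matter
  (lemma \<open>pairing_eq\<close> below).\<close>

definition pairing :: "(((nat \<Rightarrow> real) \<Rightarrow> 'x) \<Rightarrow> int) set \<Rightarrow> (real \<Rightarrow> 'x) \<Rightarrow> int" where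
  "pairing \<xi> g = (THE k. \<forall>f\<in>\<xi>. f (path_simplex g) = k)"

definition has_monodromy ::
    "'x topology \<Rightarrow> (((nat \<Rightarrow> real) \<Rightarrow> 'x) \<Rightarrow> int) set \<Rightarrow> 'k::field \<Rightarrow>
     ('x, 'k, 'v) local_system_data \<Rightarrow> bool" where
  "has_monodromy X \<xi> a L \<longleftrightarrow>
     (\<forall>g. pathin X g \<and> g 0 = g 1 \<longrightarrow>
        (\<forall>v\<in>carrier (fibre L (g 0)).
           transport L g v = (a powi pairing \<xi> g) \<odot>\<^bsub>fibre L (g 0)\<^esub> v))"

text \<open>The indeterminate of the field of rational functions over the rationals.\<close>

definition ratfun_var :: "rat poly fract" where
  "ratfun_var = Fract [:0, 1:] 1"


section \<open>The rank one local system with prescribed monodromy exists\<close>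

lemma regular_module: "module class_ring (regular_module :: ('k::comm_ring_1,'k) module)"
proof (rule moduleI)
  show "cring (class_ring :: 'k ring)" by (rule class_cring.is_cring)
  show "abelian_group (regular_module :: ('k,'k) module)"
    by (rule abelian_groupI) (auto simp: regular_module_def algebra_simps intro: exI[of _ "- x" for x])
qed (auto simp: regular_module_def algebra_simps)

lemma finsum_regular_module:
  fixes f :: "'a \<Rightarrow> 'k::comm_ring_1"
  shows "finsum regular_module f A = sum f A"
proof -
  interpret module class_ring "regular_module :: ('k,'k) module" by (rule regular_module)
  have c: "carrier (regular_module :: ('k,'k) module) = UNIV" 
    and a: "add (regular_module :: ('k,'k) module) = (+)"
    and z: "zero (regular_module :: ('k,'k) module) = 0" by (auto simp: regular_module_def)
  show ?thesis
    by (induct A rule: infinite_finite_induct) (auto simp: M.finsum_infinite c a z)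
qed

lemma integral_cocycle:
  assumes "f \<in> cocycles X (constant_system regular_module) 1" "singular_simplex 2 X s"
  shows "(f (singular_face 2 1 s) :: int) = f (singular_face 2 0 s) + f (singular_face 2 2 s)"
proof -
  have "coboundary X (constant_system regular_module) 1 f s = 0"
    using assms by (simp add: cocycles_def cochains_def Let_def constant_system_def regular_module_def numeral_2_eq_2)
  then show ?thesis
    using assms(2)
    by (simp add: coboundary_def constant_system_def Let_def finsum_regular_module)
       (simp add: regular_module_def numeral_2_eq_2)
qed

lemma continuous_simplex_coord:
  "continuous_map (subtopology (powertop_real UNIV) S) euclideanreal (\<lambda>x. x i)"
  by (rule continuous_map_from_subtopology) (use continuous_map_product_projection[of i UNIV "\<lambda>_. euclideanreal"] in simp)

lemma path_simplex_singular:
  assumes "pathin X g"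
  shows "singular_simplex 1 X (path_simplex g)"
proof -
  have "continuous_map (subtopology (powertop_real UNIV) (standard_simplex 1)) (top_of_set {0..1}) (\<lambda>x. x 1)"
    unfolding continuous_map_in_subtopology using continuous_simplex_coord
    by (auto simp: standard_simplex_def)
  from continuous_map_compose[OF this assms[unfolded pathin_def]]
  show ?thesis
    unfolding singular_simplex_def path_simplex_def
    by (auto simp: o_def elim!: continuous_map_eq)
qed

lemma standard_simplex_1: "x \<in> standard_simplex 1 \<Longrightarrow> x 0 = 1 - x 1 \<and> 0 \<le> x 1 \<and> x 1 \<le> 1 \<and> (\<forall>i>1. x i = 0)"
  by (auto simp: standard_simplex_def)

lemma singular_face_2:
  assumes "s = (\<lambda>x\<in>standard_simplex 2. t (x 1) (x 2))"
  shows "singular_face 2 0 s = path_simplex (\<lambda>u. t (1 - u) u)"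
    and "singular_face 2 1 s = path_simplex (\<lambda>u. t 0 u)"
    and "singular_face 2 2 s = path_simplex (\<lambda>u. t u 0)"
proof -
  have *: "simplical_face k x \<in> standard_simplex 2" if "x \<in> standard_simplex (Suc 0)" "k \<le> 2" for k x
    using simplical_face_in_standard_simplex[of 2 k x] that by (simp add: numeral_2_eq_2)
  show "singular_face 2 0 s = path_simplex (\<lambda>u. t (1 - u) u)"
     "singular_face 2 1 s = path_simplex (\<lambda>u. t 0 u)"
     "singular_face 2 2 s = path_simplex (\<lambda>u. t u 0)"
    unfolding singular_face_def path_simplex_def assms
    by (auto simp: fun_eq_iff restrict_def *) (auto simp: simplical_face_def dest!: standard_simplex_1[simplified])
qed

lemma continuous_two_simplex:
  assumes "continuous_map (top_of_set ({0..1}\<times>{0..1})) X (\<lambda>(u,v). h u v)"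
   "continuous_map (subtopology (powertop_real UNIV) (standard_simplex 2)) euclideanreal p"
   "continuous_map (subtopology (powertop_real UNIV) (standard_simplex 2)) euclideanreal q"
   "\<And>x. x \<in> standard_simplex 2 \<Longrightarrow> p x \<in> {0..1} \<and> q x \<in> {0..1}"
 shows "singular_simplex 2 X (\<lambda>x\<in>standard_simplex 2. h (p x) (q x))"
proof -
  have "continuous_map (subtopology (powertop_real UNIV) (standard_simplex 2)) (top_of_set ({0..1}\<times>{0..1})) (\<lambda>x. (p x, q x))"
    unfolding continuous_map_in_subtopology using assms(2-4)
    by (auto simp: continuous_map_pairwise o_def simp flip: euclidean_product_topology prod_topology_euclidean)
  from continuous_map_compose[OF this assms(1)]
  show ?thesis
    unfolding singular_simplex_def 
    by (auto simp: o_def elim!: continuous_map_eq)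
qed

lemma simplex_2: "x \<in> standard_simplex 2 \<Longrightarrow> 0 \<le> x 1 \<and> 0 \<le> x 2 \<and> x 1 + x 2 \<le> 1"
proof -
  assume x: "x \<in> standard_simplex 2"
  then have "0 \<le> x i" for i by (auto simp: standard_simplex_def)
  moreover have "x 0 + x 1 + x 2 = 1" using x by (simp add: standard_simplex_def numeral_2_eq_2)
  ultimately show ?thesis
    by (metis add.assoc add.commute le_add_same_cancel1)
qed

lemma path_simplex_cong:
  "(\<And>t. 0 \<le> t \<Longrightarrow> t \<le> 1 \<Longrightarrow> g t = h t) \<Longrightarrow> path_simplex g = path_simplex h"
  unfolding path_simplex_def by (rule restrict_ext) (use standard_simplex_1 in auto)

lemma pathin_path_concat:
  assumes "pathin X g" "pathin X h" "g 1 = h 0"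
  shows "pathin X (path_concat g h)"
  unfolding pathin_def path_concat_def
proof (rule continuous_map_cases_le)
  show "continuous_map (top_of_set {0..1}) euclideanreal (\<lambda>t. t)"
       "continuous_map (top_of_set {0..1}) euclideanreal (\<lambda>t. 1/2)"
    by auto
  have 1: "continuous_map (subtopology (top_of_set {0..1}) {x \<in> topspace (top_of_set {0..1}). x \<le> 1/2}) (top_of_set {0..1::real}) (\<lambda>t. 2 * t)"
    by (auto simp: subtopology_subtopology intro!: continuous_intros)
  have 2: "continuous_map (subtopology (top_of_set {0..1}) {x \<in> topspace (top_of_set {0..1}). 1/2 \<le> x}) (top_of_set {0..1::real}) (\<lambda>t. 2 * t - 1)"
    by (auto simp: subtopology_subtopology intro!: continuous_intros)
  show "continuous_map (subtopology (top_of_set {0..1}) {x \<in> topspace (top_of_set {0..1}). x \<le> 1/2}) X (\<lambda>t. g (2 * t))"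
    using continuous_map_compose[OF 1 assms(1)[unfolded pathin_def]] by (simp add: o_def)
  show "continuous_map (subtopology (top_of_set {0..1}) {x \<in> topspace (top_of_set {0..1}). 1/2 \<le> x}) X (\<lambda>t. h (2 * t - 1))"
    using continuous_map_compose[OF 2 assms(2)[unfolded pathin_def]] by (simp add: o_def)
  show "g (2 * t) = h (2 * t - 1)" if "t \<in> topspace (top_of_set {0..1})" "t = 1/2" for t
    unfolding that(2) using assms(3) by simp
qed

lemma singular_simplex_of_path:
  assumes "pathin X g" "continuous_map (subtopology (powertop_real UNIV) (standard_simplex p)) euclideanreal q"
   "\<And>x. x \<in> standard_simplex p \<Longrightarrow> q x \<in> {0..1}"
  shows "singular_simplex p X (\<lambda>x\<in>standard_simplex p. g (q x))"
proof -
  have "continuous_map (subtopology (powertop_real UNIV) (standard_simplex p)) (top_of_set {0..1}) q"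
    unfolding continuous_map_in_subtopology using assms by auto
  from continuous_map_compose[OF this assms(1)[unfolded pathin_def]]
  show ?thesis
    unfolding singular_simplex_def by (auto simp: o_def elim!: continuous_map_eq)
qed

context
  fixes X :: "'x topology" and f :: "((nat \<Rightarrow> real) \<Rightarrow> 'x) \<Rightarrow> int"
  assumes f: "f \<in> cocycles X (constant_system regular_module) 1"
begin

lemma cocycle_triangle:
  assumes "singular_simplex 2 X (\<lambda>x\<in>standard_simplex 2. t (x 1) (x 2))"
  shows "f (path_simplex (\<lambda>u. t 0 u)) = f (path_simplex (\<lambda>u. t (1 - u) u)) + f (path_simplex (\<lambda>u. t u 0))"
  using integral_cocycle[OF f assms] by (simp only: singular_face_2[OF refl])

lemma cocycle_const:
  assumes "x \<in> topspace X"
  shows "f (path_simplex (\<lambda>_. x)) = 0"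
  using cocycle_triangle[of "\<lambda>_ _. x"] singular_simplex_of_path[of X "\<lambda>_. x" 2 "\<lambda>_. 0"] assms by simp

lemma cocycle_concat:
  assumes "pathin X g" "pathin X h" "g 1 = h 0"
  shows "f (path_simplex (path_concat g h)) = f (path_simplex g) + f (path_simplex h)"
proof -
  have "singular_simplex 2 X (\<lambda>x\<in>standard_simplex 2. path_concat g h (x 1 / 2 + x 2))"
    by (rule singular_simplex_of_path[OF pathin_path_concat[OF assms]])
       (auto intro!: continuous_map_add continuous_map_real_divide continuous_simplex_coord dest!: simplex_2)
  from cocycle_triangle[OF this]
  have "f (path_simplex (path_concat g h)) =
     f (path_simplex (\<lambda>u. path_concat g h ((1 - u) / 2 + u))) + f (path_simplex (\<lambda>u. path_concat g h (u / 2)))"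
    by simp
  also have "path_simplex (\<lambda>u. path_concat g h ((1 - u) / 2 + u)) = path_simplex h"
    by (rule path_simplex_cong) (use assms(3) in \<open>auto simp: path_concat_def field_simps\<close>)
  also have "path_simplex (\<lambda>u. path_concat g h (u / 2)) = path_simplex g"
    by (rule path_simplex_cong) (auto simp: path_concat_def)
  finally show ?thesis by simp
qed

lemma cocycle_homotopic:
  assumes "path_homotopic X g h"
  shows "f (path_simplex g) = f (path_simplex h)"
proof -
  obtain H where H: "continuous_map (prod_topology (top_of_set {0..1::real}) (top_of_set {0..1::real})) X H"
    "\<And>x. H (0,x) = g x" "\<And>x. H (1,x) = h x"
    "\<And>t. t\<in>{0..1} \<Longrightarrow> H (t,0) = g 0 \<and> H (t,1) = g 1"
    using assms unfolding path_homotopic_def homotopic_with_def by blast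
  have Hc: "continuous_map (top_of_set ({0..1}\<times>{0..1})) X (\<lambda>(u,v). H (u,v))"
    using H(1) by (simp add: prod_topology_subtopology_eu)
  have top: "H (0,0) \<in> topspace X" "H (0,1) \<in> topspace X"
    using continuous_map_image_subset_topspace[OF Hc] by auto
  have "singular_simplex 2 X (\<lambda>x\<in>standard_simplex 2. H (x 2, x 1 + x 2))"
    by (rule continuous_two_simplex[OF Hc])
      (auto intro!: continuous_map_add continuous_simplex_coord dest!: simplex_2)
  from cocycle_triangle[OF this]
  have "f (path_simplex (\<lambda>u. H (u,u))) = f (path_simplex (\<lambda>u. H (u,1))) + f (path_simplex (\<lambda>u. H (0,u)))"
    by simp
  also have "path_simplex (\<lambda>u. H (u,1)) = path_simplex (\<lambda>_. H (0,1))"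
    by (rule path_simplex_cong) (use H in auto)
  finally have 1: "f (path_simplex (\<lambda>u. H (u,u))) = f (path_simplex g)"
    using cocycle_const[OF top(2)] H(2) by simp
  have "singular_simplex 2 X (\<lambda>x\<in>standard_simplex 2. H (x 1 + x 2, x 2))"
    by (rule continuous_two_simplex[OF Hc])
      (auto intro!: continuous_map_add continuous_simplex_coord dest!: simplex_2)
  from cocycle_triangle[OF this]
  have "f (path_simplex (\<lambda>u. H (u,u))) = f (path_simplex (\<lambda>u. H (1,u))) + f (path_simplex (\<lambda>u. H (u,0)))"
    by simp
  also have "path_simplex (\<lambda>u. H (u,0)) = path_simplex (\<lambda>_. H (0,0))"
    by (rule path_simplex_cong) (use H in auto)
  finally have 2: "f (path_simplex (\<lambda>u. H (u,u))) = f (path_simplex h)"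
    using cocycle_const[OF top(1)] H(3) by simp
  show ?thesis using 1 2 by simp
qed

end

lemma coboundary_loop:
  assumes "pathin X g" "g 0 = g 1" "b \<in> coboundaries X (constant_system regular_module) 1"
  shows "b (path_simplex g) = (0::int)"
proof -
  obtain p where b: "b = coboundary X (constant_system regular_module) 0 p"
    using assms(3) by (auto simp: coboundaries_def)
  have "singular_face (Suc 0) (Suc 0) (path_simplex g) = singular_face (Suc 0) 0 (path_simplex g)"
    unfolding singular_face_def path_simplex_def
    by (rule restrict_ext) (use assms(2) in \<open>auto simp: standard_simplex_0 simplical_face_def standard_simplex_def\<close>)
  then show ?thesis
    using path_simplex_singular[OF assms(1)]
    by (simp add: b coboundary_def constant_system_def Let_def finsum_regular_module)
       (simp add: regular_module_def)
qed

lemma cohomology_class: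
  assumes "\<xi> \<in> carrier (integral_cohomology X 1)"
  obtains z where "z \<in> cocycles X (constant_system regular_module) 1" "\<xi> \<noteq> {}"
    "\<And>f. f \<in> \<xi> \<Longrightarrow> \<exists>b\<in>coboundaries X (constant_system regular_module) 1.
       \<forall>s\<in>singular_simplex_set 1 X. f s = b s + z s"
proof -
  obtain z where z: "z \<in> cocycles X (constant_system regular_module) 1"
    "\<xi> = coboundaries X (constant_system regular_module) 1 +>\<^bsub>cochains X (constant_system regular_module) 1\<lparr>carrier := cocycles X (constant_system regular_module) 1\<rparr>\<^esub> z"
    using assms
    by (auto simp: integral_cohomology_def cohomology_def quotient_module_def A_RCOSETS_def RCOSETS_def a_r_coset_def)
  have "carrier (cochains X (constant_system (regular_module :: (int,int) module)) 0) \<noteq> {}"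
    by (auto simp: cochains_def Let_def PiE_eq_empty_iff constant_system_def regular_module_def)
  then have "\<xi> \<noteq> {}"
    using z(2) by (auto simp: a_r_coset_def r_coset_def coboundaries_def)
  moreover have "\<exists>b\<in>coboundaries X (constant_system regular_module) 1.
       \<forall>s\<in>singular_simplex_set 1 X. f s = b s + z s" if "f \<in> \<xi>" for f
    using that unfolding z(2)
    by (auto simp: a_r_coset_def r_coset_def cochains_def Let_def constant_system_def)
       (auto simp: regular_module_def)
  ultimately show ?thesis using that z(1) by blast
qed

lemma pairing_eq:
  assumes "\<xi> \<in> carrier (integral_cohomology X 1)" "pathin X g" "g 0 = g 1" "f \<in> \<xi>"
  shows "pairing \<xi> g = f (path_simplex g)"
proof -
  obtain z where "\<And>f. f \<in> \<xi> \<Longrightarrow> \<exists>b\<in>coboundaries X (constant_system regular_module) 1.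
       \<forall>s\<in>singular_simplex_set 1 X. f s = b s + z s"
    using cohomology_class[OF assms(1)] by metis
  then have z: "h (path_simplex g) = z (path_simplex g)" if "h \<in> \<xi>" for h
    using that path_simplex_singular[OF assms(2)] coboundary_loop[OF assms(2,3)] by fastforce
  show ?thesis
    unfolding pairing_def using assms(4) by (intro the_equality) (auto simp: z)
qed

lemma vs_dim_regular_module: "vs_dim (regular_module :: ('k::field,'k) module) = 1"
proof -
  let ?M = "regular_module :: ('k,'k) module"
  interpret vectorspace class_ring ?M
    using regular_module class_field by (simp add: vectorspace_def)
  have c: "carrier ?M = UNIV" and z: "zero ?M = 0" and s: "smult ?M = (*)" 
    by (auto simp: regular_module_def)
  have "x \<in> span {1}" for x
    unfolding span_def lincomb_def
    by (rule CollectI, rule exI[of _ "\<lambda>_. x"], rule exI[of _ "{1}"])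
       (auto simp: finsum_regular_module s)
  then have g: "gen_set {1}" by (auto simp: c)
  have li: "lin_indpt {1}"
    by (auto simp: lin_dep_def lincomb_def finsum_regular_module s z subset_singleton_iff)
  have "basis {1}" using g li by (auto simp: basis_def c)
  moreover have "fin_dim" using g by (auto simp: fin_dim_def c intro!: exI[of _ "{1}"])
  ultimately show ?thesis
    using dim_basis[of "{1}"] by (simp add: vs_dim_def one_enat_def)
qed

lemma rank_one_system_exists:
  fixes a :: "'k::field" and X :: "'x topology"
  assumes "\<xi> \<in> carrier (integral_cohomology X 1)" "a \<noteq> 0"
  shows "\<exists>L :: ('x, 'k, 'k) local_system_data. rank_one_local_system X L \<and> has_monodromy X \<xi> a L"
proof -
  obtain z where z: "z \<in> cocycles X (constant_system regular_module) 1" "\<xi> \<noteq> {}"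
    "\<And>f. f \<in> \<xi> \<Longrightarrow> \<exists>b\<in>coboundaries X (constant_system regular_module) 1.
       \<forall>s\<in>singular_simplex_set 1 X. f s = b s + z s"
    using cohomology_class[OF assms(1)] by metis
  define L :: "('x, 'k, 'k) local_system_data" where
    "L = \<lparr>fibre = (\<lambda>_. regular_module), transport = (\<lambda>g v. a powi z (path_simplex g) * v)\<rparr>"
  have "local_system X L"
    unfolding local_system_def
    using regular_module cocycle_const[OF z(1)] cocycle_concat[OF z(1)] cocycle_homotopic[OF z(1)] assms(2)
    by (auto simp: L_def module_hom_def power_int_add) (auto simp: regular_module_def algebra_simps)
  then have "rank_one_local_system X L"
    by (simp add: rank_one_local_system_def L_def vs_dim_regular_module)
  moreover have "pairing \<xi> g = z (path_simplex g)" if "pathin X g" "g 0 = g 1" for g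
  proof -
    obtain f where "f \<in> \<xi>" using z(2) by blast
    then show ?thesis
      using pairing_eq[OF assms(1) that] z(3) path_simplex_singular[OF that(1)] coboundary_loop[OF that] by fastforce
  qed
  then have "has_monodromy X \<xi> a L"
    by (auto simp: has_monodromy_def L_def) (auto simp: regular_module_def)
  ultimately show ?thesis by blast
qed

end

theory Submission
  imports Defs
begin

text \<open>
  A cocycle \<open>z\<close> representing \<open>\<xi>\<close> turns the singular chains of \<open>X\<close> into a complex over the principal
  ideal domain \<open>\<rat>[t, t\<^sup>-\<^sup>1]\<close>, in which the leading face is weighted by \<open>t\<close> to the power of \<open>z\<close> on the
  leading edge. A manifold is locally contractible, so a Mayer--Vietoris induction over small open
  sets, due to Wilder, shows that the homology of this complex is finitely generated. Hence the complex becomes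
  acyclic, and thereby contractible, after attaching finitely many generators in each degree.

  Trivialising the rank one system with monodromy \<open>a\<close> identifies its cochains with the cochains
  obtained by specialising \<open>t\<close> to \<open>a\<close>. Contractibility is preserved by specialisation, so that
  \<open>dim H\<^sup>q\<close> is the number of attached generators of degree \<open>q + 1\<close> minus the ranks of two finite
  matrices of Laurent polynomials evaluated at \<open>a\<close>. These ranks are largest at the indeterminate
  \<open>\<tau>\<close>, and they attain the same value at \<open>a\<close> unless \<open>a\<close> is a zero of one of two nonzero Laurent
  polynomials over \<open>\<rat>\<close>.
\<close>

section \<open>Chains over a commutative ring\<close>

text \<open>The coefficients are rational because \<rat>[t, 1/t] is a principal ideal domain and
  \<int>[t, 1/t] is not. A closed topological manifold is given here without a triangulation or a
  cell structure, so there is no finite chain complex to start from; a finite model has to be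
  extracted from finite generation of homology alone. Write C for the twisted singular complex and K
  for its acyclic extension. K is free and bounded below, hence has a contraction. A contraction is
  a system of identities between chains and is therefore inherited under every change of rings,
  which acyclicity as such is not. The quotient K/C is free on the attached generators, and the
  connecting homomorphism identifies degree q cohomology of the specialised C with degree q + 1
  cohomology of the specialised K/C: this is the origin of the shift by one, and the two matrices
  are coboundaries of K/C. Ranks are compared without determinants: a primitive relation between
  columns stays nontrivial under every ring map, and a dual system of functionals with cleared
  denominators bounds ranks from below.\<close>

abbreviation supp :: "('b \<Rightarrow>\<^sub>0 'r::zero) \<Rightarrow> 'b set" where "supp \<equiv> Poly_Mapping.keys"
abbreviation coef :: "('b \<Rightarrow>\<^sub>0 'r::zero) \<Rightarrow> 'b \<Rightarrow> 'r" where "coef \<equiv> Poly_Mapping.lookup"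
abbreviation sgl :: "'b \<Rightarrow> 'r \<Rightarrow> 'b \<Rightarrow>\<^sub>0 'r::zero" where "sgl \<equiv> Poly_Mapping.single"

definition cscale :: "'r::comm_ring_1 \<Rightarrow> ('b \<Rightarrow>\<^sub>0 'r) \<Rightarrow> 'b \<Rightarrow>\<^sub>0 'r" where
  "cscale r c = Poly_Mapping.map ((*) r) c"

lemma lookup_cscale [simp]: "coef (cscale r c) k = r * coef c k"
  unfolding cscale_def by (simp add: Poly_Mapping.map.rep_eq when_def)

lemma module_cscale: "Modules.module cscale"
  by unfold_locales (auto intro!: poly_mapping_eqI simp: lookup_add algebra_simps)

interpretation ch: Modules.module "cscale :: 'r::comm_ring_1 \<Rightarrow> ('b \<Rightarrow>\<^sub>0 'r) \<Rightarrow> 'b \<Rightarrow>\<^sub>0 'r"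
  by (rule module_cscale)

lemma keys_cscale: "supp (cscale r c) \<subseteq> supp c"
  by (auto simp: in_keys_iff)

lemma cscale_single [simp]: "cscale r (sgl b x) = sgl b (r * x)"
  by (rule poly_mapping_eqI) (simp add: lookup_single when_def)

abbreviation chains_on :: "'b set \<Rightarrow> ('b \<Rightarrow>\<^sub>0 'r::comm_ring_1) set" where
  "chains_on S \<equiv> {c. supp c \<subseteq> S}"

lemma subspace_chains_on: "ch.subspace (chains_on S)"
proof (rule ch.subspaceI)
  fix c d :: "'b \<Rightarrow>\<^sub>0 'a"
  assume "c \<in> chains_on S" "d \<in> chains_on S"
  then show "c + d \<in> chains_on S" using keys_add[of c d] by auto
next
  fix r and c :: "'b \<Rightarrow>\<^sub>0 'a"
  assume "c \<in> chains_on S"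
  then show "cscale r c \<in> chains_on S" using keys_cscale[of r c] by auto
qed simp

text \<open>The action \<open>sc\<close> is a parameter because chains are extended to three kinds
  of targets: chains over the same ring, chains over \<open>'r\<close> starting from integral
  chains, and values of cochains in a field on which \<open>'r\<close> acts through an
  evaluation.\<close>

definition linext :: "('r::comm_ring_1 \<Rightarrow> 'v::ab_group_add \<Rightarrow> 'v) \<Rightarrow> ('b \<Rightarrow> 'v) \<Rightarrow> ('b \<Rightarrow>\<^sub>0 'r) \<Rightarrow> 'v" where
  "linext sc \<phi> c = (\<Sum>b\<in>supp c. sc (coef c b) (\<phi> b))"

locale ring_action = Modules.module sc for sc :: "'r::comm_ring_1 \<Rightarrow> 'v::ab_group_add \<Rightarrow> 'v"
begin

lemma linext_superset:
  assumes "finite A" "supp c \<subseteq> A"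
  shows "linext sc \<phi> c = (\<Sum>b\<in>A. sc (coef c b) (\<phi> b))"
  unfolding linext_def by (rule sum.mono_neutral_left) (use assms in \<open>auto simp: in_keys_iff\<close>)

lemma linext_0 [simp]: "linext sc \<phi> 0 = 0"
  by (simp add: linext_def)

lemma linext_single [simp]: "linext sc \<phi> (sgl b r) = sc r (\<phi> b)"
  by (subst linext_superset[of "{b}"]) auto

lemma linext_add: "linext sc \<phi> (c + d) = linext sc \<phi> c + linext sc \<phi> d"
proof -
  let ?A = "supp c \<union> supp d"
  have "supp (c + d) \<subseteq> ?A" by (rule keys_add)
  then show ?thesis
    by (simp add: linext_superset[of ?A] lookup_add scale_left_distrib sum.distrib)
qed

lemma linext_cscale: "linext sc \<phi> (cscale r c) = sc r (linext sc \<phi> c)"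
  by (simp add: linext_superset[of "supp c" "cscale r c"] keys_cscale scale_sum_right) (simp add: linext_def scale_sum_right)

lemma module_hom_linext: "Modules.module_hom cscale sc (linext sc \<phi>)"
  by unfold_locales (auto simp: linext_add linext_cscale)

lemma linext_uminus: "linext sc \<phi> (- c) = - linext sc \<phi> c"
  using Modules.module_hom.neg[OF module_hom_linext] .

lemma linext_diff: "linext sc \<phi> (c - d) = linext sc \<phi> c - linext sc \<phi> d"
  using Modules.module_hom.diff[OF module_hom_linext] .

lemma linext_sum: "linext sc \<phi> (\<Sum>i\<in>I. g i) = (\<Sum>i\<in>I. linext sc \<phi> (g i))"
  using Modules.module_hom.sum[OF module_hom_linext] .

lemma linext_fun_add: "linext sc (\<lambda>b. \<phi> b + \<psi> b) c = linext sc \<phi> c + linext sc \<psi> c"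
  by (simp add: linext_def scale_right_distrib sum.distrib)

lemma linext_fun_diff: "linext sc (\<lambda>b. \<phi> b - \<psi> b) c = linext sc \<phi> c - linext sc \<psi> c"
  by (simp add: linext_def scale_right_diff_distrib sum_subtractf)

lemma linext_fun_0 [simp]: "linext sc (\<lambda>b. 0) c = 0"
  by (simp add: linext_def)

lemma linext_fun_sum: "linext sc (\<lambda>b. \<Sum>i\<in>I. \<phi> i b) c = (\<Sum>i\<in>I. linext sc (\<phi> i) c)"
  by (induct I rule: infinite_finite_induct) (auto simp: linext_fun_add)

lemma linext_in_subspace:
  assumes "subspace V" "\<And>b. b \<in> supp c \<Longrightarrow> \<phi> b \<in> V"
  shows "linext sc \<phi> c \<in> V"
  unfolding linext_def using assms by (intro subspace_sum subspace_scale)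

end

lemma linext_cong: "(\<And>b. b \<in> supp c \<Longrightarrow> \<phi> b = \<psi> b) \<Longrightarrow> linext sc \<phi> c = linext sc \<psi> c"
  unfolding linext_def by (rule sum.cong) auto

lemma ring_action_cscale: "ring_action cscale"
  by (simp add: ring_action_def module_cscale)

interpretation ca: ring_action "cscale :: 'r::comm_ring_1 \<Rightarrow> ('b \<Rightarrow>\<^sub>0 'r) \<Rightarrow> 'b \<Rightarrow>\<^sub>0 'r"
  by (rule ring_action_cscale)

lemma (in ring_action) linext_linext:
  "linext sc \<phi> (linext cscale \<psi> c) = linext sc (\<lambda>b. linext sc \<phi> (\<psi> b)) c"
  by (simp add: linext_def[of cscale] linext_def[of sc _ c] linext_sum linext_cscale)

lemma linext_id [simp]: "linext cscale (\<lambda>b. sgl b 1) c = c"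
proof -
  have "coef (\<Sum>b\<in>I. sgl b (coef c b)) j =
          (if j \<in> I then coef c j else 0)" if "finite I" for I j
    using that by (induct I) (auto simp: lookup_single lookup_add when_def)
  then show ?thesis
    unfolding linext_def by (intro poly_mapping_eqI) (auto simp: in_keys_iff)
qed

lemma keys_linext: "(\<And>b. b \<in> supp c \<Longrightarrow> supp (\<phi> b) \<subseteq> S) \<Longrightarrow> supp (linext cscale \<phi> c) \<subseteq> S"
  using ca.linext_in_subspace[OF subspace_chains_on, of c \<phi> S] by blast

lemma lookup_linext: "coef (linext cscale \<phi> c) k = (\<Sum>b\<in>supp c. coef c b * coef (\<phi> b) k)"
  by (simp add: linext_def lookup_sum)

lemma chains_on_span: "chains_on S = ch.span ((\<lambda>b. sgl b 1) ` S)"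
proof (intro subset_antisym subsetI)
  fix c :: "'a \<Rightarrow>\<^sub>0 'b" assume "c \<in> chains_on S"
  then have "linext cscale (\<lambda>b. sgl b 1) c \<in> ch.span ((\<lambda>b. sgl b 1) ` S)"
    by (intro ca.linext_in_subspace[OF ch.subspace_span] ch.span_base) auto
  then show "c \<in> ch.span ((\<lambda>b. sgl b 1) ` S)" by simp
next
  fix c :: "'a \<Rightarrow>\<^sub>0 'b" assume "c \<in> ch.span ((\<lambda>b. sgl b 1) ` S)"
  moreover have "(\<lambda>b. sgl b 1) ` S \<subseteq> (chains_on S :: ('a \<Rightarrow>\<^sub>0 'b) set)" by auto
  ultimately show "c \<in> chains_on S"
    using ch.span_minimal[OF _ subspace_chains_on[of S]] by blast
qed

section \<open>Principal ideal rings and finitely generated submodules\<close>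

definition principal_ring :: "'r::comm_ring_1 itself \<Rightarrow> bool" where
  "principal_ring _ \<longleftrightarrow> (\<forall>I :: 'r set. Modules.module.subspace (*) I \<longrightarrow> (\<exists>g. I = range (\<lambda>r. r * g)))"

lemma module_times: "Modules.module ((*) :: 'r::comm_ring_1 \<Rightarrow> 'r \<Rightarrow> 'r)"
  by unfold_locales (auto simp: algebra_simps)

text \<open>For a new generator \<open>a\<close>, the coefficients with which \<open>a\<close> can
  occur in elements of \<open>V\<close> form an ideal \<open>?I\<close>. An element
  \<open>x0\<close> of \<open>V\<close> that realises a generator of this ideal reduces every
  element of \<open>V\<close> to one in the span of the remaining generators. As the generators may
  satisfy relations, such coefficients are not unique, whence the existential in
  \<open>?I\<close>.\<close>

lemma (in Modules.module) fg_subspace: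
  assumes P: "principal_ring TYPE('a)" and "finite F" "subspace V" "V \<subseteq> span F"
  shows "\<exists>G. finite G \<and> V = span G"
  using assms(2-4)
proof (induct F arbitrary: V)
  case empty
  then have "V = span {}" using subspace_0 by auto
  then show ?case by blast
next
  case (insert a F)
  let ?I = "{k. \<exists>x\<in>V. x - scale k a \<in> span F}"
  interpret R: Modules.module "(*) :: 'a \<Rightarrow> 'a \<Rightarrow> 'a" by (rule module_times)
  have "R.subspace ?I"
  proof (rule R.subspaceI)
    show "0 \<in> ?I" using subspace_0[OF insert(4)] span_zero by force
  next
    fix k l assume "k \<in> ?I" "l \<in> ?I"
    then obtain x y where "x \<in> V" "y \<in> V" "x - scale k a \<in> span F" "y - scale l a \<in> span F" by auto
    then have "x + y \<in> V" "(x + y) - scale (k + l) a \<in> span F"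
      using subspace_add[OF insert(4)] span_add[of "x - scale k a" F "y - scale l a"] by (auto simp: scale_left_distrib algebra_simps)
    then show "k + l \<in> ?I" by auto
  next
    fix c k assume "k \<in> ?I"
    then obtain x where "x \<in> V" "x - scale k a \<in> span F" by auto
    then have "scale c x \<in> V" "scale c x - scale (c * k) a \<in> span F"
      using subspace_scale[OF insert(4)] span_scale[of "x - scale k a" F c] by (auto simp: scale_right_diff_distrib)
    then show "c * k \<in> ?I" by auto
  qed
  then obtain g where g: "?I = range (\<lambda>r. r * g)" using P unfolding principal_ring_def by blast
  have "g \<in> ?I" unfolding g by (rule range_eqI[of _ _ 1]) simp
  then obtain x0 where x0: "x0 \<in> V" "x0 - scale g a \<in> span F" by auto
  obtain G where G: "finite G" "V \<inter> span F = span G"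
    using insert(3)[of "V \<inter> span F"] insert(4) by (auto intro: subspace_inter)
  have "V = span (insert x0 G)"
  proof (intro subset_antisym)
    have "G \<subseteq> V" using G(2) span_superset by blast
    then show "span (insert x0 G) \<subseteq> V" using x0 insert(4) by (intro span_minimal) auto
    show "V \<subseteq> span (insert x0 G)"
    proof
      fix x assume x: "x \<in> V"
      then obtain k where k: "x - scale k a \<in> span F"
        using insert(5) span_breakdown_eq by blast
      then have "k \<in> ?I" using x by auto
      then obtain r where r: "k = r * g" using g by auto
      have eq: "x - scale r x0 = (x - scale k a) - scale r (x0 - scale g a)"
        by (simp add: r scale_right_diff_distrib)
      have "x - scale r x0 \<in> span F" using span_diff[OF k span_scale[OF x0(2), of r]] by (simp only: eq)
      moreover have "x - scale r x0 \<in> V" using x x0(1) insert(4) by (simp add: subspace_diff subspace_scale)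
      ultimately show "x \<in> span (insert x0 G)" unfolding span_breakdown_eq[of x x0 G] using G(2) by blast
    qed
  qed
  then show ?case using G(1) by blast
qed

text \<open>In this form the coefficients \<open>c\<close> of a combination can be reused with
  another family, for instance with chosen preimages of the generators.\<close>

lemma (in Modules.module) span_linext:
  "x \<in> span (f ` A) \<longleftrightarrow> (\<exists>c. supp c \<subseteq> A \<and> x = linext scale f c)"
proof
  interpret ring_action scale by unfold_locales
  assume "x \<in> span (f ` A)"
  then show "\<exists>c. supp c \<subseteq> A \<and> x = linext scale f c"
  proof (induct rule: span_induct_alt)
    case base
    show ?case by (rule exI[of _ 0]) auto
  next
    case (step r y z)
    then obtain b c where "b \<in> A" "y = f b" "supp c \<subseteq> A" "z = linext scale f c" by auto
    moreover from this have "supp (sgl b r + c) \<subseteq> A"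
      using keys_add[of "sgl b r" c] by (auto split: if_splits)
    ultimately show ?case
      by (intro exI[of _ "sgl b r + c"]) (auto simp: linext_add)
  qed
next
  interpret ring_action scale by unfold_locales
  assume "\<exists>c. supp c \<subseteq> A \<and> x = linext scale f c"
  then show "x \<in> span (f ` A)"
    by (auto intro!: linext_in_subspace[OF subspace_span] intro: span_base)
qed

section \<open>Acyclic extensions of complexes\<close>

text \<open>A complex of free modules, given by bases and the boundary on basis elements. All
  degrees share one type of basis elements, so every condition is relative to the sets
  \<open>S q\<close>, and \<open>bd\<close> is arbitrary outside them.\<close>

locale based_complex =
  fixes S :: "nat \<Rightarrow> 's set" and bd :: "nat \<Rightarrow> 's \<Rightarrow> 's \<Rightarrow>\<^sub>0 'r::comm_ring_1"
  assumes supp_bd: "s \<in> S (Suc q) \<Longrightarrow> supp (bd (Suc q) s) \<subseteq> S q"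
    and bd_0: "s \<in> S 0 \<Longrightarrow> bd 0 s = 0"
    and bd_bd: "s \<in> S (Suc q) \<Longrightarrow> linext cscale (bd q) (bd (Suc q) s) = 0"
begin

abbreviation Bd :: "nat \<Rightarrow> ('s \<Rightarrow>\<^sub>0 'r) \<Rightarrow> 's \<Rightarrow>\<^sub>0 'r" where
  "Bd q \<equiv> linext cscale (bd q)"

lemma supp_Bd: "supp c \<subseteq> S (Suc q) \<Longrightarrow> supp (Bd (Suc q) c) \<subseteq> S q"
  by (rule keys_linext) (use supp_bd in blast)

lemma Bd_Bd: "supp c \<subseteq> S (Suc q) \<Longrightarrow> Bd q (Bd (Suc q) c) = 0"
proof -
  assume "supp c \<subseteq> S (Suc q)"
  then have "linext cscale (\<lambda>s. Bd q (bd (Suc q) s)) c = linext cscale (\<lambda>_. 0) c"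
    by (intro linext_cong) (use bd_bd in blast)
  then show ?thesis by (simp add: ca.linext_linext)
qed

text \<open>Free modules allow \<open>h\<close> to be chosen on the basis, one degree at a time.
  Degree 0 is a separate hypothesis so that the lemma covers both the identity of an acyclic complex
  and the identity minus an augmentation on a contractible space. For \<open>q = 0\<close> the term
  with \<open>h (q - 1)\<close>, that is \<open>h 0\<close>, vanishes because \<open>bd 0\<close>
  does.\<close>

lemma null_homotopy:
  assumes f0: "\<And>s. s \<in> S 0 \<Longrightarrow> \<exists>c. supp c \<subseteq> S 1 \<and> Bd 1 c = f 0 s"
    and acyclic: "\<And>q c. supp c \<subseteq> S (Suc q) \<Longrightarrow> Bd (Suc q) c = 0 \<Longrightarrow>
       \<exists>c'. supp c' \<subseteq> S (Suc (Suc q)) \<and> Bd (Suc (Suc q)) c' = c"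
    and supp_f: "\<And>q s. s \<in> S q \<Longrightarrow> supp (f q s) \<subseteq> S q"
    and chain_map: "\<And>q s. s \<in> S (Suc q) \<Longrightarrow> Bd (Suc q) (f (Suc q) s) = linext cscale (f q) (bd (Suc q) s)"
  shows "\<exists>h. \<forall>q. \<forall>s\<in>S q. supp (h q s) \<subseteq> S (Suc q) \<and>
     Bd (Suc q) (h q s) = f q s - linext cscale (h (q - 1)) (bd q s)"
proof -
  define h where "h = rec_nat (\<lambda>s. SOME c. supp c \<subseteq> S 1 \<and> Bd 1 c = f 0 s)
     (\<lambda>q hq s. SOME c. supp c \<subseteq> S (Suc (Suc q)) \<and>
        Bd (Suc (Suc q)) c = f (Suc q) s - linext cscale hq (bd (Suc q) s))"
  have h0: "h 0 s = (SOME c. supp c \<subseteq> S 1 \<and> Bd 1 c = f 0 s)"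
    and hS: "h (Suc q) s = (SOME c. supp c \<subseteq> S (Suc (Suc q)) \<and>
        Bd (Suc (Suc q)) c = f (Suc q) s - linext cscale (h q) (bd (Suc q) s))" for q s
    by (simp_all add: h_def)
  have "\<forall>s\<in>S q. supp (h q s) \<subseteq> S (Suc q) \<and>
     Bd (Suc q) (h q s) = f q s - linext cscale (h (q - 1)) (bd q s)" for q
  proof (induct q)
    case 0
    show ?case
      using someI_ex[OF f0] by (auto simp: h0 bd_0)
  next
    case (Suc q)
    show ?case
    proof
      fix s assume s: "s \<in> S (Suc q)"
      \<comment> \<open>The chain that \<open>h (Suc q) s\<close> has to bound. It is a cycle by the
        homotopy identity in degree \<open>q\<close>.\<close>
      let ?z = "f (Suc q) s - linext cscale (h q) (bd (Suc q) s)"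
      have sb: "supp (bd (Suc q) s) \<subseteq> S q" by (rule supp_bd[OF s])
      have "supp (linext cscale (h q) (bd (Suc q) s)) \<subseteq> S (Suc q)"
        by (rule keys_linext) (use Suc sb in blast)
      then have z1: "supp ?z \<subseteq> S (Suc q)"
        using ch.subspace_diff[OF subspace_chains_on, of "f (Suc q) s" "S (Suc q)"] supp_f[OF s] by blast
      have "Bd (Suc q) (linext cscale (h q) (bd (Suc q) s)) = linext cscale (\<lambda>t. Bd (Suc q) (h q t)) (bd (Suc q) s)"
        by (rule ca.linext_linext)
      also have "\<dots> = linext cscale (\<lambda>t. f q t - linext cscale (h (q - 1)) (bd q t)) (bd (Suc q) s)"
        by (rule linext_cong) (use Suc sb in blast)
      also have "\<dots> = linext cscale (f q) (bd (Suc q) s) - linext cscale (h (q - 1)) (Bd q (bd (Suc q) s))"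
        by (simp add: ca.linext_fun_diff ca.linext_linext)
      finally have "Bd (Suc q) ?z = 0"
        by (simp add: ca.linext_diff chain_map[OF s] bd_bd[OF s])
      from someI_ex[OF acyclic[OF z1 this]]
      show "supp (h (Suc q) s) \<subseteq> S (Suc (Suc q)) \<and>
         Bd (Suc (Suc q)) (h (Suc q) s) = f (Suc q) s - linext cscale (h (Suc q - 1)) (bd (Suc q) s)"
        by (simp add: hS)
    qed
  qed
  then show ?thesis by blast
qed

text \<open>Degree 0 is included without augmentation: every 0-chain on \<open>S 0\<close> is a
  cycle and has to bound.\<close>

definition acyclic :: bool where
  "acyclic \<longleftrightarrow> (\<forall>q c. supp c \<subseteq> S q \<and> Bd q c = 0 \<longrightarrow> (\<exists>c'. supp c' \<subseteq> S (Suc q) \<and> Bd (Suc q) c' = c))"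

lemma contraction:
  assumes acyclic
  obtains h where "\<And>q s. s \<in> S q \<Longrightarrow> supp (h q s) \<subseteq> S (Suc q)"
    "\<And>q s. s \<in> S q \<Longrightarrow> Bd (Suc q) (h q s) = sgl s 1 - linext cscale (h (q - 1)) (bd q s)"
proof -
  have "\<exists>h. \<forall>q. \<forall>s\<in>S q. supp (h q s) \<subseteq> S (Suc q) \<and>
     Bd (Suc q) (h q s) = sgl s 1 - linext cscale (h (q - 1)) (bd q s)"
  proof (rule null_homotopy)
    fix s assume "s \<in> S 0"
    then have "supp (sgl s (1::'r)) \<subseteq> S 0" "Bd 0 (sgl s 1) = 0" by (auto simp: bd_0)
    then show "\<exists>c. supp c \<subseteq> S 1 \<and> Bd 1 c = sgl s 1"
      using assms unfolding acyclic_def One_nat_def by blast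
  qed (use assms in \<open>auto simp: acyclic_def split: if_splits\<close>)
  then show ?thesis using that by blast
qed

text \<open>Applying \<phi> to the contraction identity, boundary of \<open>h s\<close> =
  \<open>s\<close> minus \<open>h\<close> of the boundary of \<open>s\<close>, kills the left side
  because \<phi> is a cocycle. Hence \<phi> is the coboundary of \<phi> composed with
  \<open>h\<close>. The contraction lives over \<open>'r\<close> and is only evaluated through
  \<open>ev\<close>, so acyclicity over \<open>'r\<close> serves every specialisation.\<close>

lemma acyclic_cochain:
  fixes ev :: "'r \<Rightarrow> 'f::comm_ring_1"
  assumes "acyclic" and ev: "Modules.module (\<lambda>r x. ev r * x)"
    and cocycle: "\<And>s. s \<in> S (Suc q) \<Longrightarrow> linext (\<lambda>r x. ev r * x) \<phi> (bd (Suc q) s) = 0"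
  shows "\<exists>\<psi>. \<forall>s\<in>S q. \<phi> s = linext (\<lambda>r x. ev r * x) \<psi> (bd q s)"
proof -
  let ?p = "linext (\<lambda>r x. ev r * x)"
  interpret e: ring_action "\<lambda>r x. ev r * x" using ev by (simp add: ring_action_def)
  obtain h where h: "\<And>q s. s \<in> S q \<Longrightarrow> supp (h q s) \<subseteq> S (Suc q)"
    "\<And>q s. s \<in> S q \<Longrightarrow> Bd (Suc q) (h q s) = sgl s 1 - linext cscale (h (q - 1)) (bd q s)"
    using contraction[OF assms(1)] by blast
  have "\<phi> s = ?p (\<lambda>t. ?p \<phi> (h (q - 1) t)) (bd q s)" if s: "s \<in> S q" for s
  proof -
    have "?p \<phi> (Bd (Suc q) (h q s)) = ?p (\<lambda>t. ?p \<phi> (bd (Suc q) t)) (h q s)"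
      by (rule e.linext_linext)
    also have "\<dots> = ?p (\<lambda>_. 0) (h q s)"
      by (rule linext_cong) (use cocycle h(1)[OF s] in blast)
    finally have "?p \<phi> (sgl s 1) = ?p (\<lambda>t. ?p \<phi> (h (q - 1) t)) (bd q s)"
      by (simp add: h(2)[OF s] e.linext_diff e.linext_linext)
    then show ?thesis using e.scale_one[of "\<phi> s"] by simp
  qed
  then show ?thesis by blast
qed

end

section \<open>Attaching generators to a complex\<close>

definition inl_chain :: "('s \<Rightarrow>\<^sub>0 'r::comm_ring_1) \<Rightarrow> 's + 't \<Rightarrow>\<^sub>0 'r" where
  "inl_chain = linext cscale (\<lambda>s. sgl (Inl s) 1)"

text \<open>\<open>d\<close> and \<open>xs\<close> belong to the same degree. The entry
  \<open>xs ! j\<close> is the boundary of the new generator \<open>Inr j\<close>, hence a chain one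
  degree lower, which may involve generators attached there.\<close>

fun attach_bd :: "('s \<Rightarrow> 's \<Rightarrow>\<^sub>0 'r::comm_ring_1) \<Rightarrow> ('s + nat \<Rightarrow>\<^sub>0 'r) list \<Rightarrow> 's + nat \<Rightarrow> 's + nat \<Rightarrow>\<^sub>0 'r" where
  "attach_bd d xs (Inl s) = inl_chain (d s)"
| "attach_bd d xs (Inr j) = xs ! j"

definition attach_basis :: "'s set \<Rightarrow> 'a list \<Rightarrow> ('s + nat) set" where
  "attach_basis A xs = Inl ` A \<union> Inr ` {..<length xs}"

lemma linext_inl: 
  assumes "Modules.module sc" 
  shows "linext sc \<phi> (inl_chain c) = linext sc (\<lambda>s. \<phi> (Inl s)) c"
proof -
  interpret ring_action sc using assms by (simp add: ring_action_def)
  show ?thesis by (simp add: inl_chain_def linext_linext)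
qed

lemma attach_inl: "linext cscale (attach_bd d xs) (inl_chain c) = inl_chain (linext cscale d c)"
  by (simp add: linext_inl module_cscale) (simp add: inl_chain_def ca.linext_linext)

lemma supp_inl: "supp c \<subseteq> A \<Longrightarrow> supp (inl_chain c) \<subseteq> Inl ` A"
  unfolding inl_chain_def by (rule keys_linext) auto

lemma inl_surj:
  fixes z :: "'s + 't \<Rightarrow>\<^sub>0 'r::comm_ring_1"
  assumes "supp z \<subseteq> Inl ` A"
  obtains c where "supp c \<subseteq> A" "z = inl_chain c"
proof
  let ?c = "linext cscale (case_sum (\<lambda>s. sgl s 1) (\<lambda>_. 0)) z"
  show "supp ?c \<subseteq> A"
    by (rule keys_linext) (use assms in \<open>auto split: sum.splits\<close>)
  have "inl_chain ?c = linext cscale (\<lambda>b. inl_chain (case_sum (\<lambda>s. sgl s 1) (\<lambda>_. 0) b)) z"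
    unfolding inl_chain_def by (rule ca.linext_linext)
  also have "\<dots> = linext cscale (\<lambda>b. sgl b 1) z"
    by (rule linext_cong) (use assms in \<open>auto simp: inl_chain_def\<close>)
  finally show "z = inl_chain ?c" by simp
qed

locale fg_complex = based_complex S bd for S and bd :: "nat \<Rightarrow> 's \<Rightarrow> 's \<Rightarrow>\<^sub>0 'r::comm_ring_1" +
  assumes principal: "principal_ring TYPE('r)"
    and fg_homology: "\<And>q. \<exists>F. finite F \<and> (\<forall>f\<in>F. supp f \<subseteq> S q \<and> Bd q f = 0) \<and>
       (\<forall>c. supp c \<subseteq> S q \<and> Bd q c = 0 \<longrightarrow> (\<exists>f\<in>ch.span F. \<exists>b. supp b \<subseteq> S (Suc q) \<and> c = f + Bd (Suc q) b))"
begin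

definition attached_cycles :: "nat \<Rightarrow> ('s + nat \<Rightarrow>\<^sub>0 'r) list \<Rightarrow> ('s + nat \<Rightarrow>\<^sub>0 'r) set" where
  "attached_cycles q xs = {z. supp z \<subseteq> attach_basis (S q) xs \<and> linext cscale (attach_bd (bd q) xs) z = 0}"

lemma subspace_attached_cycles: "ch.subspace (attached_cycles q xs)"
proof -
  have "attached_cycles q xs = chains_on (attach_basis (S q) xs) \<inter> {z. linext cscale (attach_bd (bd q) xs) z = 0}"
    by (auto simp: attached_cycles_def)
  moreover have "ch.subspace {z. linext cscale (attach_bd (bd q) xs) z = 0}"
    by (rule Modules.module_hom.subspace_kernel[OF ca.module_hom_linext])
  ultimately show ?thesis using ch.subspace_inter[OF subspace_chains_on] by simp
qed

text \<open>The extended complex still has finitely generated homology. The attached parts of its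
  cycles lie in a finite free module, so by \<open>fg_subspace\<close> they are spanned by the
  attached parts of finitely many cycles \<open>w g\<close>. A cycle without attached part belongs
  to the original complex, where \<open>F\<close> generates up to boundaries. The list
  \<open>ys\<close> contains both kinds of cycles.\<close>

lemma kill_homology:
  "\<exists>ys. set ys \<subseteq> attached_cycles q xs \<and> (\<forall>z\<in>attached_cycles q xs.
     \<exists>c. supp c \<subseteq> attach_basis (S (Suc q)) ys \<and> linext cscale (attach_bd (bd (Suc q)) ys) c = z)"
proof -
  let ?Z = "attached_cycles q xs"
  obtain F where F0: "finite F \<and> (\<forall>f\<in>F. supp f \<subseteq> S q \<and> Bd q f = 0) \<and>
     (\<forall>c. supp c \<subseteq> S q \<and> Bd q c = 0 \<longrightarrow> (\<exists>f\<in>ch.span F. \<exists>b. supp b \<subseteq> S (Suc q) \<and> c = f + Bd (Suc q) b))"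
    using fg_homology[of q] ..
  have F: "finite F" "\<And>f. f \<in> F \<Longrightarrow> supp f \<subseteq> S q \<and> Bd q f = 0"
    "\<And>c. supp c \<subseteq> S q \<Longrightarrow> Bd q c = 0 \<Longrightarrow> \<exists>f\<in>ch.span F. \<exists>b. supp b \<subseteq> S (Suc q) \<and> c = f + Bd (Suc q) b"
    using F0 by simp_all
  define \<pi> :: "('s + nat \<Rightarrow>\<^sub>0 'r) \<Rightarrow> 's + nat \<Rightarrow>\<^sub>0 'r" where
    "\<pi> = linext cscale (case_sum (\<lambda>_. 0) (\<lambda>j. sgl (Inr j) 1))"
  interpret pi: Modules.module_hom cscale cscale \<pi> 
    unfolding \<pi>_def by (rule ca.module_hom_linext)
  have coef_pi: "coef (\<pi> z) b = (case b of Inl _ \<Rightarrow> 0 | Inr j \<Rightarrow> coef z (Inr j))" for z b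
  proof -
    have "coef (\<pi> z) b = (\<Sum>x\<in>supp z. coef z x * (case b of Inl _ \<Rightarrow> 0 | Inr j \<Rightarrow> (if x = b then 1 else 0)))"
      unfolding \<pi>_def lookup_linext 
      by (rule sum.cong) (auto simp: lookup_single when_def split: sum.splits)
    also have "\<dots> = (case b of Inl _ \<Rightarrow> 0 | Inr j \<Rightarrow> coef z (Inr j))"
      by (auto simp: if_distrib in_keys_iff split: sum.splits cong: if_cong)
    finally show ?thesis .
  qed
  have sub: "\<pi> ` ?Z \<subseteq> ch.span ((\<lambda>b. sgl b 1) ` (Inr ` {..<length xs} :: ('s + nat) set))"
  proof -
    have "supp (\<pi> z) \<subseteq> Inr ` {..<length xs}" if "z \<in> ?Z" for z
    proof
      fix b assume b: "b \<in> supp (\<pi> z)"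
      then obtain j where "b = Inr j" "coef z (Inr j) \<noteq> 0" 
        by (auto simp: in_keys_iff coef_pi split: sum.splits)
      moreover from this have "Inr j \<in> attach_basis (S q) xs" using that by (auto simp: attached_cycles_def in_keys_iff)
      ultimately show "b \<in> Inr ` {..<length xs}" by (auto simp: attach_basis_def)
    qed
    then show ?thesis unfolding chains_on_span[symmetric] by blast
  qed
  obtain G where G: "finite G" "\<pi> ` ?Z = ch.span G"
    using ch.fg_subspace[OF principal _ pi.subspace_image[OF subspace_attached_cycles] sub] by auto
  then have "G \<subseteq> \<pi> ` ?Z" using ch.span_superset[of G] by simp
  then have "\<forall>g\<in>G. \<exists>z. z \<in> ?Z \<and> \<pi> z = g" by blast
  from bchoice[OF this] obtain w where w0: "\<forall>g\<in>G. w g \<in> ?Z \<and> \<pi> (w g) = g" ..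
  have w: "w g \<in> ?Z" "\<pi> (w g) = g" if "g \<in> G" for g using w0 that by simp_all
  obtain ys where ys: "set ys = w ` G \<union> inl_chain ` F"
    using finite_list[of "w ` G \<union> inl_chain ` F"] G(1) F(1) by auto
  have "inl_chain f \<in> ?Z" if "f \<in> F" for f
    using F(2)[OF that] supp_inl[of f "S q"] 
    by (auto simp: attached_cycles_def attach_inl attach_basis_def) (simp add: inl_chain_def)
  then have "set ys \<subseteq> ?Z" unfolding ys using w(1) by blast
  moreover have "\<exists>c. supp c \<subseteq> attach_basis (S (Suc q)) ys \<and> linext cscale (attach_bd (bd (Suc q)) ys) c = z"
    if z: "z \<in> ?Z" for z
  proof -
    have "\<pi> z \<in> ch.span (\<pi> ` w ` G)"
    proof -
      have "\<pi> ` w ` G = G" using w(2) by (simp add: image_image)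
      then show ?thesis using z by (simp add: G(2)[symmetric])
    qed
    \<comment> \<open>A combination of the chosen cycles with the same attached part as
      \<open>z\<close>; the difference \<open>z - u\<close> then comes from the original
      complex.\<close>
    then obtain u where u: "u \<in> ch.span (w ` G)" "\<pi> u = \<pi> z"
      unfolding pi.span_image by auto
    have "w ` G \<subseteq> ?Z" using w(1) by blast
    from ch.span_minimal[OF this subspace_attached_cycles] u(1) have uZ: "u \<in> ?Z" by blast
    have zu: "z - u \<in> ?Z" using ch.subspace_diff[OF subspace_attached_cycles z uZ] .
    have "supp (z - u) \<subseteq> Inl ` S q"
    proof
      fix b assume b: "b \<in> supp (z - u)"
      then have "b \<in> attach_basis (S q) xs" using zu by (auto simp: attached_cycles_def)
      moreover have "coef (z - u) (Inr j) = 0" for j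
        using arg_cong[OF u(2), of "\<lambda>c. coef c (Inr j)"] by (simp add: coef_pi lookup_minus)
      ultimately show "b \<in> Inl ` S q" using b by (auto simp: attach_basis_def in_keys_iff)
    qed
    then obtain c where c: "supp c \<subseteq> S q" "z - u = inl_chain c" by (rule inl_surj)
    have inj: "c' = 0" if "inl_chain c' = (0 :: 's + nat \<Rightarrow>\<^sub>0 'r)" for c' :: "'s \<Rightarrow>\<^sub>0 'r"
    proof -
      have "linext cscale (case_sum (\<lambda>s. sgl s 1) (\<lambda>_. 0)) (inl_chain c' :: 's + nat \<Rightarrow>\<^sub>0 'r) = c'"
        by (simp add: linext_inl module_cscale)
      then show ?thesis using that by simp
    qed
    have "Bd q c = 0" using zu c(2) by (intro inj) (simp add: attached_cycles_def attach_inl)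
    then obtain f b where fb: "f \<in> ch.span F" "supp b \<subseteq> S (Suc q)" "c = f + Bd (Suc q) b"
      using F(3)[OF c(1)] by blast
    interpret il: Modules.module_hom cscale cscale "inl_chain :: _ \<Rightarrow> 's + nat \<Rightarrow>\<^sub>0 'r"
      unfolding inl_chain_def by (rule ca.module_hom_linext)
    have "inl_chain f \<in> ch.span (inl_chain ` F :: ('s + nat \<Rightarrow>\<^sub>0 'r) set)"
      unfolding il.span_image using fb(1) by blast
    then have "u + inl_chain f \<in> ch.span (set ys)"
      unfolding ys using u(1) by (intro ch.span_add) (auto intro: subsetD[OF ch.span_mono, rotated])
    also have "set ys = attach_bd (bd (Suc q)) ys ` (Inr ` {..<length ys})"
      by (auto simp: image_image set_conv_nth)
    finally obtain c1 where c1: "supp c1 \<subseteq> Inr ` {..<length ys}"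
      "u + inl_chain f = linext cscale (attach_bd (bd (Suc q)) ys) c1"
      unfolding ch.span_linext by blast
    have "z = linext cscale (attach_bd (bd (Suc q)) ys) (c1 + inl_chain b)"
      unfolding ca.linext_add attach_inl c1(2)[symmetric]
      using c(2) fb(3) by (simp add: il.add algebra_simps)
    moreover have "supp (c1 + inl_chain b) \<subseteq> attach_basis (S (Suc q)) ys"
      unfolding attach_basis_def by (rule order.trans[OF keys_add]) (use c1(1) supp_inl[OF fb(2)] in auto)
    ultimately show ?thesis by blast
  qed
  ultimately show ?thesis by blast
qed

text \<open>The list in degree \<open>Suc q\<close> kills all cycles of degree \<open>q\<close> of
  the extension built so far. Lists in higher degrees leave these cycles as they are, so no homology
  reappears.\<close>

lemma attach_acyclic:
  obtains xs :: "nat \<Rightarrow> ('s + nat \<Rightarrow>\<^sub>0 'r) list"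
  where "xs 0 = []"
    "based_complex (\<lambda>q. attach_basis (S q) (xs q)) (\<lambda>q. attach_bd (bd q) (xs q))"
    "based_complex.acyclic (\<lambda>q. attach_basis (S q) (xs q)) (\<lambda>q. attach_bd (bd q) (xs q))"
proof -
  let ?R = "\<lambda>q xs ys. set ys \<subseteq> attached_cycles q xs \<and> (\<forall>z\<in>attached_cycles q xs.
     \<exists>c. supp c \<subseteq> attach_basis (S (Suc q)) ys \<and> linext cscale (attach_bd (bd (Suc q)) ys) c = z)"
  define xs where "xs = rec_nat [] (\<lambda>q xs. SOME ys. ?R q xs ys)"
  have xs: "xs 0 = []" "?R q (xs q) (xs (Suc q))" for q
    using someI_ex[OF kill_homology[of q "xs q"]] by (simp_all add: xs_def)
  let ?B = "\<lambda>q. attach_basis (S q) (xs q)" and ?d = "\<lambda>q. attach_bd (bd q) (xs q)"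
  have *: "supp (?d (Suc q) b) \<subseteq> ?B q \<and> linext cscale (?d q) (?d (Suc q) b) = 0" if b: "b \<in> ?B (Suc q)" for b q
  proof (cases b)
    case (Inl s)
    then have "s \<in> S (Suc q)" using b by (auto simp: attach_basis_def)
    then show ?thesis
      using supp_inl[OF supp_bd] bd_bd Inl
      by (auto simp: attach_inl attach_basis_def) (simp add: inl_chain_def)
  next
    case (Inr j)
    then have "xs (Suc q) ! j \<in> set (xs (Suc q))" using b by (auto simp: attach_basis_def)
    then have "xs (Suc q) ! j \<in> attached_cycles q (xs q)" using xs(2)[of q] by blast
    then show ?thesis using Inr by (simp add: attached_cycles_def)
  qed
  have 0: "?d 0 b = 0" if "b \<in> ?B 0" for b
    using that xs(1) by (auto simp: attach_basis_def bd_0 inl_chain_def)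
  have K: "based_complex ?B ?d"
    by (rule based_complex.intro) (use * 0 in blast)+
  have "based_complex.acyclic ?B ?d"
    unfolding based_complex.acyclic_def[OF K] using xs(2) by (auto simp: attached_cycles_def)
  then show ?thesis using that xs(1) K by blast
qed

end

section \<open>Ranks under specialisation\<close>

interpretation fv: vector_space "cscale :: 'f::field \<Rightarrow> ('b \<Rightarrow>\<^sub>0 'f) \<Rightarrow> 'b \<Rightarrow>\<^sub>0 'f"
  by unfold_locales (auto intro!: poly_mapping_eqI simp: lookup_add algebra_simps)

locale ring_map =
  fixes ev :: "'r::comm_ring_1 \<Rightarrow> 'f::comm_ring_1"
  assumes ev_1 [simp]: "ev 1 = 1" and ev_add: "ev (x + y) = ev x + ev y" and ev_mult: "ev (x * y) = ev x * ev y"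
begin

lemma ev_0 [simp]: "ev 0 = 0"
  using ev_add[of 0 0] by simp

lemma ev_sum: "ev (\<Sum>i\<in>I. f i) = (\<Sum>i\<in>I. ev (f i))"
  by (induct I rule: infinite_finite_induct) (auto simp: ev_add)

lemma ring_action_ev: "ring_action (\<lambda>r x. ev r * x)"
  by unfold_locales (auto simp: ev_add ev_mult algebra_simps)

lemma coef_map [simp]: "coef (Poly_Mapping.map ev c) k = ev (coef c k)"
  by (simp add: Poly_Mapping.map.rep_eq when_def)

end

text \<open>Independence is rephrased for families because one index set is followed through two
  evaluations, under which distinct vectors might become equal.\<close>

lemma (in vector_space) independent_familyD:
  assumes "independent (f ` J)" "finite J" "inj_on f J" "(\<Sum>j\<in>J. scale (c j) (f j)) = 0" "j \<in> J"
  shows "c j = 0"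
proof -
  have "(\<Sum>v\<in>f ` J. scale (c (the_inv_into J f v)) v) = (\<Sum>j\<in>J. scale (c j) (f j))"
    by (subst sum.reindex[OF assms(3)]) (auto intro!: sum.cong simp: the_inv_into_f_f[OF assms(3)])
  with assms(4) have "(\<Sum>v\<in>f ` J. scale (c (the_inv_into J f v)) v) = 0" by simp
  from independentD[OF assms(1) _ order_refl this, of "f j"] assms(2,5)
  show ?thesis by (simp add: the_inv_into_f_f[OF assms(3)])
qed

lemma (in vector_space) independent_familyI:
  assumes "finite J" "\<And>c j. (\<Sum>j\<in>J. scale (c j) (f j)) = 0 \<Longrightarrow> j \<in> J \<Longrightarrow> c j = 0"
  shows "independent (f ` J)" "inj_on f J"
proof -
  show inj: "inj_on f J"
  proof (rule inj_onI, rule ccontr)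
    fix i j assume ij: "i \<in> J" "j \<in> J" "f i = f j" "i \<noteq> j"
    have "(\<Sum>k\<in>J. scale ((if k = i then 1 else 0) - (if k = j then 1 else 0)) (f k))
        = (\<Sum>k\<in>J. if k = i then f k else 0) - (\<Sum>k\<in>J. if k = j then f k else 0)"
      unfolding sum_subtractf[symmetric] by (rule sum.cong) (auto simp: scale_left_diff_distrib)
    also have "\<dots> = 0" using ij assms(1) by simp
    finally have "(if i = i then 1 else 0) - (if i = j then 1 else 0) = (0::'a)"
      by (rule assms(2)) (rule ij(1))
    then show False using ij(4) by simp
  qed
  have "u (f j) = 0" if "(\<Sum>v\<in>f ` J. scale (u v) v) = 0" "j \<in> J" for u j
    using that(1) by (intro assms(2)[of "\<lambda>j. u (f j)"] that(2)) (simp add: sum.reindex[OF inj] o_def)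
  then show "independent (f ` J)"
    using assms(1) by (auto simp: dependent_finite)
qed

lemma (in vector_space) independent_card_le_dim':
  assumes "independent B" "B \<subseteq> span W" "finite W"
  shows "card B \<le> dim W"
proof -
  obtain D where D: "D \<subseteq> W" "independent D" "W \<subseteq> span D" "card D = dim W" by (rule basis_exists)
  have "B \<subseteq> span D" using assms(2) span_mono[OF D(3)] by (auto simp: span_span)
  moreover have "finite D" by (rule finite_subset[OF D(1) assms(3)])
  ultimately have "card B \<le> card D" using independent_span_bound[of D B] assms(1) by simp
  then show ?thesis using D(4) by simp
qed

text \<open>The second hypothesis makes \<open>'k\<close> the field of fractions of the image of
  \<open>evK\<close>; this is how \<rat>(\<tau>) enters the comparison of ranks.\<close>

lemma common_denominator:
  fixes evK :: "'r::idom \<Rightarrow> 'k::field"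
  assumes "ring_map evK" "\<And>x. \<exists>r s. evK s \<noteq> 0 \<and> x * evK s = evK r" "finite J"
  shows "\<exists>s r. evK s \<noteq> 0 \<and> (\<forall>j\<in>J. c j * evK s = evK (r j))"
  using assms(3)
proof (induct J)
  case empty
  interpret ring_map evK by fact
  show ?case by (rule exI[of _ 1]) simp
next
  case (insert j J)
  interpret ring_map evK by fact
  from insert(3) obtain s r where s: "evK s \<noteq> 0 \<and> (\<forall>j\<in>J. c j * evK s = evK (r j))" by (elim exE)
  from assms(2)[of "c j"] obtain r' s' where s': "evK s' \<noteq> 0 \<and> c j * evK s' = evK r'" by (elim exE)
  let ?r = "\<lambda>i. if i = j then r' * s else r i * s'"
  have "c i * evK (s * s') = evK (?r i)" if "i \<in> insert j J" for i
  proof (cases "i = j")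
    case True
    have "c j * (evK s * evK s') = (c j * evK s') * evK s" by (simp only: mult_ac)
    also have "\<dots> = evK r' * evK s" using s' by simp
    finally show ?thesis using True by (simp add: ev_mult)
  next
    case False
    then have "c i * evK s = evK (r i)" using that s by simp
    moreover have "c i * (evK s * evK s') = (c i * evK s) * evK s'" by (simp only: mult_ac)
    ultimately show ?thesis using False by (simp add: ev_mult)
  qed
  moreover have "evK (s * s') \<noteq> 0" using s s' by (simp add: ev_mult)
  ultimately show ?case by (intro exI[of _ "s * s'"] exI[of _ ?r]) simp
qed

text \<open>\<open>g\<close> is a greatest common divisor, found as the generator of the ideal
  spanned by all \<open>r i\<close>, and \<open>t\<close> are Bezout coefficients for the quotients.
  The last equation is preserved by every ring map, so no ring map to a field sends all
  \<open>r' i\<close> to 0.\<close>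

lemma principal_bezout:
  fixes r :: "'i \<Rightarrow> 'r::idom"
  assumes P: "principal_ring TYPE('r)" and J: "finite J" "j \<in> J"
  shows "r j \<noteq> 0 \<longrightarrow> (\<exists>g r' t. g \<noteq> 0 \<and> (\<forall>i\<in>J. r i = r' i * g) \<and> (\<Sum>i\<in>J. t i * r' i) = 1)"
proof
  assume rj: "r j \<noteq> 0"
  define I where "I = {\<Sum>i\<in>J. t i * r i | t. True}"
  have memI: "x \<in> I \<longleftrightarrow> (\<exists>t. x = (\<Sum>i\<in>J. t i * r i))" for x by (auto simp: I_def)
  have "Modules.module.subspace (*) I"
    unfolding Modules.module.subspace_def[OF module_times]
  proof (intro conjI ballI allI)
    show "0 \<in> I" unfolding memI by (rule exI[of _ "\<lambda>_. 0"]) simp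
    fix x assume "x \<in> I"
    then obtain t where t: "x = (\<Sum>i\<in>J. t i * r i)" unfolding memI ..
    {
      fix y assume "y \<in> I"
      then obtain u where u: "y = (\<Sum>i\<in>J. u i * r i)" unfolding memI ..
      show "x + y \<in> I" unfolding memI
        by (rule exI[of _ "\<lambda>i. t i + u i"]) (simp add: t u distrib_right sum.distrib)
    next
      fix c
      show "c * x \<in> I" unfolding memI
        by (rule exI[of _ "\<lambda>i. c * t i"]) (simp add: t sum_distrib_left mult.assoc)
    }
  qed
  then obtain g where g: "I = range (\<lambda>x. x * g)" using P unfolding principal_ring_def by auto
  have "\<exists>x. r i = x * g" if i: "i \<in> J" for i
  proof -
    have "r i \<in> I" unfolding memI
      by (rule exI[of _ "\<lambda>k. if k = i then 1 else 0"]) (simp add: if_distrib[of "\<lambda>x. x * _"] i J(1) cong: if_cong)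
    then show ?thesis unfolding g by (rule rangeE) (rule exI)
  qed
  then have "\<forall>i\<in>J. \<exists>x. r i = x * g" by (rule ballI)
  from bchoice[OF this] obtain r' where r': "\<forall>i\<in>J. r i = r' i * g" ..
  have g0: "g \<noteq> 0" using r' rj J(2) by auto
  have "g \<in> I" unfolding g by (rule range_eqI[of _ _ 1]) simp
  then obtain t where t: "g = (\<Sum>i\<in>J. t i * r i)" unfolding memI ..
  have "(\<Sum>i\<in>J. t i * r' i) * g = (\<Sum>i\<in>J. t i * r i)"
    unfolding sum_distrib_right by (rule sum.cong) (auto simp: r' mult.assoc)
  then have "(\<Sum>i\<in>J. t i * r' i) * g = 1 * g" by (simp add: t[symmetric])
  then have "(\<Sum>i\<in>J. t i * r' i) = 1" using g0 by (simp only: mult_cancel_right simp_thms)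
  with g0 r' show "\<exists>g r' t. g \<noteq> 0 \<and> (\<forall>i\<in>J. r i = r' i * g) \<and> (\<Sum>i\<in>J. t i * r' i) = 1"
    by (intro exI[of _ g] exI[of _ r'] exI[of _ t]) simp
qed

text \<open>Vectors that are independent after \<open>ev\<close> are independent over
  \<open>'k\<close>: a relation over \<open>'k\<close> can be cleared of denominators and divided by
  a greatest common divisor, and the primitive relation so obtained has a nontrivial image under
  \<open>ev\<close>.\<close>

lemma rank_specialise_le:
  fixes evK :: "'r::idom \<Rightarrow> 'k::field" and ev :: "'r \<Rightarrow> 'f::field" and A :: "('b \<Rightarrow>\<^sub>0 'r) set"
  assumes P: "principal_ring TYPE('r)" and K: "ring_map evK" "inj evK"
    "\<And>x. \<exists>r s. evK s \<noteq> 0 \<and> x * evK s = evK r"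
    and ev: "ring_map ev" and A: "finite A"
  shows "fv.dim (Poly_Mapping.map ev ` A) \<le> fv.dim (Poly_Mapping.map evK ` A)"
proof -
  interpret K: ring_map evK by fact
  interpret e: ring_map ev by fact
  obtain C where C: "C \<subseteq> Poly_Mapping.map ev ` A" "ch.independent C" "card C = fv.dim (Poly_Mapping.map ev ` A)"
    by (rule fv.basis_exists)
  from C(1)[unfolded subset_image_inj] obtain J
    where J0: "J \<subseteq> A \<and> inj_on (Poly_Mapping.map ev) J \<and> C = Poly_Mapping.map ev ` J" by (elim exE)
  then have J: "J \<subseteq> A" "inj_on (Poly_Mapping.map ev) J" "C = Poly_Mapping.map ev ` J" by simp_all
  have fJ: "finite J" by (rule finite_subset[OF J(1) A])
  have main: "c j = 0" if c: "(\<Sum>j\<in>J. cscale (c j) (Poly_Mapping.map evK j)) = 0" and j: "j \<in> J" for c j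
  proof (rule ccontr)
    assume cj: "c j \<noteq> 0"
    from common_denominator[OF K(1,3) fJ, of c]
    obtain s r where s0: "evK s \<noteq> 0 \<and> (\<forall>j\<in>J. c j * evK s = evK (r j))" by (elim exE)
    have s: "evK s \<noteq> 0" "c j * evK s = evK (r j)" if "j \<in> J" for j using s0 that by simp_all
    have rel: "(\<Sum>j\<in>J. r j * coef j k) = 0" for k
    proof -
      have "evK (\<Sum>j\<in>J. r j * coef j k) = (\<Sum>j\<in>J. c j * evK s * evK (coef j k))"
        unfolding K.ev_sum by (rule sum.cong) (auto simp: K.ev_mult s(2))
      also have "\<dots> = evK s * (\<Sum>j\<in>J. c j * evK (coef j k))"
        by (simp add: sum_distrib_left mult_ac)
      also have "(\<Sum>j\<in>J. c j * evK (coef j k)) = coef (\<Sum>j\<in>J. cscale (c j) (Poly_Mapping.map evK j)) k"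
        by (simp add: lookup_sum)
      finally have "evK (\<Sum>j\<in>J. r j * coef j k) = evK 0" by (simp add: c)
      then show ?thesis using K(2) by (simp only: inj_eq)
    qed
    have rj: "r j \<noteq> 0" using s[OF j] cj by auto
    from principal_bezout[OF P fJ j, of r] rj obtain g r' t
      where g0: "g \<noteq> 0 \<and> (\<forall>i\<in>J. r i = r' i * g) \<and> (\<Sum>i\<in>J. t i * r' i) = 1" by (elim exE impE)
    have r': "r i = r' i * g" if "i \<in> J" for i using g0 that by simp
    have one: "(\<Sum>i\<in>J. t i * r' i) = 1" using g0 by simp
    have rel': "(\<Sum>j\<in>J. r' j * coef j k) = 0" for k
    proof -
      have "(\<Sum>j\<in>J. r' j * coef j k) * g = (\<Sum>j\<in>J. r j * coef j k)"
        unfolding sum_distrib_right by (rule sum.cong) (auto simp: r' mult_ac)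
      then show ?thesis using rel[of k] g0 by simp
    qed
    have "(\<Sum>j\<in>J. cscale (ev (r' j)) (Poly_Mapping.map ev j)) = 0"
    proof (rule poly_mapping_eqI)
      fix k
      have "coef (\<Sum>j\<in>J. cscale (ev (r' j)) (Poly_Mapping.map ev j)) k = ev (\<Sum>j\<in>J. r' j * coef j k)"
        by (simp add: lookup_sum e.ev_sum e.ev_mult)
      then show "coef (\<Sum>j\<in>J. cscale (ev (r' j)) (Poly_Mapping.map ev j)) k = coef 0 k"
        by (simp add: rel')
    qed
    then have "ev (r' i) = 0" if "i \<in> J" for i
      by (rule fv.independent_familyD[OF C(2)[unfolded J(3)] fJ J(2) _ that])
    then have "ev (\<Sum>i\<in>J. t i * r' i) = 0" by (simp add: e.ev_sum e.ev_mult)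
    then show False using one by simp
  qed
  have ind: "ch.independent (Poly_Mapping.map evK ` J)" "inj_on (Poly_Mapping.map evK) J"
    by (rule fv.independent_familyI(1)[OF fJ], erule (1) main, rule fv.independent_familyI(2)[OF fJ], erule (1) main)
  have "card (Poly_Mapping.map evK ` J) \<le> fv.dim (Poly_Mapping.map evK ` A)"
    by (rule fv.independent_card_le_dim'[OF ind(1)]) (use A order.trans[OF image_mono[OF J(1)] ch.span_superset] in simp_all)
  moreover have "card (Poly_Mapping.map evK ` J) = card C"
    using ind(2) J by (simp add: card_image)
  ultimately show ?thesis using C(3) by simp
qed

text \<open>Independence over \<open>'k\<close> is certified by functionals \<open>L i\<close> that
  are 1 on the vector \<open>i\<close> and 0 on the others, restricted to the finitely many
  coordinates \<open>T\<close>. Multiplied by a common denominator \<open>d\<close>, the certificate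
  has entries \<open>r (i, k)\<close> in \<open>'r\<close> and stays valid after every evaluation
  that does not kill \<open>d\<close>. Thus \<open>d\<close> plays the part of a nonzero maximal
  minor.\<close>

lemma rank_generic:
  fixes evK :: "'r::idom \<Rightarrow> 'k::field" and A :: "('b \<Rightarrow>\<^sub>0 'r) set"
  assumes K: "ring_map evK" "inj evK" "\<And>x. \<exists>r s. evK s \<noteq> 0 \<and> x * evK s = evK r"
    and A: "finite A"
  shows "\<exists>d. d \<noteq> 0 \<and> (\<forall>ev :: 'r \<Rightarrow> 'f::field. ring_map ev \<longrightarrow> ev d \<noteq> 0 \<longrightarrow>
     fv.dim (Poly_Mapping.map evK ` A) \<le> fv.dim (Poly_Mapping.map ev ` A))"
proof -
  interpret K: ring_map evK by fact
  obtain C where C: "C \<subseteq> Poly_Mapping.map evK ` A" "ch.independent C" "card C = fv.dim (Poly_Mapping.map evK ` A)"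
    by (rule fv.basis_exists)
  from C(1)[unfolded subset_image_inj] obtain J
    where J0: "J \<subseteq> A \<and> inj_on (Poly_Mapping.map evK) J \<and> C = Poly_Mapping.map evK ` J" by (elim exE)
  then have J: "J \<subseteq> A" "inj_on (Poly_Mapping.map evK) J" "C = Poly_Mapping.map evK ` J" by simp_all
  have fJ: "finite J" by (rule finite_subset[OF J(1) A])
  define T where "T = (\<Union>j\<in>J. supp j)"
  have fT: "finite T" using fJ by (simp add: T_def)
  interpret vp: vector_space_pair "cscale :: 'k \<Rightarrow> ('b \<Rightarrow>\<^sub>0 'k) \<Rightarrow> 'b \<Rightarrow>\<^sub>0 'k" "(*) :: 'k \<Rightarrow> 'k \<Rightarrow> 'k"
    by unfold_locales (auto simp: algebra_simps)
  have "\<exists>L. \<forall>j\<in>J. (\<Sum>k\<in>T. evK (coef j k) * L k) = (if j = i then 1 else 0)" if i: "i \<in> J" for i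
  proof -
    obtain g where g: "Vector_Spaces.linear cscale (*) g"
      "\<And>x. x \<in> C \<Longrightarrow> g x = (if x = Poly_Mapping.map evK i then 1 else 0)"
    proof -
      from vp.linear_independent_extend[OF C(2), of "\<lambda>x. if x = Poly_Mapping.map evK i then 1 else 0"]
      obtain g where "Vector_Spaces.linear cscale (*) g \<and> (\<forall>x\<in>C. g x = (if x = Poly_Mapping.map evK i then 1 else 0))" ..
      then show ?thesis by (intro that[of g]) simp_all
    qed
    have gadd: "g (x + y) = g x + g y" and gsc: "g (cscale r x) = r * g x" for x y r
      by (rule vp.linear_add[OF g(1)], rule vp.linear_scale[OF g(1)])
    have "(\<Sum>k\<in>T. evK (coef j k) * g (sgl k 1)) = (if j = i then 1 else 0)" if j: "j \<in> J" for j
    proof -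
      have s: "supp (Poly_Mapping.map evK j) \<subseteq> T"
        using j by (auto simp: T_def in_keys_iff intro!: bexI[of _ j])
      have "Poly_Mapping.map evK j = (\<Sum>k\<in>T. cscale (evK (coef j k)) (sgl k 1))"
        using linext_id[of "Poly_Mapping.map evK j"] unfolding ca.linext_superset[OF fT s] by simp
      then have "g (Poly_Mapping.map evK j) = g (\<Sum>k\<in>T. cscale (evK (coef j k)) (sgl k 1))" by simp
      also have "\<dots> = (\<Sum>k\<in>T. g (cscale (evK (coef j k)) (sgl k 1)))"
        by (rule Modules.additive.sum) (simp add: Modules.additive_def gadd)
      finally have "(\<Sum>k\<in>T. evK (coef j k) * g (sgl k 1)) = g (Poly_Mapping.map evK j)"
        by (simp only: gsc)
      also have "\<dots> = (if Poly_Mapping.map evK j = Poly_Mapping.map evK i then 1 else 0)"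
        using j J(3) by (intro g(2)) auto
      also have "\<dots> = (if j = i then 1 else 0)" using inj_on_eq_iff[OF J(2) j i] by simp
      finally show ?thesis .
    qed
    then show ?thesis by (intro exI[of _ "\<lambda>k. g (sgl k 1)"] ballI)
  qed
  then have "\<forall>i\<in>J. \<exists>L. \<forall>j\<in>J. (\<Sum>k\<in>T. evK (coef j k) * L k) = (if j = i then 1 else 0)" by simp
  from bchoice[OF this] obtain L
    where L0: "\<forall>i\<in>J. \<forall>j\<in>J. (\<Sum>k\<in>T. evK (coef j k) * L i k) = (if j = i then 1 else 0)" ..
  have L: "(\<Sum>k\<in>T. evK (coef j k) * L i k) = (if j = i then 1 else 0)" if "i \<in> J" "j \<in> J" for i j
    using L0 that by simp
  from common_denominator[OF K(1,3) finite_cartesian_product[OF fJ fT], of "\<lambda>(i, k). L i k"]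
  obtain d r where d0: "evK d \<noteq> 0 \<and> (\<forall>x\<in>J \<times> T. (case x of (i, k) \<Rightarrow> L i k) * evK d = evK (r x))" by (elim exE)
  have d: "evK d \<noteq> 0" "L i k * evK d = evK (r (i, k))" if "i \<in> J" "k \<in> T" for i k
    using d0 that by auto
  have rel: "(\<Sum>k\<in>T. coef j k * r (i, k)) = (if j = i then d else 0)" if "i \<in> J" "j \<in> J" for i j
  proof -
    have "evK (\<Sum>k\<in>T. coef j k * r (i, k)) = (\<Sum>k\<in>T. evK (coef j k) * (L i k * evK d))"
      unfolding K.ev_sum by (rule sum.cong) (use d(2) that in \<open>auto simp: K.ev_mult\<close>)
    also have "\<dots> = (\<Sum>k\<in>T. evK (coef j k) * L i k) * evK d"
      by (simp add: sum_distrib_right mult.assoc)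
    also have "\<dots> = evK (if j = i then d else 0)" using L[OF that] by simp
    finally show ?thesis using K(2) by (simp only: inj_eq)
  qed
  have "fv.dim (Poly_Mapping.map evK ` A) \<le> fv.dim (Poly_Mapping.map ev ` A)"
    if ev: "ring_map ev" and evd: "ev d \<noteq> 0" for ev :: "'r \<Rightarrow> 'f"
  proof -
    interpret e: ring_map ev by fact
    have main: "c i = 0" if c: "(\<Sum>j\<in>J. cscale (c j) (Poly_Mapping.map ev j)) = 0" and i: "i \<in> J" for c i
    proof -
      have ck: "(\<Sum>j\<in>J. c j * ev (coef j k)) = 0" for k
        using arg_cong[OF c, of "\<lambda>x. coef x k"] by (simp add: lookup_sum)
      \<comment> \<open>Pairing the relation with the functional \<open>r (i, _)\<close> leaves only
        the term \<open>c i * ev d\<close>.\<close>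
      have "(\<Sum>j\<in>J. c j * ev (\<Sum>k\<in>T. coef j k * r (i, k))) = (\<Sum>j\<in>J. \<Sum>k\<in>T. c j * ev (coef j k) * ev (r (i, k)))"
        by (simp add: e.ev_sum e.ev_mult sum_distrib_left mult.assoc)
      also have "\<dots> = (\<Sum>k\<in>T. (\<Sum>j\<in>J. c j * ev (coef j k)) * ev (r (i, k)))"
        by (subst sum.swap) (simp add: sum_distrib_right)
      finally have "(\<Sum>j\<in>J. c j * ev (\<Sum>k\<in>T. coef j k * r (i, k))) = 0" by (simp add: ck)
      moreover have "(\<Sum>j\<in>J. c j * ev (\<Sum>k\<in>T. coef j k * r (i, k))) = (\<Sum>j\<in>J. if j = i then c j * ev d else 0)"
        by (rule sum.cong) (use rel[OF i] in auto)
      ultimately have "c i * ev d = 0" using i fJ by simp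
      then show ?thesis using evd by simp
    qed
    have ind: "ch.independent (Poly_Mapping.map ev ` J)" "inj_on (Poly_Mapping.map ev) J"
      by (rule fv.independent_familyI(1)[OF fJ], erule (1) main, rule fv.independent_familyI(2)[OF fJ], erule (1) main)
    have "card (Poly_Mapping.map ev ` J) \<le> fv.dim (Poly_Mapping.map ev ` A)"
      by (rule fv.independent_card_le_dim'[OF ind(1)]) (use A order.trans[OF image_mono[OF J(1)] ch.span_superset] in simp_all)
    moreover have "card (Poly_Mapping.map ev ` J) = card C"
      using ind(2) J by (simp add: card_image)
    ultimately show ?thesis using C(3) by simp
  qed
  moreover have "d \<noteq> 0" using d0 by auto
  ultimately show ?thesis by (intro exI[of _ d]) simp
qed

text \<open>\<open>BI\<close>, \<open>BZ\<close> and \<open>BV\<close> are nested bases of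
  \<open>I\<close>, of the kernel of \<open>f\<close> in \<open>span E\<close>, and of
  \<open>span E\<close>; \<open>W\<close> is \<open>BZ - BI\<close>. The conclusion speaks of
  coefficient functions instead of a quotient space because it is carried over to cochains through
  \<open>connect\<close>.\<close>

lemma (in vector_space) subquotient_dim:
  assumes E: "independent E" "finite E" and f: "Vector_Spaces.linear scale scale f"
    and I: "subspace I" "I \<subseteq> span E" "\<And>x. x \<in> I \<Longrightarrow> f x = 0"
  shows "\<exists>W. finite W \<and> card W + (dim (f ` span E) + dim I) = card E \<and>
    W \<subseteq> span E \<and> (\<forall>w\<in>W. f w = 0) \<and>
    (\<forall>x\<in>span E. f x = 0 \<longrightarrow> (\<exists>c. x - (\<Sum>w\<in>W. scale (c w) w) \<in> I)) \<and>
    (\<forall>c. (\<Sum>w\<in>W. scale (c w) w) \<in> I \<longrightarrow> (\<forall>w\<in>W. c w = 0))"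
proof -
  interpret vp: vector_space_pair scale scale by unfold_locales
  interpret f: Vector_Spaces.linear scale scale f by fact
  define Z where "Z = span E \<inter> {x. f x = 0}"
  have memZ: "x \<in> Z \<longleftrightarrow> x \<in> span E \<and> f x = 0" for x by (simp add: Z_def)
  have Z: "subspace Z"
    unfolding Z_def by (rule subspace_inter[OF subspace_span f.subspace_kernel])
  obtain BI where BI: "BI \<subseteq> I" "independent BI" "I \<subseteq> span BI" by (rule maximal_independent_subset)
  have "BI \<subseteq> Z"
  proof
    fix x assume "x \<in> BI"
    then have "x \<in> I" using BI(1) by (rule subsetD[rotated])
    then show "x \<in> Z" using I(2) I(3)[of x] by (auto simp: memZ)
  qed
  then obtain BZ where BZ: "BI \<subseteq> BZ" "BZ \<subseteq> Z" "independent BZ" "Z \<subseteq> span BZ"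
    by (rule maximal_independent_subset_extend[OF _ BI(2)])
  have "BZ \<subseteq> span E" using BZ(2) by (auto simp: memZ)
  then obtain BV where BV: "BZ \<subseteq> BV" "BV \<subseteq> span E" "independent BV" "span E \<subseteq> span BV"
    by (rule maximal_independent_subset_extend[OF _ BZ(3)])
  have fBV: "finite BV" using independent_span_bound[OF E(2) BV(3,2)] by blast
  have sBV: "span BV = span E" using BV(2,4) span_minimal[OF BV(2)] by auto
  have cBV: "card BV = card E"
    using dim_eq_card[OF sBV BV(3)] dim_eq_card[OF refl E(1)] by simp
  let ?W = "BZ - BI" and ?U = "BV - BZ"
  have sI: "span BI = I" using BI(1,3) I(1) span_minimal by blast
  have sZ: "span BZ = Z" using BZ(2,4) Z span_minimal by blast
  have dI: "dim I = card BI" proof (rule dim_eq_card[OF _ BI(2)])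
    show "span BI = span I" by (simp only: sI span_eq_iff[THEN iffD2, OF I(1)])
  qed
  have fU: "finite ?U" "finite ?W" "finite BI" "finite BZ"
    using finite_subset[OF BV(1) fBV] fBV finite_subset[OF BZ(1)] by simp_all
  \<comment> \<open>A combination of \<open>?U\<close> that \<open>f\<close> kills lies in the span
    of \<open>BZ\<close>, and independence of \<open>BV\<close> makes it trivial. So
    \<open>f\<close> maps \<open>?U\<close> to a basis of the image.\<close>
  have famU: "c u = 0" if c: "(\<Sum>u\<in>?U. scale (c u) (f u)) = 0" and u: "u \<in> ?U" for c u
  proof -
    let ?x = "\<Sum>u\<in>?U. scale (c u) u"
    have "f ?x = 0" using c by (simp add: f.sum f.scale)
    moreover have "?x \<in> span E" using BV(2) by (intro span_sum span_scale) auto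
    ultimately have "?x \<in> span BZ" by (simp add: sZ memZ)
    then obtain e where e: "?x = (\<Sum>v\<in>BZ. scale (e v) v)"
      unfolding span_finite[OF fU(4)] by auto
    let ?d = "\<lambda>v. if v \<in> BZ then - e v else c v"
    have "(\<Sum>v\<in>BV. scale (?d v) v) = (\<Sum>v\<in>?U. scale (?d v) v) + (\<Sum>v\<in>BZ. scale (?d v) v)"
      by (rule sum.subset_diff[OF BV(1) fBV])
    also have "(\<Sum>v\<in>?U. scale (?d v) v) = ?x" by (rule sum.cong) auto
    also have "(\<Sum>v\<in>BZ. scale (?d v) v) = - (\<Sum>v\<in>BZ. scale (e v) v)"
      unfolding sum_negf[symmetric] by (rule sum.cong) (auto simp: scale_minus_left)
    finally have "(\<Sum>v\<in>BV. scale (?d v) v) = 0" using e by simp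
    from independentD[OF BV(3) fBV order_refl this, of u] u show ?thesis by auto
  qed
  have indU: "independent (f ` ?U)" "inj_on f ?U"
    by (rule independent_familyI(1)[OF fU(1)], erule (1) famU, rule independent_familyI(2)[OF fU(1)], erule (1) famU)
  have "f ` span E = span (f ` ?U)"
  proof -
    have "f ` BV \<subseteq> insert 0 (f ` ?U)" using BZ(2) by (auto simp: memZ)
    then have "span (f ` BV) \<subseteq> span (insert 0 (f ` ?U))" by (rule span_mono)
    then have "span (f ` BV) = span (f ` ?U)" using span_mono[of "f ` ?U" "f ` BV"] by auto
    then show ?thesis by (simp add: sBV[symmetric] f.span_image)
  qed
  then have df: "dim (f ` span E) = card ?U"
    using dim_eq_card_independent[OF indU(1)] card_image[OF indU(2)] by (simp add: dim_span)
  have "card ?W + (card ?U + card BI) = card E"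
    using card_Diff_subset[OF fU(3) BZ(1)] card_Diff_subset[OF fU(4) BV(1)] 
      card_mono[OF fU(4) BZ(1)] card_mono[OF fBV BV(1)] cBV by simp
  then have 1: "card ?W + (dim (f ` span E) + dim I) = card E" by (simp add: df dI)
  have split: "(\<Sum>v\<in>BZ. scale (e v) v) = (\<Sum>v\<in>?W. scale (e v) v) + (\<Sum>v\<in>BI. scale (e v) v)" for e
    by (rule sum.subset_diff[OF BZ(1) fU(4)])
  have 2: "\<exists>c. x - (\<Sum>w\<in>?W. scale (c w) w) \<in> I" if "x \<in> span E" "f x = 0" for x
  proof -
    have "x \<in> span BZ" using that by (simp add: sZ memZ)
    then obtain e where "x = (\<Sum>v\<in>BZ. scale (e v) v)" unfolding span_finite[OF fU(4)] by auto
    then have "x - (\<Sum>w\<in>?W. scale (e w) w) = (\<Sum>v\<in>BI. scale (e v) v)" using split by simp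
    also have "\<dots> \<in> I" unfolding sI[symmetric] by (intro span_sum span_scale span_base)
    finally show ?thesis by (rule exI[of _ e])
  qed
  have 3: "c w = 0" if c: "(\<Sum>w\<in>?W. scale (c w) w) \<in> I" and w: "w \<in> ?W" for c w
  proof -
    obtain e where e: "(\<Sum>w\<in>?W. scale (c w) w) = (\<Sum>v\<in>BI. scale (e v) v)"
      using c unfolding sI[symmetric] span_finite[OF fU(3)] by auto
    let ?d = "\<lambda>v. if v \<in> BI then - e v else c v"
    have "(\<Sum>v\<in>?W. scale (?d v) v) = (\<Sum>w\<in>?W. scale (c w) w)" by (rule sum.cong) auto
    moreover have "(\<Sum>v\<in>BI. scale (?d v) v) = - (\<Sum>v\<in>BI. scale (e v) v)"
      unfolding sum_negf[symmetric] by (rule sum.cong) (auto simp: scale_minus_left)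
    ultimately have "(\<Sum>v\<in>BZ. scale (?d v) v) = 0" using e unfolding split by simp
    from independentD[OF BZ(3) fU(4) order_refl this, of w] w show ?thesis by auto
  qed
  have "?W \<subseteq> span E" "\<And>w. w \<in> ?W \<Longrightarrow> f w = 0"
    using BZ(2) by (auto simp: memZ)
  then show ?thesis
    using fU(2) 1 2 3 by (intro exI[of _ ?W] conjI ballI allI impI) simp_all
qed

section \<open>Cohomology after specialisation\<close>

locale attached_complex = based_complex S bd for S and bd :: "nat \<Rightarrow> 's \<Rightarrow> 's \<Rightarrow>\<^sub>0 'r::comm_ring_1" +
  fixes xs :: "nat \<Rightarrow> ('s + nat \<Rightarrow>\<^sub>0 'r) list"
  assumes K: "based_complex (\<lambda>q. attach_basis (S q) (xs q)) (\<lambda>q. attach_bd (bd q) (xs q))"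
    and acyclic_K: "based_complex.acyclic (\<lambda>q. attach_basis (S q) (xs q)) (\<lambda>q. attach_bd (bd q) (xs q))"
begin

sublocale K: based_complex "\<lambda>q. attach_basis (S q) (xs q)" "\<lambda>q. attach_bd (bd q) (xs q)"
  by (rule K)

abbreviation rnk :: "nat \<Rightarrow> nat" where "rnk q \<equiv> length (xs q)"

text \<open>Modulo the original complex, the boundary of the generator \<open>Inr j\<close> of
  degree \<open>Suc q\<close> is given by its coefficients at the \<open>Inr i\<close>. With
  \<open>j\<close> as the row index this is the matrix of the coboundary of the quotient complex
  from degree \<open>q\<close> to \<open>Suc q\<close>.\<close>

definition column :: "nat \<Rightarrow> nat \<Rightarrow> nat \<Rightarrow>\<^sub>0 'r" where
  "column q i = (\<Sum>j<rnk (Suc q). sgl j (coef (xs (Suc q) ! j) (Inr i)))"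

lemma coef_sum_sgl: "coef (\<Sum>j<(n::nat). sgl j (v j)) k = (if k < n then v k else 0)"
  by (simp add: lookup_sum lookup_single when_def)

lemma supp_sum_sgl: "supp (\<Sum>j<(n::nat). sgl j (v j)) \<subseteq> {..<n}"
  by (auto simp: in_keys_iff coef_sum_sgl split: if_splits)

definition columns :: "nat \<Rightarrow> (nat \<Rightarrow>\<^sub>0 'r) set" where
  "columns q = column q ` {..<rnk q}"

text \<open>Degree \<open>Suc q\<close> cohomology of the quotient complex: the number of cochain
  coordinates minus the ranks of the outgoing and the incoming coboundary. Since the extension is
  contractible, this is also degree \<open>q\<close> cohomology of the original complex.\<close>

definition betti :: "nat \<Rightarrow> ('r \<Rightarrow> 'f::field) \<Rightarrow> nat" where
  "betti q ev = rnk (Suc q) -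
     (fv.dim (Poly_Mapping.map ev ` columns (Suc q)) + fv.dim (Poly_Mapping.map ev ` columns q))"

end

definition act :: "('r \<Rightarrow> 'f) \<Rightarrow> 'r \<Rightarrow> 'f \<Rightarrow> 'f::comm_ring_1" where
  "act ev = (\<lambda>r x. ev r * x)"

text \<open>A cochain of the quotient complex, regarded as a cochain of the extension.\<close>

definition inr_part :: "(nat \<Rightarrow>\<^sub>0 'f::zero) \<Rightarrow> 's + nat \<Rightarrow> 'f" where
  "inr_part v = case_sum (\<lambda>_. 0) (coef v)"

definition inl_part :: "('s \<Rightarrow> 'f::zero) \<Rightarrow> 's + nat \<Rightarrow> 'f" where
  "inl_part f = case_sum f (\<lambda>_. 0)"

lemma parts_simps [simp]: "inr_part v (Inl s) = 0" "inr_part v (Inr j) = coef v j"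
  "inl_part f (Inl s) = f s" "inl_part f (Inr j) = 0"
  by (simp_all add: inr_part_def inl_part_def)

locale specialised_complex = attached_complex S bd xs + ring_map ev
  for S and bd :: "nat \<Rightarrow> 's \<Rightarrow> 's \<Rightarrow>\<^sub>0 'r::comm_ring_1" and xs and ev :: "'r \<Rightarrow> 'f::field"
begin

sublocale e: ring_action "act ev"
  unfolding act_def by (rule ring_action_ev)

abbreviation pair where "pair \<equiv> linext (act ev)"

definition cocycle :: "nat \<Rightarrow> ('s \<Rightarrow> 'f) \<Rightarrow> bool" where
  "cocycle q f \<longleftrightarrow> (\<forall>s\<in>S (Suc q). pair f (bd (Suc q) s) = 0)"

text \<open>In degree 0 this forces \<open>f\<close> to vanish on \<open>S 0\<close>, because
  \<open>bd 0\<close> is 0 there.\<close>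

definition coboundary :: "nat \<Rightarrow> ('s \<Rightarrow> 'f) \<Rightarrow> bool" where
  "coboundary q f \<longleftrightarrow> (\<exists>g. \<forall>s\<in>S q. f s = pair g (bd q s))"

abbreviation d where "d q \<equiv> attach_bd (bd q) (xs q)"

abbreviation B where "B q \<equiv> attach_basis (S q) (xs q)"

definition mat :: "nat \<Rightarrow> (nat \<Rightarrow>\<^sub>0 'f) \<Rightarrow> nat \<Rightarrow>\<^sub>0 'f" where
  "mat q u = linext cscale (\<lambda>i. Poly_Mapping.map ev (column q i)) u"

text \<open>The connecting homomorphism: extend \<open>f\<close> by zero, take the coboundary in the
  extension, and keep its values at the attached generators of degree \<open>Suc q\<close>.\<close>

definition connect :: "nat \<Rightarrow> ('s \<Rightarrow> 'f) \<Rightarrow> nat \<Rightarrow>\<^sub>0 'f" where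
  "connect q f = (\<Sum>j<rnk (Suc q). sgl j (pair (inl_part f) (xs (Suc q) ! j)))"

lemma pair_inl [simp]: "pair \<phi> (inl_chain c) = pair (\<lambda>s. \<phi> (Inl s)) c"
  by (rule linext_inl) unfold_locales

lemma pair_inr_part: "pair (inr_part u) c = (\<Sum>i\<in>supp u. coef u i * ev (coef c (Inr i)))"
proof -
  let ?A = "supp c \<union> Inr ` supp u"
  have "pair (inr_part u) c = (\<Sum>b\<in>?A. ev (coef c b) * inr_part u b)"
    by (subst e.linext_superset[of ?A]) (auto simp: act_def)
  also have "\<dots> = (\<Sum>b\<in>Inr ` supp u. ev (coef c b) * inr_part u b)"
  proof (rule sum.mono_neutral_right)
    show "\<forall>b\<in>?A - Inr ` supp u. ev (coef c b) * inr_part u b = 0"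
    proof
      fix b assume "b \<in> ?A - Inr ` supp u"
      then show "ev (coef c b) * inr_part u b = 0"
        by (cases b) (auto simp: in_keys_iff image_iff)
    qed
  qed auto
  also have "\<dots> = (\<Sum>i\<in>supp u. coef u i * ev (coef c (Inr i)))"
    by (subst sum.reindex) (auto simp: mult.commute)
  finally show ?thesis .
qed

text \<open>Links the matrix to the complex: \<open>mat q\<close> is the coboundary of the
  extension, applied to cochains that live on the attached generators and read off on them.\<close>

lemma coef_mat: "coef (mat q u) j = (if j < rnk (Suc q) then pair (inr_part u) (xs (Suc q) ! j) else 0)"
  unfolding mat_def lookup_linext pair_inr_part
  by (auto simp: column_def coef_sum_sgl intro: sum.neutral)

lemma coef_connect: "coef (connect q f) j = (if j < rnk (Suc q) then pair (inl_part f) (xs (Suc q) ! j) else 0)"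
  by (simp add: connect_def coef_sum_sgl)

lemma supp_connect: "supp (connect q f) \<subseteq> {..<rnk (Suc q)}"
  unfolding connect_def by (rule supp_sum_sgl)

lemma supp_mat: "supp (mat q u) \<subseteq> {..<rnk (Suc q)}"
  by (auto simp: in_keys_iff coef_mat split: if_splits)

lemma attached_mem: "j < rnk q \<Longrightarrow> Inr j \<in> B q" "s \<in> S q \<Longrightarrow> Inl s \<in> B q"
  by (auto simp: attach_basis_def)

lemma supp_attached: "j < rnk (Suc q) \<Longrightarrow> supp (xs (Suc q) ! j) \<subseteq> B q"
  using K.supp_bd[OF attached_mem(1), of j q] by simp

lemma pair_cong: "supp c \<subseteq> B q \<Longrightarrow> (\<And>s. s \<in> S q \<Longrightarrow> \<phi> (Inl s) = \<psi> (Inl s)) \<Longrightarrow>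
    (\<And>j. j < rnk q \<Longrightarrow> \<phi> (Inr j) = \<psi> (Inr j)) \<Longrightarrow> pair \<phi> c = pair \<psi> c"
  by (rule linext_cong) (auto simp: attach_basis_def)

lemma pair_d_d:
  assumes "b \<in> B (Suc q)"
  shows "pair (\<lambda>b. pair \<phi> (d q b)) (d (Suc q) b) = 0"
  using arg_cong[OF K.bd_bd[OF assms], of "pair \<phi>"] by (simp add: e.linext_linext)

lemma acyclic_pair:
  assumes "\<And>b. b \<in> B (Suc q) \<Longrightarrow> pair \<phi> (d (Suc q) b) = 0"
  obtains \<psi> where "\<And>b. b \<in> B q \<Longrightarrow> \<phi> b = pair \<psi> (d q b)"
proof -
  have m: "Modules.module (\<lambda>r x. ev r * x)"
    using ring_action_ev by (simp add: ring_action_def)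
  have "\<exists>\<psi>. \<forall>b\<in>B q. \<phi> b = pair \<psi> (d q b)"
    using K.acyclic_cochain[OF acyclic_K m, of q \<phi>] assms unfolding act_def by blast
  then show ?thesis using that by blast
qed

text \<open>For a cocycle \<open>f\<close> the coboundary of \<open>inl_part f\<close> is
  \<open>inr_part (connect q f)\<close>, and the coboundary of a coboundary is 0.\<close>

lemma mat_connect:
  assumes "cocycle q f"
  shows "mat (Suc q) (connect q f) = 0"
proof (rule poly_mapping_eqI)
  fix j
  show "coef (mat (Suc q) (connect q f)) j = coef 0 j"
  proof (cases "j < rnk (Suc (Suc q))")
    case True
    have "pair (inr_part (connect q f)) (xs (Suc (Suc q)) ! j)
        = pair (\<lambda>b. pair (inl_part f) (d (Suc q) b)) (xs (Suc (Suc q)) ! j)"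
      by (rule pair_cong[OF supp_attached[OF True]])
        (use assms in \<open>auto simp: cocycle_def coef_connect\<close>)
    also have "\<dots> = 0"
      using pair_d_d[OF attached_mem(1)[OF True], of "inl_part f"] by simp
    finally show ?thesis using True by (simp add: coef_mat)
  qed (simp add: coef_mat)
qed

text \<open>\<open>inr_part v\<close> is a cocycle of the extension, hence the coboundary of some
  \<open>\<psi>\<close>. The values of \<open>\<psi>\<close> on the original basis give
  \<open>f\<close>, those on the attached generators give \<open>u\<close>.\<close>

lemma connect_surj:
  assumes v: "supp v \<subseteq> {..<rnk (Suc q)}" "mat (Suc q) v = 0"
  obtains f u where "cocycle q f" "supp u \<subseteq> {..<rnk q}" "v = connect q f + mat q u"
proof -
  have "pair (inr_part v) (d (Suc (Suc q)) b) = 0" if "b \<in> B (Suc (Suc q))" for b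
  proof (cases b)
    case (Inr j)
    then have "j < rnk (Suc (Suc q))" using that by (auto simp: attach_basis_def)
    then show ?thesis using arg_cong[OF v(2), of "\<lambda>c. coef c j"] Inr by (simp add: coef_mat)
  qed simp
  from acyclic_pair[OF this] obtain \<psi> where psi: "\<And>b. b \<in> B (Suc q) \<Longrightarrow> inr_part v b = pair \<psi> (d (Suc q) b)"
    by metis
  define f where "f = (\<lambda>s. \<psi> (Inl s))"
  define u where "u = (\<Sum>i<rnk q. sgl i (\<psi> (Inr i)))"
  have "cocycle q f"
    using psi[OF attached_mem(2)] by (auto simp: cocycle_def f_def)
  moreover have "supp u \<subseteq> {..<rnk q}" unfolding u_def by (rule supp_sum_sgl)
  moreover have "v = connect q f + mat q u"
  proof (rule poly_mapping_eqI)
    fix j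
    show "coef v j = coef (connect q f + mat q u) j"
    proof (cases "j < rnk (Suc q)")
      case True
      have "coef v j = pair \<psi> (xs (Suc q) ! j)" using psi[OF attached_mem(1)[OF True]] by simp
      also have "\<dots> = pair (\<lambda>b. inl_part f b + inr_part u b) (xs (Suc q) ! j)"
        by (rule pair_cong[OF supp_attached[OF True]]) (simp_all add: f_def u_def coef_sum_sgl)
      finally show ?thesis using True by (simp add: e.linext_fun_add lookup_add coef_connect coef_mat)
    next
      case False
      then have "j \<notin> supp v" using v(1) by auto
      then show ?thesis using False by (simp add: lookup_add coef_connect coef_mat in_keys_iff)
    qed
  qed
  ultimately show ?thesis by (rule that)
qed

text \<open>\<open>inl_part f - inr_part u\<close> is a cocycle of the extension, hence the
  coboundary of some \<open>\<psi>\<close>; on the original basis only the values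
  \<open>\<psi> (Inl _)\<close> enter this equation.\<close>

lemma connect_inj:
  assumes f: "cocycle q f" and u: "connect q f = mat q u"
  shows "coboundary q f"
proof -
  have "pair (\<lambda>b. inl_part f b - inr_part u b) (d (Suc q) b) = 0" if "b \<in> B (Suc q)" for b
  proof (cases b)
    case (Inl s)
    then have "s \<in> S (Suc q)" using that by (auto simp: attach_basis_def)
    then show ?thesis using f Inl by (simp add: cocycle_def)
  next
    case (Inr j)
    then have "j < rnk (Suc q)" using that by (auto simp: attach_basis_def)
    then show ?thesis using arg_cong[OF u, of "\<lambda>c. coef c j"] Inr
      by (simp add: coef_mat coef_connect e.linext_fun_diff)
  qed
  from acyclic_pair[OF this] obtain \<psi>
    where psi: "\<And>b. b \<in> B q \<Longrightarrow> inl_part f b - inr_part u b = pair \<psi> (d q b)" by metis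
  have "f s = pair (\<lambda>s. \<psi> (Inl s)) (bd q s)" if "s \<in> S q" for s
    using psi[OF attached_mem(2)[OF that]] by simp
  then show ?thesis unfolding coboundary_def by blast
qed

text \<open>With the sign chosen in \<open>u\<close>, the coboundary of \<open>inl_part g\<close> in
  degree \<open>q\<close> is \<open>inl_part f - inr_part u\<close>, and its own coboundary is
  0.\<close>

lemma connect_coboundary:
  assumes "coboundary q f"
  obtains u where "supp u \<subseteq> {..<rnk q}" "connect q f = mat q u"
proof -
  obtain g where g: "\<And>s. s \<in> S q \<Longrightarrow> f s = pair g (bd q s)"
    using assms unfolding coboundary_def by blast
  define u where "u = (\<Sum>i<rnk q. sgl i (- pair (inl_part g) (xs q ! i)))"
  have "connect q f = mat q u"
  proof (rule poly_mapping_eqI)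
    fix j
    show "coef (connect q f) j = coef (mat q u) j"
    proof (cases "j < rnk (Suc q)")
      case True
      have "pair (\<lambda>b. inl_part f b - inr_part u b) (xs (Suc q) ! j)
          = pair (\<lambda>b. pair (inl_part g) (d q b)) (xs (Suc q) ! j)"
        by (rule pair_cong[OF supp_attached[OF True]]) (simp_all add: g u_def coef_sum_sgl)
      also have "\<dots> = 0"
        using pair_d_d[OF attached_mem(1)[OF True], of "inl_part g"] by simp
      finally show ?thesis using True by (simp add: e.linext_fun_diff coef_mat coef_connect)
    qed (simp add: coef_mat coef_connect)
  qed
  moreover have "supp u \<subseteq> {..<rnk q}" unfolding u_def by (rule supp_sum_sgl)
  ultimately show ?thesis using that by blast
qed

lemma connect_add: "connect q (\<lambda>s. f s + g s) = connect q f + connect q g"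
proof (rule poly_mapping_eqI)
  fix j
  have "inl_part (\<lambda>s. f s + g s) = (\<lambda>b :: 's + nat. inl_part f b + inl_part g b)"
    by (auto simp: inl_part_def split: sum.splits)
  then show "coef (connect q (\<lambda>s. f s + g s)) j = coef (connect q f + connect q g) j"
    by (simp add: coef_connect lookup_add e.linext_fun_add)
qed

lemma connect_scale: "connect q (\<lambda>s. c * f s) = cscale c (connect q f)"
proof (rule poly_mapping_eqI)
  fix j
  have "inl_part (\<lambda>s. c * f s) = (\<lambda>b :: 's + nat. c * inl_part f b)"
    by (auto simp: inl_part_def split: sum.splits)
  then show "coef (connect q (\<lambda>s. c * f s)) j = coef (cscale c (connect q f)) j"
    by (simp add: coef_connect linext_def act_def sum_distrib_left mult_ac)
qed

lemma connect_0: "connect q (\<lambda>s. 0) = 0"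
  using connect_scale[of q 0 "\<lambda>s. 0"] by simp

lemma connect_sum: "connect q (\<lambda>s. \<Sum>w\<in>W. c w * f w s) = (\<Sum>w\<in>W. cscale (c w) (connect q (f w)))"
  by (induct W rule: infinite_finite_induct) (simp_all add: connect_0 connect_add connect_scale)

lemma connect_diff: "connect q (\<lambda>s. f s - g s) = connect q f - connect q g"
  using connect_add[of q f "\<lambda>s. - 1 * g s"] connect_scale[of q "- 1" g]
  by (simp add: ch.scale_minus_left)

lemma cocycle_sum:
  assumes "\<And>w. w \<in> W \<Longrightarrow> cocycle q (f w)"
  shows "cocycle q (\<lambda>s. \<Sum>w\<in>W. c w * f w s)"
proof -
  have "pair (\<lambda>s. \<Sum>w\<in>W. c w * f w s) x = (\<Sum>w\<in>W. c w * pair (f w) x)" for x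
    unfolding e.linext_fun_sum by (rule sum.cong) (auto simp: linext_def act_def sum_distrib_left mult_ac)
  then show ?thesis using assms by (simp add: cocycle_def)
qed

lemma cocycle_diff: "cocycle q f \<Longrightarrow> cocycle q g \<Longrightarrow> cocycle q (\<lambda>s. f s - g s)"
  by (simp add: cocycle_def e.linext_fun_diff)

lemma mat_add: "mat q (u + v) = mat q u + mat q v"
  by (simp add: mat_def ca.linext_add)

lemma mat_scale: "mat q (cscale c u) = cscale c (mat q u)"
  by (simp add: mat_def ca.linext_cscale)

lemma mat_mat:
  assumes "supp u \<subseteq> {..<rnk q}"
  shows "mat (Suc q) (mat q u) = 0"
proof (rule poly_mapping_eqI)
  fix j
  show "coef (mat (Suc q) (mat q u)) j = coef 0 j"
  proof (cases "j < rnk (Suc (Suc q))")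
    case True
    have "pair (inr_part (mat q u)) (xs (Suc (Suc q)) ! j)
        = pair (\<lambda>b. pair (inr_part u) (d (Suc q) b)) (xs (Suc (Suc q)) ! j)"
      by (rule pair_cong[OF supp_attached[OF True]]) (simp_all add: coef_mat)
    also have "\<dots> = 0"
      using pair_d_d[OF attached_mem(1)[OF True], of "inr_part u"] by simp
    finally show ?thesis using True by (simp add: coef_mat)
  qed (simp add: coef_mat)
qed

lemma image_mat: "mat q ` chains_on {..<rnk q} = ch.span (Poly_Mapping.map ev ` columns q)"
proof -
  have "Poly_Mapping.map ev ` columns q = (\<lambda>i. Poly_Mapping.map ev (column q i)) ` {..<rnk q}"
    by (auto simp: columns_def)
  then have "x \<in> ch.span (Poly_Mapping.map ev ` columns q) \<longleftrightarrow> (\<exists>u. supp u \<subseteq> {..<rnk q} \<and> x = mat q u)" for x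
    by (simp only: ch.span_linext mat_def)
  then show ?thesis by blast
qed

text \<open>\<open>connect\<close> induces an isomorphism from the degree \<open>q\<close>
  cohomology of the specialised complex to the kernel of \<open>mat (Suc q)\<close> modulo the image
  of \<open>mat q\<close>. A basis \<open>W\<close> of the latter is lifted by
  \<open>connect_surj\<close> to cocycles \<open>F w\<close>, each up to an error
  \<open>mat q (U w)\<close>.\<close>

theorem cohomology_basis:
  "\<exists>(W :: (nat \<Rightarrow>\<^sub>0 'f) set) F. finite W \<and> card W = betti q ev \<and> (\<forall>w\<in>W. cocycle q (F w)) \<and>
     (\<forall>f. cocycle q f \<longrightarrow> (\<exists>c. coboundary q (\<lambda>s. f s - (\<Sum>w\<in>W. c w * F w s)))) \<and>
     (\<forall>c. coboundary q (\<lambda>s. \<Sum>w\<in>W. c w * F w s) \<longrightarrow> (\<forall>w\<in>W. c w = 0))"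
proof -
  let ?E = "(\<lambda>j. sgl j (1::'f)) ` {..<rnk (Suc q)}"
  have injE: "inj_on (\<lambda>j. sgl j (1::'f)) {..<rnk (Suc q)}"
    by (auto simp: inj_on_def dest: arg_cong[of _ _ supp])
  have E: "ch.independent ?E" "finite ?E" "card ?E = rnk (Suc q)"
  proof -
    show "ch.independent ?E"
    proof (rule fv.independent_familyI)
      fix c j assume c: "(\<Sum>j<rnk (Suc q). cscale (c j) (sgl j (1::'f))) = 0" and j: "j \<in> {..<rnk (Suc q)}"
      have "c j = coef (\<Sum>j<rnk (Suc q). cscale (c j) (sgl j (1::'f))) j"
        using j by (simp add: lookup_sum lookup_single when_def)
      also have "\<dots> = 0" by (simp only: c lookup_zero)
      finally show "c j = 0" .
    qed simp
  qed (simp_all add: card_image[OF injE])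
  have sE: "ch.span ?E = chains_on {..<rnk (Suc q)}"
    by (rule chains_on_span[symmetric])
  let ?I = "mat q ` chains_on {..<rnk q}"
  have lin: "Vector_Spaces.linear cscale cscale (mat (Suc q))"
    by unfold_locales (simp_all add: mat_add mat_scale)
  have I: "ch.subspace ?I" "?I \<subseteq> ch.span ?E" "\<And>x. x \<in> ?I \<Longrightarrow> mat (Suc q) x = 0"
    unfolding sE by (simp add: image_mat) (use supp_mat mat_mat in auto)
  have "\<exists>W. finite W \<and> card W + (fv.dim (mat (Suc q) ` ch.span ?E) + fv.dim ?I) = card ?E \<and>
    W \<subseteq> ch.span ?E \<and> (\<forall>w\<in>W. mat (Suc q) w = 0) \<and>
    (\<forall>x\<in>ch.span ?E. mat (Suc q) x = 0 \<longrightarrow> (\<exists>c. x - (\<Sum>w\<in>W. cscale (c w) w) \<in> ?I)) \<and>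
    (\<forall>c. (\<Sum>w\<in>W. cscale (c w) w) \<in> ?I \<longrightarrow> (\<forall>w\<in>W. c w = 0))"
    by (rule fv.subquotient_dim[OF E(1,2) lin I(1,2)]) (rule I(3))
  then obtain W
    where W0: "finite W \<and> card W + (fv.dim (mat (Suc q) ` ch.span ?E) + fv.dim ?I) = card ?E \<and>
    W \<subseteq> ch.span ?E \<and> (\<forall>w\<in>W. mat (Suc q) w = 0) \<and>
    (\<forall>x\<in>ch.span ?E. mat (Suc q) x = 0 \<longrightarrow> (\<exists>c. x - (\<Sum>w\<in>W. cscale (c w) w) \<in> ?I)) \<and>
    (\<forall>c. (\<Sum>w\<in>W. cscale (c w) w) \<in> ?I \<longrightarrow> (\<forall>w\<in>W. c w = 0))" by (elim exE)
  then have W: "finite W" "card W + (fv.dim (mat (Suc q) ` ch.span ?E) + fv.dim ?I) = card ?E"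
    "W \<subseteq> ch.span ?E" "\<And>w. w \<in> W \<Longrightarrow> mat (Suc q) w = 0" by simp_all
  have W5': "\<forall>x\<in>ch.span ?E. mat (Suc q) x = 0 \<longrightarrow> (\<exists>c. x - (\<Sum>w\<in>W. cscale (c w) w) \<in> ?I)"
    and W6': "\<forall>c. (\<Sum>w\<in>W. cscale (c w) w) \<in> ?I \<longrightarrow> (\<forall>w\<in>W. c w = 0)"
    by (rule W0[THEN conjunct2, THEN conjunct2, THEN conjunct2, THEN conjunct2, THEN conjunct1],
        rule W0[THEN conjunct2, THEN conjunct2, THEN conjunct2, THEN conjunct2, THEN conjunct2])
  have W5: "\<exists>c. x - (\<Sum>w\<in>W. cscale (c w) w) \<in> ?I" if "x \<in> ch.span ?E" "mat (Suc q) x = 0" for x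
    by (rule mp[OF bspec[OF W5' that(1)] that(2)])
  have W6: "c w = 0" if "(\<Sum>w\<in>W. cscale (c w) w) \<in> ?I" "w \<in> W" for c w
    by (rule bspec[OF mp[OF spec[OF W6', of c] that(1)] that(2)])
  have cW: "card W = betti q ev"
    using W(2) unfolding betti_def sE image_mat fv.dim_span E(3) by simp
  have "\<exists>f u. cocycle q f \<and> supp u \<subseteq> {..<rnk q} \<and> w = connect q f + mat q u" if "w \<in> W" for w
  proof -
    have "supp w \<subseteq> {..<rnk (Suc q)}" using W(3) that unfolding sE by blast
    from connect_surj[OF this W(4)[OF that]] show ?thesis by blast
  qed
  then have "\<forall>w\<in>W. \<exists>fu. cocycle q (fst fu) \<and> supp (snd fu) \<subseteq> {..<rnk q} \<and> w = connect q (fst fu) + mat q (snd fu)"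
    by simp
  from bchoice[OF this] obtain FU'
    where FU': "\<forall>w\<in>W. cocycle q (fst (FU' w)) \<and> supp (snd (FU' w)) \<subseteq> {..<rnk q} \<and>
      w = connect q (fst (FU' w)) + mat q (snd (FU' w))" ..
  define F U where "F w = fst (FU' w)" and "U w = snd (FU' w)" for w
  have FU: "cocycle q (F w)" "supp (U w) \<subseteq> {..<rnk q}" "w = connect q (F w) + mat q (U w)" if "w \<in> W" for w
    using FU' that by (simp_all add: F_def U_def)
  have split: "(\<Sum>w\<in>W. cscale (c w) w) = connect q (\<lambda>s. \<Sum>w\<in>W. c w * F w s) + (\<Sum>w\<in>W. cscale (c w) (mat q (U w)))" for c
  proof -
    have "(\<Sum>w\<in>W. cscale (c w) w) = (\<Sum>w\<in>W. cscale (c w) (connect q (F w)) + cscale (c w) (mat q (U w)))"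
    proof (rule sum.cong[OF refl])
      fix w assume "w \<in> W"
      from arg_cong[OF FU(3)[OF this], of "cscale (c w)"]
      show "cscale (c w) w = cscale (c w) (connect q (F w)) + cscale (c w) (mat q (U w))"
        by (simp only: ch.scale_right_distrib)
    qed
    then show ?thesis by (simp add: connect_sum sum.distrib)
  qed
  \<comment> \<open>The errors of the lifts lie in the subspace that is divided out, so they disturb
    neither generation nor independence.\<close>
  have inI: "(\<Sum>w\<in>W. cscale (c w) (mat q (U w))) \<in> ?I" for c
    by (intro ch.subspace_sum[OF I(1)] ch.subspace_scale[OF I(1)]) (use FU(2) in auto)
  have span: "\<exists>c. coboundary q (\<lambda>s. f s - (\<Sum>w\<in>W. c w * F w s))" if f: "cocycle q f" for f
  proof -
    have "connect q f \<in> ch.span ?E" using supp_connect[of q f] unfolding sE by blast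
    from W5[OF this mat_connect[OF f]] obtain c where c: "connect q f - (\<Sum>w\<in>W. cscale (c w) w) \<in> ?I" ..
    have eq: "connect q (\<lambda>s. f s - (\<Sum>w\<in>W. c w * F w s))
        = (connect q f - (\<Sum>w\<in>W. cscale (c w) w)) + (\<Sum>w\<in>W. cscale (c w) (mat q (U w)))"
      unfolding split by (simp add: connect_diff)
    have "connect q (\<lambda>s. f s - (\<Sum>w\<in>W. c w * F w s)) \<in> ?I"
      unfolding eq using c inI by (rule ch.subspace_add[OF I(1)])
    moreover have "cocycle q (\<lambda>s. f s - (\<Sum>w\<in>W. c w * F w s))"
      by (intro cocycle_diff f cocycle_sum FU(1))
    ultimately show ?thesis using connect_inj by blast
  qed
  have indep: "c w = 0" if c: "coboundary q (\<lambda>s. \<Sum>w\<in>W. c w * F w s)" and w: "w \<in> W" for c w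
  proof -
    obtain u where u: "supp u \<subseteq> {..<rnk q}" "connect q (\<lambda>s. \<Sum>w\<in>W. c w * F w s) = mat q u"
      using connect_coboundary[OF c] by blast
    then have "connect q (\<lambda>s. \<Sum>w\<in>W. c w * F w s) \<in> ?I" by blast
    then have "(\<Sum>w\<in>W. cscale (c w) w) \<in> ?I"
      unfolding split using inI by (rule ch.subspace_add[OF I(1)])
    then show ?thesis by (rule W6) (rule w)
  qed
  show ?thesis
    using W(1) cW FU(1) span indep by (intro exI[of _ W] exI[of _ F] conjI ballI allI impI)
qed

end

section \<open>Singular chains twisted by a cocycle\<close>

abbreviation simplex_space :: "nat \<Rightarrow> (nat \<Rightarrow> real) topology" where
  "simplex_space p \<equiv> subtopology (powertop_real UNIV) (standard_simplex p)"

abbreviation id_simplex :: "nat \<Rightarrow> (nat \<Rightarrow> real) \<Rightarrow> nat \<Rightarrow> real" where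
  "id_simplex p \<equiv> restrict id (standard_simplex p)"

lemma vertex_in_simplex [simp]: "vertex i \<in> standard_simplex p \<longleftrightarrow> i \<le> p"
  unfolding vertex_def by simp

lemma continuous_map_interpolate:
  assumes "continuous_map T euclideanreal a" "continuous_map T (powertop_real UNIV) f" "continuous_map T (powertop_real UNIV) g"
  shows "continuous_map T (powertop_real UNIV) (\<lambda>x i. (1 - a x) * f x i + a x * g x i)"
proof -
  have "continuous_map T euclideanreal (\<lambda>x. f x i)" "continuous_map T euclideanreal (\<lambda>x. g x i)" for i
    using assms(2,3) by (auto simp: continuous_map_componentwise_UNIV)
  then show ?thesis
    unfolding continuous_map_componentwise_UNIV
    by (intro allI continuous_map_add continuous_map_real_mult continuous_map_diff) (use assms(1) in auto)
qed

lemma straight_line_contraction: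
  assumes "\<And>x y t. x \<in> C \<Longrightarrow> 0 \<le> t \<Longrightarrow> t \<le> 1 \<Longrightarrow> (\<lambda>i. (1 - t) * x i + t * a i) \<in> C" "a \<in> C"
  shows "continuous_map (prod_topology (top_of_set {0..1::real}) (subtopology (powertop_real UNIV) C))
     (subtopology (powertop_real UNIV) C) (\<lambda>(t, x) i. (1 - t) * x i + t * a i)"
proof -
  let ?T = "prod_topology (top_of_set {0..1::real}) (subtopology (powertop_real UNIV) C)"
  have f: "continuous_map ?T euclideanreal fst"
    using continuous_map_fst[of "top_of_set {0..1::real}" "subtopology (powertop_real UNIV) C"]
    by (simp add: continuous_map_in_subtopology)
  have s: "continuous_map ?T (powertop_real UNIV) snd"
    using continuous_map_snd[of "top_of_set {0..1::real}" "subtopology (powertop_real UNIV) C"]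
    by (simp add: continuous_map_in_subtopology)
  have "continuous_map ?T (powertop_real UNIV) (\<lambda>x i. (1 - fst x) * snd x i + fst x * a i)"
    by (rule continuous_map_interpolate[OF f s]) simp
  then show ?thesis
    unfolding continuous_map_in_subtopology using assms by (auto simp: case_prod_unfold)
qed

lemma contractible_convex:
  assumes "\<And>x y t. x \<in> C \<Longrightarrow> y \<in> C \<Longrightarrow> 0 \<le> t \<Longrightarrow> t \<le> 1 \<Longrightarrow> (\<lambda>i. (1 - t) * x i + t * y i) \<in> C"
  shows "contractible_space (subtopology (powertop_real UNIV) C)"
proof (cases "C = {}")
  case True
  then show ?thesis by simp
next
  case False
  then obtain a where a: "a \<in> C" by blast
  have "homotopic_with (\<lambda>x. True) (subtopology (powertop_real UNIV) C) (subtopology (powertop_real UNIV) C) id (\<lambda>x. a)"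
    unfolding homotopic_with_def
    by (rule exI[of _ "\<lambda>(t, x) i. (1 - t) * x i + t * a i"]) (auto intro!: straight_line_contraction assms a)
  then show ?thesis unfolding contractible_space_def by blast
qed

lemma simplex_line:
  assumes "x \<in> standard_simplex p" "y \<in> standard_simplex p" "0 \<le> t" "t \<le> (1::real)"
  shows "(\<lambda>i. (1 - t) * x i + t * y i) \<in> standard_simplex p"
  using convex_standard_simplex assms by blast

lemma contractible_simplex_space: "contractible_space (simplex_space p)"
  by (rule contractible_convex) (rule simplex_line)

lemma pathin_leading_edge:
  assumes "singular_simplex (Suc p) Y s"
  shows "pathin Y (leading_edge s)"
proof -
  have l: "(\<lambda>j. (1 - t) * vertex 1 j + t * vertex 0 j) \<in> standard_simplex (Suc p)" if "0 \<le> t" "t \<le> 1" for t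
    by (rule simplex_line) (use that in auto)
  have "continuous_map (top_of_set {0..1::real}) (powertop_real UNIV) (\<lambda>t j. (1 - t) * vertex 1 j + t * vertex 0 j)"
    by (rule continuous_map_interpolate) auto
  then have "continuous_map (top_of_set {0..1::real}) (simplex_space (Suc p)) (\<lambda>t j. (1 - t) * vertex 1 j + t * vertex 0 j)"
    unfolding continuous_map_in_subtopology using l by auto
  moreover have "continuous_map (simplex_space (Suc p)) Y s" using assms by (simp add: singular_simplex_def)
  ultimately have "continuous_map (top_of_set {0..1::real}) Y (s \<circ> (\<lambda>t j. (1 - t) * vertex 1 j + t * vertex 0 j))"
    by (rule continuous_map_compose)
  then show ?thesis unfolding pathin_def leading_edge_def by (simp add: o_def)
qed

lemma singular_face_vertex:
  assumes "i \<le> Suc p"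
  shows "singular_face (Suc p) i s (vertex 0) = s (vertex (if i = 0 then 1 else 0))"
proof -
  have "simplical_face i (vertex 0) = vertex (if i = 0 then 1 else 0)"
    by (auto simp: simplical_face_def vertex_def fun_eq_iff)
  then show ?thesis by (simp add: singular_face_def)
qed

lemma singular_face_simplex_map':
  assumes "i \<le> Suc p"
  shows "singular_face (Suc p) i (simplex_map (Suc p) u s) = simplex_map p u (singular_face (Suc p) i s)"
  using assms simplical_face_in_standard_simplex[of "Suc p" i]
  by (auto simp: singular_face_def simplex_map_def fun_eq_iff restrict_def)

lemma frag_cmul_eq_cscale: "frag_cmul = cscale"
  by (intro ext poly_mapping_eqI) simp

lemma frag_extend_eq_linext: "frag_extend = linext cscale"
  by (intro ext) (simp add: frag_extend_def linext_def frag_cmul_eq_cscale)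

text \<open>The action of \<int> through which integral singular chains are pushed into chains over
  \<open>'r\<close>.\<close>

definition int_scale :: "int \<Rightarrow> ('b \<Rightarrow>\<^sub>0 'r::comm_ring_1) \<Rightarrow> 'b \<Rightarrow>\<^sub>0 'r" where
  "int_scale n c = cscale (of_int n) c"

interpretation ia: ring_action int_scale
  by unfold_locales (auto simp: int_scale_def ch.scale_right_distrib ch.scale_left_distrib)

lemma linext_int_scale: "linext cscale \<phi> (int_scale n c) = int_scale n (linext cscale \<phi> c)"
  by (simp add: int_scale_def ca.linext_cscale)

lemma linext_cscale_int: "linext cscale \<phi> (linext int_scale \<psi> c) = linext int_scale (\<lambda>b. linext cscale \<phi> (\<psi> b)) c"
  by (simp add: linext_def[of int_scale] ca.linext_sum linext_int_scale)

text \<open>\<open>e\<close> stands for the powers of t: a homomorphism from the additive group of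
  integers to the units of \<open>'r\<close>. A cocycle is fixed, not just its class, because paths
  that are not closed need weights too.\<close>

locale twisted =
  fixes X :: "'x topology" and z :: "((nat \<Rightarrow> real) \<Rightarrow> 'x) \<Rightarrow> int" and e :: "int \<Rightarrow> 'r::comm_ring_1"
  assumes cocycle: "z \<in> cocycles X (constant_system regular_module) 1"
    and e_0 [simp]: "e 0 = 1" and e_add: "e (i + j) = e i * e j"
begin

lemma e_inverse [simp]: "e (- i) * e i = 1" "e i * e (- i) = 1"
  using e_add[of "- i" i] e_add[of i "- i"] by simp_all

definition weight :: "((nat \<Rightarrow> real) \<Rightarrow> 'x) \<Rightarrow> int" where
  "weight s = z (path_simplex (leading_edge s))"

text \<open>The transpose of the coboundary of a local system in a trivialisation where transport
  along a path \<open>g\<close> is t to the power \<open>z (path_simplex g)\<close>. The face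
  opposite to vertex 0 is the only one with a different leading vertex, hence the only one with a
  weight.\<close>

definition tb :: "nat \<Rightarrow> ((nat \<Rightarrow> real) \<Rightarrow> 'x) \<Rightarrow> ((nat \<Rightarrow> real) \<Rightarrow> 'x) \<Rightarrow>\<^sub>0 'r" where
  "tb q s = (if q = 0 then 0 else
     sgl (singular_face q 0 s) (e (weight s)) + (\<Sum>i\<in>{1..q}. sgl (singular_face q i s) ((- 1) ^ i)))"

abbreviation Tb where "Tb q \<equiv> linext cscale (tb q)"

text \<open>A primitive of the pullback of \<open>z\<close> along \<open>u\<close>. The sign is such
  that \<psi> can be the value of \<open>z\<close> on a path from the given point to a base point.
  Where a potential exists, rescaling of simplices removes the twist.\<close>

definition potential :: "'y topology \<Rightarrow> ('y \<Rightarrow> 'x) \<Rightarrow> ('y \<Rightarrow> int) \<Rightarrow> bool" where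
  "potential Y u \<psi> \<longleftrightarrow> (\<forall>g. pathin Y g \<longrightarrow> z (path_simplex (u \<circ> g)) = \<psi> (g 0) - \<psi> (g 1))"

text \<open>A square filled by a contraction, cut along its diagonal into two triangles, expresses the
  value of the cocycle on a path by the values on the tracks of its end points.\<close>

lemma potential_of_contraction:
  assumes u: "continuous_map Y X u"
    and h: "continuous_map (prod_topology (top_of_set {0..1::real}) Y) Y h"
    and h0: "\<And>y. y \<in> topspace Y \<Longrightarrow> h (0, y) = y" and h1: "\<And>y. y \<in> topspace Y \<Longrightarrow> h (1, y) = a"
  shows "potential Y u (\<lambda>y. z (path_simplex (\<lambda>t. u (h (t, y)))))"
  unfolding potential_def
proof (intro allI impI)
  fix g assume g: "pathin Y g"
  have gY: "g t \<in> topspace Y" if "0 \<le> t" "t \<le> 1" for t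
    using continuous_map_image_subset_topspace[OF g[unfolded pathin_def]] that by auto
  define K where "K s t = u (h (s, g t))" for s t
  have "continuous_map (prod_topology (top_of_set {0..1::real}) (top_of_set {0..1::real}))
     (prod_topology (top_of_set {0..1::real}) Y) (\<lambda>(s, t). (s, g t))"
    using g unfolding pathin_def case_prod_unfold
    by (intro continuous_map_pairedI continuous_map_fst continuous_map_compose[OF continuous_map_snd, unfolded o_def])
  from continuous_map_compose[OF continuous_map_compose[OF this h] u]
  have Kc: "continuous_map (top_of_set ({0..1}\<times>{0..1})) X (\<lambda>(s, t). K s t)"
    by (simp add: prod_topology_subtopology_eu o_def case_prod_unfold K_def)
  have a: "u a \<in> topspace X"
  proof -
    have "h (1, g 0) \<in> topspace Y" using continuous_map_image_subset_topspace[OF h] gY[of 0] by fastforce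
    then show ?thesis using h1[OF gY[of 0]] continuous_map_image_subset_topspace[OF u] by auto
  qed
  have "singular_simplex 2 X (\<lambda>x\<in>standard_simplex 2. K (x 2) (x 1 + x 2))"
    by (rule continuous_two_simplex[OF Kc])
      (auto intro!: continuous_map_add continuous_simplex_coord dest!: simplex_2)
  from cocycle_triangle[OF cocycle, of "\<lambda>a b. K b (a + b)", OF this]
  have "z (path_simplex (\<lambda>t. K t t)) = z (path_simplex (\<lambda>t. K t 1)) + z (path_simplex (\<lambda>t. K 0 t))"
    by simp
  also have "path_simplex (\<lambda>t. K 0 t) = path_simplex (u \<circ> g)"
    by (rule path_simplex_cong) (simp add: K_def h0 gY)
  finally have 1: "z (path_simplex (\<lambda>t. K t t)) = z (path_simplex (\<lambda>t. K t 1)) + z (path_simplex (u \<circ> g))" .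
  have "singular_simplex 2 X (\<lambda>x\<in>standard_simplex 2. K (x 1 + x 2) (x 2))"
    by (rule continuous_two_simplex[OF Kc])
      (auto intro!: continuous_map_add continuous_simplex_coord dest!: simplex_2)
  from cocycle_triangle[OF cocycle, of "\<lambda>a b. K (a + b) b", OF this]
  have "z (path_simplex (\<lambda>t. K t t)) = z (path_simplex (\<lambda>t. K 1 t)) + z (path_simplex (\<lambda>t. K t 0))"
    by simp
  also have "path_simplex (\<lambda>t. K 1 t) = path_simplex (\<lambda>_. u a)"
    by (rule path_simplex_cong) (simp add: K_def h1 gY)
  finally have 2: "z (path_simplex (\<lambda>t. K t t)) = z (path_simplex (\<lambda>t. K t 0))"
    using cocycle_const[OF cocycle a] by simp
  show "z (path_simplex (u \<circ> g)) = z (path_simplex (\<lambda>t. u (h (t, g 0)))) - z (path_simplex (\<lambda>t. u (h (t, g 1))))"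
    using 1 2 by (simp add: K_def)
qed

lemma potential_exists:
  assumes "contractible_space Y" "continuous_map Y X u"
  obtains \<psi> where "potential Y u \<psi>"
proof -
  obtain a where "homotopic_with (\<lambda>x. True) Y Y id (\<lambda>x. a)"
    using assms(1) unfolding contractible_space_def by blast
  then obtain h where h: "continuous_map (prod_topology (top_of_set {0..1::real}) Y) Y h"
    "\<And>x. h (0, x) = x" "\<And>x. h (1, x) = a"
    unfolding homotopic_with_def by auto
  show ?thesis by (rule that[OF potential_of_contraction[OF assms(2) h(1), of a]]) (simp_all add: h)
qed

lemma potential_unique:
  assumes "path_connected_space Y" "potential Y u \<psi>" "potential Y u \<psi>'" "x \<in> topspace Y" "y \<in> topspace Y"
  shows "\<psi> x - \<psi> y = \<psi>' x - \<psi>' y"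
proof -
  obtain g where "pathin Y g" "g 0 = x" "g 1 = y"
    using assms(1,4,5) unfolding path_connected_space_def by blast
  then show ?thesis using assms(2,3) unfolding potential_def by metis
qed

lemma potential_compose:
  assumes "continuous_map Y' Y v" "potential Y u \<psi>"
  shows "potential Y' (u \<circ> v) (\<psi> \<circ> v)"
  unfolding potential_def
proof (intro allI impI)
  fix g assume "pathin Y' g"
  then have "pathin Y (v \<circ> g)" unfolding pathin_def using assms(1) by (rule continuous_map_compose)
  then show "z (path_simplex (u \<circ> v \<circ> g)) = (\<psi> \<circ> v) (g 0) - (\<psi> \<circ> v) (g 1)"
    using assms(2) unfolding potential_def by (simp add: comp_assoc)
qed

text \<open>A simplex is weighted by the potential at its leading vertex. By \<open>tb_push\<close>
  this is a chain map from ordinary integral chains of \<open>Y\<close>, so homotopies and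
  subdivisions on \<open>Y\<close> can be carried over to twisted chains.\<close>

definition push :: "nat \<Rightarrow> ('y \<Rightarrow> 'x) \<Rightarrow> ('y \<Rightarrow> int) \<Rightarrow> 'y chain \<Rightarrow> ((nat \<Rightarrow> real) \<Rightarrow> 'x) \<Rightarrow>\<^sub>0 'r" where
  "push p u \<psi> = linext int_scale (\<lambda>\<sigma>. sgl (simplex_map p u \<sigma>) (e (\<psi> (\<sigma> (vertex 0)))))"

lemma push_of: "push p u \<psi> (frag_of \<sigma>) = sgl (simplex_map p u \<sigma>) (e (\<psi> (\<sigma> (vertex 0))))"
  by (simp add: push_def int_scale_def)

lemma push_0 [simp]: "push p u \<psi> 0 = 0"
  by (simp add: push_def)

lemma push_diff: "push p u \<psi> (c - d) = push p u \<psi> c - push p u \<psi> d"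
  by (simp add: push_def ia.linext_diff)

lemma push_sum: "push p u \<psi> (\<Sum>i\<in>I. f i) = (\<Sum>i\<in>I. push p u \<psi> (f i))"
  by (simp add: push_def ia.linext_sum)

lemma push_cmul: "push p u \<psi> (frag_cmul n c) = int_scale n (push p u \<psi> c)"
  by (simp add: push_def frag_cmul_eq_cscale ia.linext_cscale)

lemma push_extend: "push p u \<psi> (frag_extend f c) = linext int_scale (\<lambda>b. push p u \<psi> (f b)) c"
  by (simp add: push_def frag_extend_eq_linext ia.linext_linext)

lemma supp_push: "supp (push p u \<psi> c) \<subseteq> simplex_map p u ` supp c"
proof -
  have "push p u \<psi> c \<in> chains_on (simplex_map p u ` supp c)"
    unfolding push_def linext_def int_scale_def
    by (intro ch.subspace_sum[OF subspace_chains_on] ch.subspace_scale[OF subspace_chains_on]) auto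
  then show ?thesis by simp
qed

lemma weight_simplex_map:
  assumes "singular_simplex (Suc p) Y \<sigma>" "potential Y u \<psi>"
  shows "weight (simplex_map (Suc p) u \<sigma>) = \<psi> (\<sigma> (vertex 1)) - \<psi> (\<sigma> (vertex 0))"
proof -
  have "path_simplex (leading_edge (simplex_map (Suc p) u \<sigma>)) = path_simplex (u \<circ> leading_edge \<sigma>)"
    by (rule path_simplex_cong) (auto simp: leading_edge_def simplex_map_def intro: simplex_line)
  moreover have "leading_edge \<sigma> 0 = \<sigma> (vertex 1)" "leading_edge \<sigma> 1 = \<sigma> (vertex 0)"
    by (simp_all add: leading_edge_def)
  moreover have "z (path_simplex (u \<circ> leading_edge \<sigma>)) = \<psi> (leading_edge \<sigma> 0) - \<psi> (leading_edge \<sigma> 1)"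
    using assms(2) pathin_leading_edge[OF assms(1)] unfolding potential_def by blast
  ultimately show ?thesis by (simp only: weight_def)
qed

text \<open>By \<open>weight_simplex_map\<close> the leading edge has as weight the difference of
  the potentials at vertices 1 and 0. It turns the factor for vertex 0 into the one for vertex 1,
  the leading vertex of face 0, while the other faces keep the leading vertex and the
  factor.\<close>

lemma tb_push:
  assumes c: "singular_chain (Suc p) Y c" and pot: "potential Y u \<psi>"
  shows "Tb (Suc p) (push (Suc p) u \<psi> c) = push p u \<psi> (chain_boundary (Suc p) c)"
proof -
  have *: "Tb (Suc p) (push (Suc p) u \<psi> (frag_of \<sigma>)) = push p u \<psi> (\<Sum>k\<le>Suc p. frag_cmul ((- 1) ^ k) (frag_of (singular_face (Suc p) k \<sigma>)))"
    if s: "singular_simplex (Suc p) Y \<sigma>" for \<sigma>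
  proof -
    let ?u = "simplex_map (Suc p) u \<sigma>"
    let ?f = "\<lambda>k. simplex_map p u (singular_face (Suc p) k \<sigma>)"
    have "push p u \<psi> (\<Sum>k\<le>Suc p. frag_cmul ((- 1) ^ k) (frag_of (singular_face (Suc p) k \<sigma>)))
        = (\<Sum>k\<le>Suc p. sgl (?f k) ((- 1) ^ k * e (\<psi> (singular_face (Suc p) k \<sigma> (vertex 0)))))"
      by (simp only: push_sum push_cmul push_of int_scale_def cscale_single of_int_power of_int_minus of_int_1)
    also have "\<dots> = sgl (?f 0) (e (\<psi> (\<sigma> (vertex 1)))) +
        (\<Sum>k\<in>{1..Suc p}. sgl (?f k) ((- 1) ^ k * e (\<psi> (singular_face (Suc p) k \<sigma> (vertex 0)))))"
      unfolding atMost_atLeast0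
      by (subst sum.atLeast_Suc_atMost) (simp_all del: sum.cl_ivl_Suc add: singular_face_vertex)
    also have "\<dots> = sgl (?f 0) (e (\<psi> (\<sigma> (vertex 0))) * e (weight ?u)) +
        (\<Sum>k\<in>{1..Suc p}. cscale (e (\<psi> (\<sigma> (vertex 0)))) (sgl (?f k) ((- 1) ^ k)))"
    proof -
      have "e (\<psi> (\<sigma> (vertex 0))) * e (weight ?u) = e (\<psi> (\<sigma> (vertex 1)))"
        by (simp add: weight_simplex_map[OF s pot] e_add[symmetric])
      moreover have "(\<Sum>k\<in>{1..Suc p}. sgl (?f k) ((- 1) ^ k * e (\<psi> (singular_face (Suc p) k \<sigma> (vertex 0)))))
          = (\<Sum>k\<in>{1..Suc p}. cscale (e (\<psi> (\<sigma> (vertex 0)))) (sgl (?f k) ((- 1) ^ k)))"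
        by (rule sum.cong) (auto simp: singular_face_vertex mult.commute)
      ultimately show ?thesis by simp
    qed
    also have "\<dots> = cscale (e (\<psi> (\<sigma> (vertex 0)))) (tb (Suc p) ?u)"
    proof -
      have "(\<Sum>k\<in>{1..Suc p}. sgl (singular_face (Suc p) k ?u) ((- 1) ^ k)) = (\<Sum>k\<in>{1..Suc p}. sgl (?f k) ((- 1) ^ k :: 'r))"
        by (rule sum.cong) (auto simp: singular_face_simplex_map')
      then show ?thesis
        by (simp add: tb_def singular_face_simplex_map' ch.scale_right_distrib ch.scale_sum_right)
    qed
    finally show ?thesis by (simp add: push_of)
  qed
  have "Tb (Suc p) (push (Suc p) u \<psi> c) = linext int_scale (\<lambda>\<sigma>. Tb (Suc p) (push (Suc p) u \<psi> (frag_of \<sigma>))) c"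
    unfolding push_of by (simp add: push_def linext_cscale_int)
  also have "\<dots> = linext int_scale (\<lambda>\<sigma>. push p u \<psi> (\<Sum>k\<le>Suc p. frag_cmul ((- 1) ^ k) (frag_of (singular_face (Suc p) k \<sigma>)))) c"
    by (rule linext_cong) (use c * in \<open>auto simp: singular_chain_def\<close>)
  also have "\<dots> = push p u \<psi> (chain_boundary (Suc p) c)"
    by (simp add: chain_boundary_def push_extend)
  finally show ?thesis .
qed

text \<open>The potential that comes from the straight contraction of a simplex to vertex 0, and
  therefore the one normalised to be 0 at vertex 0.\<close>

definition line_potential :: "((nat \<Rightarrow> real) \<Rightarrow> 'x) \<Rightarrow> (nat \<Rightarrow> real) \<Rightarrow> int" where
  "line_potential s x = z (path_simplex (\<lambda>t. s (\<lambda>i. (1 - t) * x i + t * vertex 0 i)))"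

lemma potential_line:
  assumes "singular_simplex p X s"
  shows "potential (simplex_space p) s (line_potential s)"
proof -
  have "potential (simplex_space p) s (\<lambda>x. z (path_simplex (\<lambda>t. s ((\<lambda>(t, x) i. (1 - t) * x i + t * vertex 0 i) (t, x)))))"
    by (rule potential_of_contraction[where a = "vertex 0"])
      (use assms in \<open>auto simp: singular_simplex_def intro!: straight_line_contraction simplex_line\<close>)
  then show ?thesis by (simp add: line_potential_def[abs_def])
qed

lemma line_potential_vertex:
  assumes "singular_simplex p X s"
  shows "line_potential s (vertex 0) = 0"
proof -
  have "path_simplex (\<lambda>t. s (\<lambda>i. (1 - t) * vertex 0 i + t * vertex 0 i)) = path_simplex (\<lambda>t. s (vertex 0))"
    by (simp add: left_diff_distrib)
  moreover have "s (vertex 0) \<in> topspace X"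
    using assms continuous_map_image_subset_topspace unfolding singular_simplex_def by fastforce
  ultimately show ?thesis unfolding line_potential_def using cocycle_const[OF cocycle] by metis
qed

lemma simplex_map_id_simplex:
  assumes "singular_simplex p X s"
  shows "simplex_map p s (id_simplex p) = s"
  using singular_simplex_chain_map_id[OF assms] by (simp add: frag_of_eq)

lemma push_id_simplex:
  assumes "singular_simplex p X s"
  shows "push p s (line_potential s) (frag_of (id_simplex p)) = sgl s 1"
  by (simp add: push_of simplex_map_id_simplex[OF assms] line_potential_vertex[OF assms])

lemma singular_simplex_id: "singular_simplex p (simplex_space p) (id_simplex p)"
  using simplicial_simplex_id[of p "standard_simplex p"] unfolding simplicial_simplex_def by simp

lemma singular_chain_id: "singular_chain p (simplex_space p) (frag_of (id_simplex p))"
  using singular_simplex_id by (simp add: singular_chain_of)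

text \<open>\<open>s\<close> is the pushforward of the identity simplex with weight 1, so
  \<open>tb_push\<close> applies. Identities for \<open>tb\<close>, such as \<open>tb_tb\<close>,
  thereby reduce to those for the ordinary boundary.\<close>

lemma tb_eq_push:
  assumes "singular_simplex (Suc p) X s"
  shows "tb (Suc p) s = push p s (line_potential s) (chain_boundary (Suc p) (frag_of (id_simplex (Suc p))))"
proof -
  have "Tb (Suc p) (push (Suc p) s (line_potential s) (frag_of (id_simplex (Suc p)))) =
      push p s (line_potential s) (chain_boundary (Suc p) (frag_of (id_simplex (Suc p))))"
    by (rule tb_push[OF singular_chain_id potential_line[OF assms]])
  then show ?thesis unfolding push_id_simplex[OF assms] by simp
qed

lemma supp_tb:
  assumes "singular_simplex (Suc q) (subtopology X U) s"
  shows "supp (tb (Suc q) s) \<subseteq> singular_simplex_set q (subtopology X U)"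
proof -
  have f: "singular_simplex q (subtopology X U) (singular_face (Suc q) i s)" if "i \<le> Suc q" for i
    using singular_simplex_singular_face[OF assms, of i] that by simp
  have m: "sgl (singular_face (Suc q) i s) r \<in> chains_on (singular_simplex_set q (subtopology X U))"
    if "i \<le> Suc q" for i and r :: 'r
    using f[OF that] by simp
  have "tb (Suc q) s = sgl (singular_face (Suc q) 0 s) (e (weight s)) + (\<Sum>i\<in>{1..Suc q}. sgl (singular_face (Suc q) i s) ((- 1) ^ i))"
    by (simp only: tb_def nat.distinct if_False)
  also have "\<dots> \<in> chains_on (singular_simplex_set q (subtopology X U))"
    by (intro ch.subspace_add[OF subspace_chains_on] ch.subspace_sum[OF subspace_chains_on] m) auto
  finally show ?thesis by simp
qed

lemma tb_tb:
  assumes "singular_simplex (Suc q) X s"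
  shows "Tb q (tb (Suc q) s) = 0"
proof (cases q)
  case 0
  then show ?thesis by (simp add: tb_def linext_def)
next
  case (Suc p)
  let ?i = "id_simplex (Suc (Suc p))"
  have s: "singular_simplex (Suc (Suc p)) X s" using assms Suc by simp
  have "Tb (Suc p) (tb (Suc (Suc p)) s) = Tb (Suc p) (push (Suc p) s (line_potential s) (chain_boundary (Suc (Suc p)) (frag_of ?i)))"
    by (simp only: tb_eq_push[OF s])
  also have "\<dots> = push p s (line_potential s) (chain_boundary (Suc p) (chain_boundary (Suc (Suc p)) (frag_of ?i)))"
    by (rule tb_push[OF singular_chain_boundary_alt[OF singular_chain_id] potential_line[OF s]])
  also have "chain_boundary (Suc p) (chain_boundary (Suc (Suc p)) (frag_of ?i)) = 0"
    by (rule chain_boundary_boundary_alt[OF singular_chain_id])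
  finally show ?thesis by (simp add: Suc)
qed

lemma based_complex_twisted: "based_complex (\<lambda>q. singular_simplex_set q (subtopology X U)) tb"
proof
  fix q s assume "s \<in> singular_simplex_set (Suc q) (subtopology X U)"
  then have s: "singular_simplex (Suc q) (subtopology X U) s" by simp
  then have "singular_simplex (Suc q) X s" by (simp add: singular_simplex_subtopology)
  then show "Tb q (tb (Suc q) s) = 0" by (rule tb_tb)
  show "supp (tb (Suc q) s) \<subseteq> singular_simplex_set q (subtopology X U)" by (rule supp_tb[OF s])
qed (simp add: tb_def)

end

section \<open>Chains in contractible subspaces\<close>

lemma cycle_imp_boundary_contractible:
  assumes Y: "contractible_space Y" and c: "singular_chain (Suc q) Y c" "chain_boundary (Suc q) c = 0"
  shows "\<exists>c'. singular_chain (Suc (Suc q)) Y c' \<and> chain_boundary (Suc (Suc q)) c' = c"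
proof -
  have "trivial_group (homology_group (int (Suc q)) Y)"
    using trivial_reduced_homology_group_contractible_space[OF Y, of "int (Suc q)"]
    by (simp add: un_reduced_homology_group)
  moreover have cyc: "singular_relcycle (Suc q) Y {} c"
    using c by (simp add: singular_cycle)
  have "homologous_rel_set (Suc q) Y {} c \<in> carrier (homology_group (int (Suc q)) Y)"
    unfolding carrier_relative_homology_group using cyc by blast
  ultimately have "homologous_rel_set (Suc q) Y {} c = singular_relboundary_set (Suc q) Y {}"
    unfolding trivial_group_def by (metis one_relative_homology_group singletonD)
  then have "singular_relboundary (Suc q) Y {} c"
    using homologous_rel_refl[of "Suc q" Y "{}" c] by blast
  then show ?thesis by (auto simp: singular_boundary)
qed

lemma path_connected_contractible: "contractible_space Y \<Longrightarrow> path_connected_space Y"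
  by (rule contractible_imp_path_connected_space)

lemma linext_chain_boundary: "linext cscale (\<lambda>s. chain_boundary q (frag_of s)) c = chain_boundary q c"
  by (cases q) (simp_all add: chain_boundary_def frag_extend_eq_linext linext_def)

text \<open>An instance of \<open>null_homotopy\<close> for the identity minus the augmentation onto
  multiples of \<open>s0\<close>. The start in degree 0 is that all points of a path connected space
  are homologous.\<close>

lemma contractible_homotopy:
  assumes Y: "contractible_space Y" and s0: "singular_simplex 0 Y s0"
  shows "\<exists>h. \<forall>q s. singular_simplex q Y s \<longrightarrow> singular_chain (Suc q) Y (h q s) \<and>
     chain_boundary (Suc q) (h q s) =
       frag_of s - (if q = 0 then frag_of s0 else 0) - frag_extend (h (q - 1)) (chain_boundary q (frag_of s))"
proof -
  interpret based_complex "\<lambda>q. singular_simplex_set q Y" "\<lambda>q s. chain_boundary q (frag_of s)"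
  proof
    fix q s assume "s \<in> singular_simplex_set (Suc q) Y"
    then have s: "singular_chain (Suc q) Y (frag_of s)" by (simp add: singular_chain_of)
    from singular_chain_boundary_alt[OF s]
    show "supp (chain_boundary (Suc q) (frag_of s)) \<subseteq> singular_simplex_set q Y"
      by (simp add: singular_chain_def)
    show "linext cscale (\<lambda>s. chain_boundary q (frag_of s)) (chain_boundary (Suc q) (frag_of s)) = 0"
      unfolding linext_chain_boundary by (rule chain_boundary_boundary_alt[OF s])
  qed (simp add: chain_boundary_def)
  have "\<exists>h. \<forall>q. \<forall>s\<in>singular_simplex_set q Y. supp (h q s) \<subseteq> singular_simplex_set (Suc q) Y \<and>
     linext cscale (\<lambda>s. chain_boundary (Suc q) (frag_of s)) (h q s) =
     (frag_of s - (if q = 0 then frag_of s0 else 0)) - linext cscale (h (q - 1)) (chain_boundary q (frag_of s))"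
  proof (rule null_homotopy)
    fix s assume "s \<in> singular_simplex_set 0 Y"
    then have "homologous_rel 0 Y {} (frag_of s) (frag_of s0)"
      by (intro iso_integer_zeroth_homology_group_aux path_connected_contractible Y s0) simp
    then show "\<exists>c. supp c \<subseteq> singular_simplex_set 1 Y \<and> linext cscale (\<lambda>s. chain_boundary 1 (frag_of s)) c
        = frag_of s - (if (0::nat) = 0 then frag_of s0 else 0)"
      unfolding linext_chain_boundary by (simp add: homologous_rel_def singular_boundary singular_chain_def)
  next
    fix q and c :: "'a chain"
    assume "supp c \<subseteq> singular_simplex_set (Suc q) Y" "linext cscale (\<lambda>s. chain_boundary (Suc q) (frag_of s)) c = 0"
    then show "\<exists>c'. supp c' \<subseteq> singular_simplex_set (Suc (Suc q)) Y \<and>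
        linext cscale (\<lambda>s. chain_boundary (Suc (Suc q)) (frag_of s)) c' = c"
      using cycle_imp_boundary_contractible[OF Y] unfolding linext_chain_boundary singular_chain_def by blast
  next
    fix q s assume s: "s \<in> singular_simplex_set q Y"
    have "frag_of s - (if q = 0 then frag_of s0 else 0) \<in> chains_on (singular_simplex_set q Y)"
      using s s0 by (intro ch.subspace_diff[OF subspace_chains_on]) auto
    then show "supp (frag_of s - (if q = 0 then frag_of s0 else 0)) \<subseteq> singular_simplex_set q Y" by simp
  next
    fix q s assume s: "s \<in> singular_simplex_set (Suc q) Y"
    have *: "linext cscale frag_of c = c" for c :: "'a chain"
      by simp
    \<comment> \<open>For \<open>q = 0\<close> the constant \<open>s0\<close> cancels on the right,
      since the two faces of a 1-simplex carry opposite signs.\<close>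
    show "linext cscale (\<lambda>s. chain_boundary (Suc q) (frag_of s)) (frag_of s - (if Suc q = 0 then frag_of s0 else 0))
        = linext cscale (\<lambda>s. frag_of s - (if q = 0 then frag_of s0 else 0)) (chain_boundary (Suc q) (frag_of s))"
      unfolding linext_chain_boundary ca.linext_fun_diff *
      by (simp add: chain_boundary_of ca.linext_diff)
  qed
  then show ?thesis
    unfolding linext_chain_boundary frag_extend_eq_linext singular_chain_def by simp
qed

context twisted
begin

text \<open>The homotopy of \<open>contractible_homotopy\<close> is pushed along the inclusion with
  a potential. In degree 0 the base simplex appears with a factor that depends on the potential
  difference between \<open>s\<close> and \<open>s0\<close>, hence the existential over
  \<open>r\<close>.\<close>

lemma contractible_twisted_homotopy:
  assumes B: "contractible_space (subtopology X B)" and s0: "singular_simplex 0 (subtopology X B) s0"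
  shows "\<exists>H. (\<forall>q s. singular_simplex q (subtopology X B) s \<longrightarrow> supp (H q s) \<subseteq> singular_simplex_set (Suc q) (subtopology X B)) \<and>
     (\<forall>q s. singular_simplex (Suc q) (subtopology X B) s \<longrightarrow> Tb (Suc (Suc q)) (H (Suc q) s) = sgl s 1 - linext cscale (H q) (tb (Suc q) s)) \<and>
     (\<forall>s. singular_simplex 0 (subtopology X B) s \<longrightarrow> (\<exists>r. Tb 1 (H 0 s) = sgl s 1 - sgl s0 r))"
proof -
  let ?Y = "subtopology X B"
  have "continuous_map ?Y X id" by (simp add: continuous_map_from_subtopology)
  from potential_exists[OF B this] obtain \<psi> where pot: "potential ?Y id \<psi>" by blast
  from contractible_homotopy[OF B s0] obtain h where h0: "\<forall>q s. singular_simplex q ?Y s \<longrightarrow> singular_chain (Suc q) ?Y (h q s) \<and>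
     chain_boundary (Suc q) (h q s) =
       frag_of s - (if q = 0 then frag_of s0 else 0) - frag_extend (h (q - 1)) (chain_boundary q (frag_of s))" ..
  have h1: "singular_chain (Suc q) ?Y (h q s)" 
    and h2: "chain_boundary (Suc q) (h q s) =
       frag_of s - (if q = 0 then frag_of s0 else 0) - frag_extend (h (q - 1)) (chain_boundary q (frag_of s))"
    if "singular_simplex q ?Y s" for q s using h0 that by simp_all
  let ?w = "\<lambda>s. \<psi> (s (vertex 0))"
  \<comment> \<open>The scalar cancels the weight that \<open>push\<close> puts on \<open>s\<close>
    itself, see \<open>push_frag\<close>.\<close>
  define H where "H q s = cscale (e (- ?w s)) (push (Suc q) id \<psi> (h q s))" for q s
  have id: "simplex_map q id s = s" if "singular_simplex q ?Y s" for q s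
    using simplex_map_id_gen[OF that, of id] by simp
  have push_frag: "cscale (e (- ?w s)) (push q id \<psi> (frag_of s)) = sgl s 1" if "singular_simplex q ?Y s" for q s
    by (simp add: push_of id[OF that] del: simplex_map_id)
  have push_h: "push (Suc q) id \<psi> (frag_extend (h q) c) = linext cscale (H q) (push q id \<psi> c)"
    if "singular_chain q ?Y c" for q c
  proof -
    have "linext cscale (H q) (push q id \<psi> c) = linext int_scale (\<lambda>\<sigma>. linext cscale (H q) (push q id \<psi> (frag_of \<sigma>))) c"
      unfolding push_of by (simp add: push_def linext_cscale_int)
    also have "\<dots> = linext int_scale (\<lambda>\<sigma>. push (Suc q) id \<psi> (h q \<sigma>)) c"
    proof (rule linext_cong)
      fix \<sigma> assume "\<sigma> \<in> supp c"
      then have "singular_simplex q ?Y \<sigma>" using that by (auto simp: singular_chain_def)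
      then show "linext cscale (H q) (push q id \<psi> (frag_of \<sigma>)) = push (Suc q) id \<psi> (h q \<sigma>)"
        by (simp add: push_of id H_def del: simplex_map_id)
    qed
    finally show ?thesis by (simp add: push_extend)
  qed
  have supp_H: "supp (H q s) \<subseteq> singular_simplex_set (Suc q) ?Y" if s: "singular_simplex q ?Y s" for q s
  proof -
    have "supp (push (Suc q) id \<psi> (h q s)) \<subseteq> simplex_map (Suc q) id ` supp (h q s)" by (rule supp_push)
    also have "\<dots> = id ` supp (h q s)"
      using h1[OF s] id[of "Suc q"] unfolding singular_chain_def by (intro image_cong) auto
    also have "\<dots> \<subseteq> singular_simplex_set (Suc q) ?Y" using h1[OF s] unfolding singular_chain_def by simp
    finally show ?thesis unfolding H_def using keys_cscale by (rule order.trans[rotated])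
  qed
  have Tb_H: "Tb (Suc q) (H q s) = cscale (e (- ?w s)) (push q id \<psi> (chain_boundary (Suc q) (h q s)))"
    if "singular_simplex q ?Y s" for q s
    unfolding H_def ca.linext_cscale tb_push[OF h1[OF that] pot] ..
  have "Tb (Suc (Suc q)) (H (Suc q) s) = sgl s 1 - linext cscale (H q) (tb (Suc q) s)"
    if s: "singular_simplex (Suc q) ?Y s" for q s
  proof -
    have c: "singular_chain (Suc q) ?Y (frag_of s)" using s by (simp add: singular_chain_of)
    have "Tb (Suc q) (sgl s 1) = cscale (e (- ?w s)) (push q id \<psi> (chain_boundary (Suc q) (frag_of s)))"
      unfolding push_frag[OF s, symmetric] ca.linext_cscale tb_push[OF c pot] ..
    then have t: "tb (Suc q) s = cscale (e (- ?w s)) (push q id \<psi> (chain_boundary (Suc q) (frag_of s)))" by simp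
    have "Tb (Suc (Suc q)) (H (Suc q) s) = cscale (e (- ?w s)) (push (Suc q) id \<psi> (frag_of s))
        - cscale (e (- ?w s)) (push (Suc q) id \<psi> (frag_extend (h q) (chain_boundary (Suc q) (frag_of s))))"
      unfolding Tb_H[OF s] h2[OF s] by (simp add: push_diff ch.scale_right_diff_distrib)
    also have "\<dots> = sgl s 1 - linext cscale (H q) (tb (Suc q) s)"
      unfolding push_frag[OF s] push_h[OF singular_chain_boundary_alt[OF c]] t ca.linext_cscale ..
    finally show ?thesis .
  qed
  moreover have "\<exists>r. Tb 1 (H 0 s) = sgl s 1 - sgl s0 r" if s: "singular_simplex 0 ?Y s" for s
  proof
    have "Tb 1 (H 0 s) = cscale (e (- ?w s)) (push 0 id \<psi> (frag_of s)) - cscale (e (- ?w s)) (push 0 id \<psi> (frag_of s0))"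
      using Tb_H[OF s] h2[OF s] by (simp add: push_diff ch.scale_right_diff_distrib chain_boundary_def)
    also have "\<dots> = sgl s 1 - sgl s0 (e (- ?w s) * e (?w s0))"
      unfolding push_frag[OF s] by (simp add: push_of id[OF s0] del: simplex_map_id)
    finally show "Tb 1 (H 0 s) = sgl s 1 - sgl s0 (e (- ?w s) * e (?w s0))" .
  qed
  ultimately show ?thesis using supp_H by (intro exI[of _ H] conjI allI impI) simp_all
qed

definition chains :: "nat \<Rightarrow> 'x set \<Rightarrow> (((nat \<Rightarrow> real) \<Rightarrow> 'x) \<Rightarrow>\<^sub>0 'r) set" where
  "chains q U = chains_on (singular_simplex_set q (subtopology X U))"

definition cycles :: "nat \<Rightarrow> 'x set \<Rightarrow> (((nat \<Rightarrow> real) \<Rightarrow> 'x) \<Rightarrow>\<^sub>0 'r) set" where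
  "cycles q U = {c \<in> chains q U. Tb q c = 0}"

lemma subspace_chains: "ch.subspace (chains q U)"
  unfolding chains_def by (rule subspace_chains_on)

lemma cyclesI: "c \<in> chains q U \<Longrightarrow> Tb q c = 0 \<Longrightarrow> c \<in> cycles q U"
  by (simp add: cycles_def)

lemma cyclesD: "c \<in> cycles q U \<Longrightarrow> c \<in> chains q U" "c \<in> cycles q U \<Longrightarrow> Tb q c = 0"
  by (simp_all add: cycles_def)

lemma subspace_cycles: "ch.subspace (cycles q U)"
proof -
  have "cycles q U = chains q U \<inter> {c. Tb q c = 0}" by (auto simp: cycles_def)
  then show ?thesis
    using ch.subspace_inter[OF subspace_chains Modules.module_hom.subspace_kernel[OF ca.module_hom_linext]] by simp
qed

lemma mem_chains: "c \<in> chains q U \<longleftrightarrow> (\<forall>s\<in>supp c. singular_simplex q X s \<and> s ` standard_simplex q \<subseteq> U)"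
  by (simp add: chains_def subset_iff[of "supp c"] singular_simplex_subtopology Ball_def)

lemma chains_mono:
  assumes "U \<subseteq> V"
  shows "chains q U \<subseteq> chains q V"
proof
  fix c assume c: "c \<in> chains q U"
  show "c \<in> chains q V"
    unfolding mem_chains
  proof
    fix s assume s: "s \<in> supp c"
    have "\<forall>s\<in>supp c. singular_simplex q X s \<and> s ` standard_simplex q \<subseteq> U" using c by (simp only: mem_chains)
    from bspec[OF this s] show "singular_simplex q X s \<and> s ` standard_simplex q \<subseteq> V" using assms by (simp add: subset_trans[of _ U V])
  qed
qed

lemma chains_Int: "c \<in> chains q U \<Longrightarrow> c \<in> chains q V \<Longrightarrow> c \<in> chains q (U \<inter> V)"
  by (auto simp: mem_chains)

lemma Tb_chains: "c \<in> chains (Suc q) U \<Longrightarrow> Tb (Suc q) c \<in> chains q U"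
  using based_complex.supp_Bd[OF based_complex_twisted] unfolding chains_def by blast

lemma Tb_Tb: "c \<in> chains (Suc q) U \<Longrightarrow> Tb q (Tb (Suc q) c) = 0"
  using based_complex.Bd_Bd[OF based_complex_twisted] unfolding chains_def by blast

lemma Tb_0 [simp]: "Tb 0 c = 0"
  by (simp add: tb_def linext_def)

text \<open>Finite generation of the image of the homology of \<open>V\<close> in that of
  \<open>U\<close>. \<open>F\<close> may consist of arbitrary chains, which makes the notion easy to
  enlarge and to shrink; over a principal ring, \<open>fg_subspace\<close> recovers generating
  cycles.\<close>

definition fg_image :: "nat \<Rightarrow> 'x set \<Rightarrow> 'x set \<Rightarrow> bool" where
  "fg_image q V U \<longleftrightarrow> (\<exists>F. finite F \<and>
     (\<forall>c\<in>cycles q V. \<exists>f\<in>ch.span F. \<exists>b\<in>chains (Suc q) U. c = f + Tb (Suc q) b))"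

text \<open>The twisted homotopy fills every cycle of positive degree, and in degree 0 it reduces
  every cycle to a multiple of the base simplex \<open>s0\<close>.\<close>

lemma fg_image_contractible:
  assumes B: "contractible_space (subtopology X B)"
  shows "fg_image q B B"
proof (cases "\<exists>s0. singular_simplex 0 (subtopology X B) s0")
  case False
  have "c = 0" if "c \<in> cycles q B" for c
  proof (rule ccontr)
    assume "c \<noteq> 0"
    then obtain s where "s \<in> supp c" by (metis all_not_in_conv keys_eq_empty)
    then have "singular_simplex q (subtopology X B) s" using cyclesD(1)[OF that] by (auto simp: chains_def)
    \<comment> \<open>The leading vertex of any simplex is a 0-simplex, so without 0-simplices there
      are no nonzero chains.\<close>
    then have "singular_simplex 0 (subtopology X B) (\<lambda>x\<in>standard_simplex 0. s (vertex 0))"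
      using continuous_map_image_subset_topspace
      by (fastforce simp: singular_simplex_def)
    then show False using False by blast
  qed
  then show ?thesis
    unfolding fg_image_def by (intro exI[of _ "{}"]) (auto simp: ch.subspace_0[OF subspace_chains] intro!: bexI[of _ 0])
next
  case True
  then obtain s0 where s0: "singular_simplex 0 (subtopology X B) s0" ..
  let ?S = "\<lambda>q. singular_simplex_set q (subtopology X B)"
  from contractible_twisted_homotopy[OF B s0] obtain H
    where H0: "(\<forall>q s. singular_simplex q (subtopology X B) s \<longrightarrow> supp (H q s) \<subseteq> ?S (Suc q)) \<and>
     (\<forall>q s. singular_simplex (Suc q) (subtopology X B) s \<longrightarrow> Tb (Suc (Suc q)) (H (Suc q) s) = sgl s 1 - linext cscale (H q) (tb (Suc q) s)) \<and>
     (\<forall>s. singular_simplex 0 (subtopology X B) s \<longrightarrow> (\<exists>r. Tb 1 (H 0 s) = sgl s 1 - sgl s0 r))" ..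
  have HS: "linext cscale (H q) c \<in> chains (Suc q) B" if "c \<in> chains q B" for q c
    unfolding chains_def mem_Collect_eq by (rule keys_linext) (use H0 that in \<open>auto simp: chains_def\<close>)
  show ?thesis
  proof (cases q)
    case (Suc p)
    have "c = 0 + Tb (Suc q) (linext cscale (H q) c)" if c: "c \<in> cycles q B" for c
    proof -
      have "Tb (Suc q) (linext cscale (H q) c) = linext cscale (\<lambda>s. Tb (Suc q) (H q s)) c"
        by (rule ca.linext_linext)
      also have "\<dots> = linext cscale (\<lambda>s. sgl s 1 - linext cscale (H p) (tb q s)) c"
        by (rule linext_cong) (use H0 cyclesD(1)[OF c] Suc in \<open>auto simp: chains_def\<close>)
      also have "\<dots> = c - linext cscale (H p) (Tb q c)"
        by (simp add: ca.linext_fun_diff ca.linext_linext)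
      finally show ?thesis using cyclesD(2)[OF c] by simp
    qed
    then show ?thesis
      unfolding fg_image_def using HS cyclesD(1) ch.span_zero
      by (intro exI[of _ "{}"] conjI ballI finite.emptyI) blast
  next
    case 0
    have "\<exists>f\<in>ch.span {sgl s0 1}. \<exists>b\<in>chains (Suc q) B. c = f + Tb (Suc q) b" if c: "c \<in> cycles q B" for c
    proof -
      have "\<forall>s\<in>supp c. \<exists>r. Tb 1 (H 0 s) = sgl s 1 - sgl s0 r"
        using H0 cyclesD(1)[OF c] 0 by (auto simp: chains_def)
      from bchoice[OF this] obtain r where r: "\<forall>s\<in>supp c. Tb 1 (H 0 s) = sgl s 1 - sgl s0 (r s)" ..
      have "Tb 1 (linext cscale (H 0) c) = linext cscale (\<lambda>s. Tb 1 (H 0 s)) c"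
        by (rule ca.linext_linext)
      also have "\<dots> = linext cscale (\<lambda>s. sgl s 1 - sgl s0 (r s)) c"
        by (rule linext_cong) (use r in blast)
      finally have "c = linext cscale (\<lambda>s. sgl s0 (r s)) c + Tb (Suc q) (linext cscale (H q) c)"
        using 0 by (simp add: ca.linext_fun_diff)
      moreover have "linext cscale (\<lambda>s. sgl s0 (r s)) c \<in> ch.span {sgl s0 1}"
      proof (rule ca.linext_in_subspace[OF ch.subspace_span])
        fix s
        have "cscale (r s) (sgl s0 1) \<in> ch.span {sgl s0 1}" by (intro ch.span_scale ch.span_base) simp
        then show "sgl s0 (r s) \<in> ch.span {sgl s0 1}" by simp
      qed
      ultimately show ?thesis using HS[OF cyclesD(1)[OF c]] by blast
    qed
    then show ?thesis unfolding fg_image_def by (intro exI[of _ "{sgl s0 1}"]) simp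
  qed
qed

end

section \<open>Subdivision of twisted chains\<close>

lemma linext_funpow:
  fixes A :: "'s \<Rightarrow> 's \<Rightarrow>\<^sub>0 'r::comm_ring_1"
  shows "((linext cscale A) ^^ n) c = linext cscale (\<lambda>s. ((linext cscale A) ^^ n) (sgl s 1)) c"
proof (induct n)
  case (Suc n)
  have "linext cscale (\<lambda>s. ((linext cscale A) ^^ Suc n) (sgl s 1)) c
      = linext cscale A (linext cscale (\<lambda>s. ((linext cscale A) ^^ n) (sgl s 1)) c)"
    by (simp add: ca.linext_linext)
  then show ?case by (simp add: Suc[symmetric])
qed simp

lemma chain_split:
  fixes c :: "'s \<Rightarrow>\<^sub>0 'r::comm_ring_1"
  assumes "supp c \<subseteq> A \<union> B"
  obtains a b where "supp a \<subseteq> A" "supp b \<subseteq> B" "c = a + b"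
proof
  show "supp (linext cscale (\<lambda>s. if s \<in> A then sgl s 1 else 0) c) \<subseteq> A"
    by (rule keys_linext) auto
  show "supp (linext cscale (\<lambda>s. if s \<in> A then 0 else sgl s 1) c) \<subseteq> B"
    by (rule keys_linext) (use assms in auto)
  have "linext cscale (\<lambda>s. sgl s 1) c = linext cscale (\<lambda>s. (if s \<in> A then sgl s 1 else 0) + (if s \<in> A then 0 else sgl s 1)) c"
    by (rule linext_cong) auto
  then show "c = linext cscale (\<lambda>s. if s \<in> A then sgl s 1 else 0) c + linext cscale (\<lambda>s. if s \<in> A then 0 else sgl s 1) c"
    unfolding ca.linext_fun_add by simp
qed

context twisted
begin

lemma potential_cong:
  assumes "\<And>y. y \<in> topspace Y \<Longrightarrow> u y = u' y" "potential Y u \<psi>"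
  shows "potential Y u' \<psi>"
  unfolding potential_def
proof (intro allI impI)
  fix g assume g: "pathin Y g"
  have "path_simplex (u \<circ> g) = path_simplex (u' \<circ> g)"
  proof (rule path_simplex_cong)
    fix t :: real assume "0 \<le> t" "t \<le> 1"
    then have "g t \<in> topspace Y" using continuous_map_image_subset_topspace[OF g[unfolded pathin_def]] by auto
    then show "(u \<circ> g) t = (u' \<circ> g) t" by (simp add: assms(1))
  qed
  moreover have "z (path_simplex (u \<circ> g)) = \<psi> (g 0) - \<psi> (g 1)"
    using assms(2) g unfolding potential_def by blast
  ultimately show "z (path_simplex (u' \<circ> g)) = \<psi> (g 0) - \<psi> (g 1)" by (simp only:)
qed

lemma singular_simplex_comp:
  assumes "singular_simplex n Y s" "singular_simplex q (simplex_space n) \<tau>"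
  shows "singular_simplex q Y (simplex_map q s \<tau>)"
  using singular_simplex_simplex_map[OF assms(2)] assms(1) unfolding singular_simplex_def by blast

lemma simplex_image: "singular_simplex p (simplex_space n) \<tau> \<Longrightarrow> x \<in> standard_simplex p \<Longrightarrow> \<tau> x \<in> standard_simplex n"
  unfolding singular_simplex_subtopology by auto

text \<open>As functions of \<open>x\<close>, both potentials belong to the composite simplex, so
  they differ by a constant, which is read off at vertex 0.\<close>

lemma line_potential_comp:
  assumes s: "singular_simplex n X s" and t: "singular_simplex p (simplex_space n) \<tau>" and x: "x \<in> standard_simplex p"
  shows "line_potential s (\<tau> x) = line_potential s (\<tau> (vertex 0)) + line_potential (simplex_map p s \<tau>) x"
proof -
  let ?st = "simplex_map p s \<tau>"
  have st: "singular_simplex p X ?st" by (rule singular_simplex_comp[OF s t])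
  have "continuous_map (simplex_space p) (simplex_space n) \<tau>" using t by (simp add: singular_simplex_def)
  from potential_compose[OF this potential_line[OF s]]
  have "potential (simplex_space p) ?st (line_potential s \<circ> \<tau>)"
    by (rule potential_cong[rotated]) (simp add: simplex_map_def)
  from potential_unique[OF path_connected_contractible[OF contractible_simplex_space] this potential_line[OF st], of x "vertex 0"]
  show ?thesis using x by (simp add: line_potential_vertex[OF st])
qed

text \<open>Passing from \<open>s\<close> to its composite with \<tau> moves the base point of the
  potential from vertex 0 to \<open>\<tau> (vertex 0)\<close>. This costs one unit, the same for all
  simplices of \<open>c\<close>.\<close>

lemma push_comp:
  assumes s: "singular_simplex n X s" and t: "singular_simplex p (simplex_space n) \<tau>"
    and c: "singular_chain q (simplex_space p) c"
  shows "push q s (line_potential s) (chain_map q \<tau> c)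
    = cscale (e (line_potential s (\<tau> (vertex 0)))) (push q (simplex_map p s \<tau>) (line_potential (simplex_map p s \<tau>)) c)"
proof -
  have "push q s (line_potential s) (chain_map q \<tau> c) = linext int_scale (\<lambda>\<rho>. push q s (line_potential s) (frag_of (simplex_map q \<tau> \<rho>))) c"
    by (simp add: chain_map_def push_extend)
  also have "\<dots> = linext int_scale (\<lambda>\<rho>. cscale (e (line_potential s (\<tau> (vertex 0))))
      (push q (simplex_map p s \<tau>) (line_potential (simplex_map p s \<tau>)) (frag_of \<rho>))) c"
  proof (rule linext_cong)
    fix \<rho> assume "\<rho> \<in> supp c"
    then have r: "singular_simplex q (simplex_space p) \<rho>" using c by (auto simp: singular_chain_def)
    have "simplex_map q s (simplex_map q \<tau> \<rho>) = simplex_map q (simplex_map p s \<tau>) \<rho>"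
      using simplex_image[OF r] by (auto simp: simplex_map_def fun_eq_iff)
    then show "push q s (line_potential s) (frag_of (simplex_map q \<tau> \<rho>)) = cscale (e (line_potential s (\<tau> (vertex 0))))
      (push q (simplex_map p s \<tau>) (line_potential (simplex_map p s \<tau>)) (frag_of \<rho>))"
      using line_potential_comp[OF s t simplex_image[OF r, of "vertex 0"]]
      by (simp add: push_of simplex_map_def[of q \<tau>] e_add)
  qed
  also have "\<dots> = cscale (e (line_potential s (\<tau> (vertex 0)))) (push q (simplex_map p s \<tau>) (line_potential (simplex_map p s \<tau>)) c)"
    unfolding push_of unfolding push_def linext_def ch.scale_sum_right int_scale_def
    by (rule sum.cong) (auto simp: mult.left_commute)
  finally show ?thesis .
qed

lemma push_frag_comp:
  assumes s: "singular_simplex n X s" and t: "singular_simplex p (simplex_space n) \<tau>"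
  shows "linext cscale A (push p s (line_potential s) (frag_of \<tau>))
    = cscale (e (line_potential s (\<tau> (vertex 0)))) (A (simplex_map p s \<tau>))"
  by (simp add: push_of)

text \<open>The subdivision operator and its homotopy to the identity are pushed forward from the
  library's operators on affine chains of the standard simplex.\<close>

definition Sd :: "nat \<Rightarrow> ((nat \<Rightarrow> real) \<Rightarrow> 'x) \<Rightarrow> ((nat \<Rightarrow> real) \<Rightarrow> 'x) \<Rightarrow>\<^sub>0 'r" where
  "Sd q s = push q s (line_potential s) (simplicial_subdivision q (frag_of (id_simplex q)))"

definition Th :: "nat \<Rightarrow> ((nat \<Rightarrow> real) \<Rightarrow> 'x) \<Rightarrow> ((nat \<Rightarrow> real) \<Rightarrow> 'x) \<Rightarrow>\<^sub>0 'r" where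
  "Th q s = push (Suc q) s (line_potential s) (subd q (frag_of (id_simplex q)))"

abbreviation SD where "SD q \<equiv> linext cscale (Sd q)"

lemma simplicial_id: "simplicial_chain q (standard_simplex q) (frag_of (id_simplex q))"
  by simp

lemma singular_sd_id: "singular_chain q (simplex_space q) (simplicial_subdivision q (frag_of (id_simplex q)))"
  by (rule simplicial_imp_singular_chain[OF simplicial_chain_simplicial_subdivision[OF simplicial_id]])

lemma singular_subd_id: "singular_chain (Suc q) (simplex_space q) (subd q (frag_of (id_simplex q)))"
  by (rule simplicial_imp_singular_chain[OF chain_homotopic_simplicial_subdivision2[OF simplicial_id]])

lemma supp_push_simplex:
  assumes "singular_simplex n (subtopology X U) s" "singular_chain q (simplex_space n) c"
  shows "push q s \<psi> c \<in> chains q U"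
proof -
  have "simplex_map q s ` supp c \<subseteq> singular_simplex_set q (subtopology X U)"
    using assms(2) singular_simplex_comp[OF assms(1)] by (auto simp: singular_chain_def)
  then show ?thesis unfolding chains_def using supp_push[of q s \<psi> c] by simp
qed

text \<open>Both subdivisions are transported from the identity simplex along \<tau>, and the unit
  from \<open>push_comp\<close> is the same on the two sides.\<close>

lemma push_subdivision:
  assumes s: "singular_simplex n X s" and c: "singular_chain q (simplex_space n) c"
  shows "push q s (line_potential s) (singular_subdivision q c) = SD q (push q s (line_potential s) c)"
proof -
  have "push q s (line_potential s) (singular_subdivision q c) =
      linext int_scale (\<lambda>\<tau>. push q s (line_potential s) (chain_map q \<tau> (simplicial_subdivision q (frag_of (id_simplex q))))) c"
    by (simp add: singular_subdivision_def push_extend)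
  also have "\<dots> = linext int_scale (\<lambda>\<tau>. SD q (push q s (line_potential s) (frag_of \<tau>))) c"
  proof (rule linext_cong)
    fix \<tau> assume "\<tau> \<in> supp c"
    then have t: "singular_simplex q (simplex_space n) \<tau>" using c by (auto simp: singular_chain_def)
    show "push q s (line_potential s) (chain_map q \<tau> (simplicial_subdivision q (frag_of (id_simplex q))))
        = SD q (push q s (line_potential s) (frag_of \<tau>))"
      unfolding push_comp[OF s t singular_sd_id] push_frag_comp[OF s t] Sd_def ..
  qed
  also have "\<dots> = SD q (push q s (line_potential s) c)"
    unfolding push_of by (simp add: push_def linext_cscale_int)
  finally show ?thesis .
qed

text \<open>\<open>subd\<close> commutes with affine simplices \<tau>, so the claim is made for
  affine chains. The boundary of the identity simplex is such a chain, and this is the case that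
  \<open>Tb_Th\<close> uses.\<close>

lemma push_subd:
  assumes s: "singular_simplex n X s" and c: "simplicial_chain q (standard_simplex n) c"
  shows "push (Suc q) s (line_potential s) (subd q c) = linext cscale (Th q) (push q s (line_potential s) c)"
  using c unfolding simplicial_chain_def
proof (induction c rule: frag_induction)
  case (one \<tau>)
  then have st: "simplicial_simplex q (standard_simplex n) \<tau>" by simp
  have t: "singular_simplex q (simplex_space n) \<tau>" by (rule simplicial_imp_singular_simplex[OF st])
  have "subd q (frag_of \<tau>) = subd q (chain_map q \<tau> (frag_of (id_simplex q)))"
    by (simp only: singular_simplex_chain_map_id[OF t])
  also have "\<dots> = chain_map (Suc q) \<tau> (subd q (frag_of (id_simplex q)))"
    by (rule chain_homotopic_simplicial_subdivision1[OF simplicial_id st, symmetric])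
  finally show ?case
    by (simp only: push_comp[OF s t singular_subd_id] push_frag_comp[OF s t] Th_def)
qed (simp_all add: push_diff ca.linext_diff)

lemma Tb_Th:
  assumes s: "singular_simplex q X s"
  shows "Tb (Suc q) (Th q s) = Sd q s - sgl s 1 - linext cscale (Th (q - 1)) (tb q s)"
proof -
  let ?i = "frag_of (id_simplex q)"
  have "Tb (Suc q) (Th q s) = push q s (line_potential s) (chain_boundary (Suc q) (subd q ?i))"
    unfolding Th_def by (rule tb_push[OF singular_subd_id potential_line[OF s]])
  also have "\<dots> = Sd q s - sgl s 1 - push q s (line_potential s) (subd (q - 1) (chain_boundary q ?i))"
    unfolding chain_homotopic_simplicial_subdivision3[OF simplicial_id]
    by (simp only: push_diff Sd_def push_id_simplex[OF s] One_nat_def)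
  also have "push q s (line_potential s) (subd (q - 1) (chain_boundary q ?i)) = linext cscale (Th (q - 1)) (tb q s)"
  proof (cases q)
    case 0
    then show ?thesis by (simp add: tb_def chain_boundary_def)
  next
    case (Suc p)
    have s': "singular_simplex (Suc p) X s" using s Suc by simp
    have "simplicial_chain p (standard_simplex (Suc p)) (chain_boundary (Suc p) (frag_of (id_simplex (Suc p))))"
      using simplicial_chain_boundary[OF simplicial_id, of "Suc p"] by (simp only: diff_Suc_1)
    from push_subd[OF s' this] show ?thesis
      by (simp only: Suc diff_Suc_1 tb_eq_push[OF s'])
  qed
  finally show ?thesis .
qed

lemma Th_chains: "c \<in> chains q U \<Longrightarrow> linext cscale (Th q) c \<in> chains (Suc q) U"
  unfolding Th_def[abs_def]
  by (rule ca.linext_in_subspace[OF subspace_chains], rule supp_push_simplex[OF _ singular_subd_id])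
    (auto simp: chains_def)

lemma Sd_cycle:
  assumes c: "c \<in> cycles q U"
  shows "SD q c = c + Tb (Suc q) (linext cscale (Th q) c)"
proof -
  have "Tb (Suc q) (linext cscale (Th q) c) = linext cscale (\<lambda>s. Tb (Suc q) (Th q s)) c"
    by (rule ca.linext_linext)
  also have "\<dots> = linext cscale (\<lambda>s. Sd q s - sgl s 1 - linext cscale (Th (q - 1)) (tb q s)) c"
  proof (rule linext_cong)
    fix s assume "s \<in> supp c"
    then have "singular_simplex q X s" using cyclesD(1)[OF c] by (simp add: mem_chains)
    then show "Tb (Suc q) (Th q s) = Sd q s - sgl s 1 - linext cscale (Th (q - 1)) (tb q s)" by (rule Tb_Th)
  qed
  also have "\<dots> = SD q c - c - linext cscale (Th (q - 1)) (Tb q c)"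
    by (simp add: ca.linext_fun_diff ca.linext_linext)
  finally show ?thesis using cyclesD(2)[OF c] by simp
qed

lemma iterated_Sd_cycle:
  assumes c: "c \<in> cycles q U"
  shows "\<exists>b\<in>chains (Suc q) U. (SD q ^^ n) c = c + Tb (Suc q) b"
proof (induct n)
  case 0
  show ?case by (rule bexI[of _ 0]) (simp_all add: ch.subspace_0[OF subspace_chains])
next
  case (Suc n)
  then obtain b where b: "b \<in> chains (Suc q) U" "(SD q ^^ n) c = c + Tb (Suc q) b" by blast
  have "Tb (Suc q) b \<in> cycles q U" using Tb_chains[OF b(1)] Tb_Tb[OF b(1)] by (rule cyclesI)
  then have cyc: "(SD q ^^ n) c \<in> cycles q U"
    unfolding b(2) using c by (intro ch.subspace_add[OF subspace_cycles])
  let ?d = "linext cscale (Th q) ((SD q ^^ n) c)"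
  have "(SD q ^^ Suc n) c = (SD q ^^ n) c + Tb (Suc q) ?d"
    by (simp only: funpow.simps o_apply) (rule Sd_cycle[OF cyc])
  also have "\<dots> = c + Tb (Suc q) (b + ?d)"
    by (simp only: b(2) ca.linext_add add.assoc)
  finally have "(SD q ^^ Suc n) c = c + Tb (Suc q) (b + ?d)" .
  moreover have "b + ?d \<in> chains (Suc q) U"
    using b(1) Th_chains[OF cyclesD(1)[OF cyc]] by (rule ch.subspace_add[OF subspace_chains])
  ultimately show ?case by blast
qed

text \<open>Reduces iterated twisted subdivision to ordinary subdivision of the identity simplex, to
  which \<open>sufficient_iterated_singular_subdivision_exists\<close> applies. The second conjunct
  carries the hypothesis of \<open>push_subdivision\<close> through the induction.\<close>

lemma iterated_Sd_simplex:
  assumes s: "singular_simplex q X s"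
  shows "(SD q ^^ n) (sgl s 1) = push q s (line_potential s) ((singular_subdivision q ^^ n) (frag_of (id_simplex q)))
    \<and> singular_chain q (simplex_space q) ((singular_subdivision q ^^ n) (frag_of (id_simplex q)))"
proof (induct n)
  case 0
  show ?case by (simp only: funpow_0 push_id_simplex[OF s] singular_chain_id simp_thms)
next
  case (Suc n)
  show ?case
    by (simp only: funpow.simps o_apply Suc[THEN conjunct1] push_subdivision[OF s Suc[THEN conjunct2]]
      singular_chain_singular_subdivision[OF Suc[THEN conjunct2]] simp_thms)
qed

text \<open>The Lebesgue number argument takes place in the standard simplex, covered by the
  preimages of \<open>U\<close> and \<open>V\<close> under each simplex \<open>s\<close> of the
  chain.\<close>

lemma small_chain:
  assumes U: "openin X U" and V: "openin X V" and c: "c \<in> chains q (U \<union> V)"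
  shows "\<exists>n. supp ((SD q ^^ n) c) \<subseteq> singular_simplex_set q (subtopology X U) \<union> singular_simplex_set q (subtopology X V)"
proof -
  let ?S = "singular_simplex_set q (subtopology X U) \<union> singular_simplex_set q (subtopology X V)"
  have "\<exists>n. \<forall>m\<ge>n. supp ((SD q ^^ m) (sgl s 1)) \<subseteq> ?S" if "s \<in> supp c" for s
  proof -
    have s: "singular_simplex q X s" "s ` standard_simplex q \<subseteq> U \<union> V"
      using c that by (simp_all add: mem_chains)
    have cs: "continuous_map (simplex_space q) X s" using s(1) by (simp add: singular_simplex_def)
    let ?C = "{{x \<in> topspace (simplex_space q). s x \<in> U}, {x \<in> topspace (simplex_space q). s x \<in> V}}"
    have 1: "\<And>W. W \<in> ?C \<Longrightarrow> openin (simplex_space q) W"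
      using openin_continuous_map_preimage[OF cs U] openin_continuous_map_preimage[OF cs V] by fastforce
    have 2: "topspace (simplex_space q) \<subseteq> \<Union>?C" using s(2) by auto
    have "\<exists>n. \<forall>m f. n \<le> m \<longrightarrow> f \<in> supp ((singular_subdivision q ^^ m) (frag_of (id_simplex q)))
        \<longrightarrow> (\<exists>W\<in>?C. f \<in> standard_simplex q \<rightarrow> W)"
    proof (rule sufficient_iterated_singular_subdivision_exists[OF 1 2 singular_chain_id])
      fix n assume "\<And>m f. n \<le> m \<Longrightarrow> f \<in> supp ((singular_subdivision q ^^ m) (frag_of (id_simplex q)))
        \<Longrightarrow> \<exists>W\<in>?C. f \<in> standard_simplex q \<rightarrow> W"
      then show ?thesis by (intro exI[of _ n] allI impI)
    qed
    then obtain n where n: "\<forall>m f. n \<le> m \<longrightarrow> f \<in> supp ((singular_subdivision q ^^ m) (frag_of (id_simplex q)))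
        \<longrightarrow> (\<exists>W\<in>?C. f \<in> standard_simplex q \<rightarrow> W)" by (elim exE)
    have "supp ((SD q ^^ m) (sgl s 1)) \<subseteq> ?S" if m: "n \<le> m" for m
    proof
      fix t assume "t \<in> supp ((SD q ^^ m) (sgl s 1))"
      moreover have "supp ((SD q ^^ m) (sgl s 1)) \<subseteq> simplex_map q s ` supp ((singular_subdivision q ^^ m) (frag_of (id_simplex q)))"
        by (simp only: iterated_Sd_simplex[OF s(1), THEN conjunct1] supp_push)
      ultimately obtain f where f: "f \<in> supp ((singular_subdivision q ^^ m) (frag_of (id_simplex q)))" "t = simplex_map q s f" by blast
      have "f \<in> singular_simplex_set q (simplex_space q)"
        by (rule subsetD[OF iterated_Sd_simplex[OF s(1), THEN conjunct2, unfolded singular_chain_def] f(1)])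
      then have t: "singular_simplex q X t" unfolding f(2) by (intro singular_simplex_comp[OF s(1)]) simp
      from n[rule_format, OF m f(1)] consider "f \<in> standard_simplex q \<rightarrow> {x \<in> topspace (simplex_space q). s x \<in> U}"
        | "f \<in> standard_simplex q \<rightarrow> {x \<in> topspace (simplex_space q). s x \<in> V}" by auto
      then show "t \<in> ?S"
      proof cases
        case 1
        then have "t ` standard_simplex q \<subseteq> U" by (auto simp: f(2) simplex_map_def)
        then show ?thesis using t by (simp add: singular_simplex_subtopology)
      next
        case 2
        then have "t ` standard_simplex q \<subseteq> V" by (auto simp: f(2) simplex_map_def)
        then show ?thesis using t by (simp add: singular_simplex_subtopology)
      qed
    qed
    then show ?thesis by blast
  qed
  then have "\<forall>s\<in>supp c. \<exists>n. \<forall>m\<ge>n. supp ((SD q ^^ m) (sgl s 1)) \<subseteq> ?S" by (rule ballI)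
  from bchoice[OF this] obtain N where N: "\<forall>s\<in>supp c. \<forall>m\<ge>N s. supp ((SD q ^^ m) (sgl s 1)) \<subseteq> ?S" ..
  \<comment> \<open>The sum is a common upper bound of all \<open>N s\<close>, and \<open>N\<close>
    guarantees smallness for every later subdivision as well.\<close>
  have "supp ((SD q ^^ (\<Sum>s\<in>supp c. N s)) c) \<subseteq> ?S"
  proof (subst linext_funpow, rule keys_linext)
    fix s assume s: "s \<in> supp c"
    have "N s \<le> (\<Sum>s\<in>supp c. N s)" by (rule member_le_sum[OF s]) simp_all
    then show "supp ((SD q ^^ (\<Sum>s\<in>supp c. N s)) (sgl s 1)) \<subseteq> ?S" by (rule N[rule_format, OF s])
  qed
  then show ?thesis ..
qed

text \<open>Subdivision moves a cycle only by a boundary. The parts \<open>a\<close> and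
  \<open>b\<close> are chains whose boundaries cancel each other; this is where the intersection
  enters in \<open>fg_image_union\<close>.\<close>

lemma small_cycle:
  assumes U: "openin X U" and V: "openin X V" and c: "c \<in> cycles q (U \<union> V)"
  shows "\<exists>a\<in>chains q U. \<exists>b\<in>chains q V. \<exists>d\<in>chains (Suc q) (U \<union> V). c = a + b + Tb (Suc q) d"
proof -
  from small_chain[OF U V cyclesD(1)[OF c]]
  obtain n where n: "supp ((SD q ^^ n) c) \<subseteq> singular_simplex_set q (subtopology X U) \<union> singular_simplex_set q (subtopology X V)"
    by (elim exE)
  from chain_split[OF n] obtain a b where ab: "a \<in> chains q U" "b \<in> chains q V" "(SD q ^^ n) c = a + b"
    unfolding chains_def by auto
  obtain d where d: "d \<in> chains (Suc q) (U \<union> V)" "(SD q ^^ n) c = c + Tb (Suc q) d"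
    using iterated_Sd_cycle[OF c] by blast
  have "c = a + b + Tb (Suc q) (- d)" using ab(3) d(2) by (simp add: ca.linext_uminus eq_diff_eq)
  moreover have "- d \<in> chains (Suc q) (U \<union> V)" using d(1) by (rule ch.subspace_neg[OF subspace_chains])
  ultimately show ?thesis using ab(1,2) by blast
qed

lemma fg_image_mono:
  assumes "fg_image q V U" "V' \<subseteq> V" "U \<subseteq> U'"
  shows "fg_image q V' U'"
proof -
  from assms(1) obtain F where F: "finite F \<and> (\<forall>c\<in>cycles q V. \<exists>f\<in>ch.span F. \<exists>b\<in>chains (Suc q) U. c = f + Tb (Suc q) b)"
    unfolding fg_image_def ..
  have "cycles q V' \<subseteq> cycles q V" using chains_mono[OF assms(2)] by (auto simp: cycles_def)
  moreover have "chains (Suc q) U \<subseteq> chains (Suc q) U'" by (rule chains_mono[OF assms(3)])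
  ultimately show ?thesis unfolding fg_image_def using F by (intro exI[of _ F]) blast
qed

end

section \<open>Finite generation of the twisted homology\<close>

text \<open>Contractible open sets form a base: \<open>B\<close> is contractible in itself, not
  merely inside \<open>U\<close>.\<close>

definition locally_contractible :: "'x topology \<Rightarrow> bool" where
  "locally_contractible X \<longleftrightarrow> (\<forall>U x. openin X U \<and> x \<in> U \<longrightarrow>
     (\<exists>B. openin X B \<and> x \<in> B \<and> B \<subseteq> U \<and> contractible_space (subtopology X B)))"

context twisted
begin

text \<open>Mayer--Vietoris: a small cycle splits into chains in the two pieces, whose boundaries agree up to
  sign and lie in the intersection.\<close>

lemma fg_image_union:
  assumes P: "principal_ring TYPE('r)" and W: "openin X W1" "openin X W2"
    and WV: "W1 \<subseteq> V1" "W2 \<subseteq> V2" "V1 \<subseteq> U" "V2 \<subseteq> U"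
    and fg: "fg_image q V1 U" "fg_image q V2 U"
    and inter: "\<And>p. q = Suc p \<Longrightarrow> fg_image p (W1 \<inter> W2) (V1 \<inter> V2)"
  shows "fg_image q (W1 \<union> W2) U"
proof -
  from fg(1) obtain F1 where F1: "finite F1 \<and> (\<forall>c\<in>cycles q V1. \<exists>f\<in>ch.span F1. \<exists>b\<in>chains (Suc q) U. c = f + Tb (Suc q) b)"
    unfolding fg_image_def ..
  from fg(2) obtain F2 where F2: "finite F2 \<and> (\<forall>c\<in>cycles q V2. \<exists>f\<in>ch.span F2. \<exists>b\<in>chains (Suc q) U. c = f + Tb (Suc q) b)"
    unfolding fg_image_def ..
  \<comment> \<open>The possible first halves of split cycles. Their boundaries are cycles of
    \<open>W1 \<inter> W2\<close> in the degree below.\<close>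
  define A where "A = {a \<in> chains q W1. \<exists>b\<in>chains q W2. Tb q (a + b) = 0}"
  have sub_A: "ch.subspace A"
  proof (rule ch.subspaceI)
    show "0 \<in> A"
      unfolding A_def using ch.subspace_0[OF subspace_chains] by (auto intro!: bexI[of _ 0])
  next
    fix a a' assume "a \<in> A" "a' \<in> A"
    then obtain b b' where "a \<in> chains q W1" "b \<in> chains q W2" "Tb q (a + b) = 0"
      "a' \<in> chains q W1" "b' \<in> chains q W2" "Tb q (a' + b') = 0" unfolding A_def by blast
    moreover have "Tb q ((a + a') + (b + b')) = Tb q (a + b) + Tb q (a' + b')"
      by (simp add: ca.linext_add algebra_simps)
    ultimately have "a + a' \<in> chains q W1" "b + b' \<in> chains q W2" "Tb q ((a + a') + (b + b')) = 0"
      by (simp_all add: ch.subspace_add[OF subspace_chains])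
    then show "a + a' \<in> A" unfolding A_def by blast
  next
    fix r a assume "a \<in> A"
    then obtain b where "a \<in> chains q W1" "b \<in> chains q W2" "Tb q (a + b) = 0" unfolding A_def by blast
    then have "cscale r a \<in> chains q W1" "cscale r b \<in> chains q W2" "Tb q (cscale r a + cscale r b) = 0"
      by (auto intro: ch.subspace_scale[OF subspace_chains] simp: ca.linext_cscale ch.scale_right_distrib[symmetric])
    then show "cscale r a \<in> A" unfolding A_def by blast
  qed
  \<comment> \<open>The connecting map of Mayer--Vietoris sends \<open>a\<close> to
    \<open>Tb q a\<close>; modulo boundaries from \<open>V1 \<inter> V2\<close> its image is spanned
    by the images of finitely many elements of \<open>A\<close>. In degree 0 it is zero.\<close>
  have "\<exists>G. finite G \<and> G \<subseteq> A \<and> (\<forall>a\<in>A. \<exists>g\<in>ch.span G. \<exists>e\<in>chains q (V1 \<inter> V2). Tb q (a - g) = Tb q e)"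
  proof (cases q)
    case 0
    have "\<forall>a\<in>A. \<exists>g\<in>ch.span {}. \<exists>e\<in>chains q (V1 \<inter> V2). Tb q (a - g) = Tb q e"
      using 0 ch.subspace_0[OF subspace_chains, of 0 "V1 \<inter> V2"] by auto
    then show ?thesis by (intro exI[of _ "{}"]) simp
  next
    case (Suc p)
    from inter[OF Suc] obtain F where F: "finite F \<and> (\<forall>c\<in>cycles p (W1 \<inter> W2). \<exists>f\<in>ch.span F. \<exists>b\<in>chains (Suc p) (V1 \<inter> V2). c = f + Tb (Suc p) b)"
      unfolding fg_image_def ..
    let ?E = "Tb q ` chains q (V1 \<inter> V2)"
    have sub_E: "ch.subspace ?E"
      by (rule Modules.module_hom.subspace_image[OF ca.module_hom_linext subspace_chains])
    \<comment> \<open>The elements of \<open>F\<close> need not represent boundaries of elements of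
      \<open>A\<close>. \<open>M\<close> collects the combinations that do, and
      \<open>fg_subspace\<close> gives it finitely many generators, which can then be lifted to
      \<open>A\<close>.\<close>
    define M where "M = ch.span F \<inter> {m. \<exists>a\<in>A. Tb q a - m \<in> ?E}"
    have memM: "m \<in> M \<longleftrightarrow> m \<in> ch.span F \<and> (\<exists>a\<in>A. Tb q a - m \<in> ?E)" for m by (simp add: M_def)
    have sub_M: "ch.subspace M"
    proof (rule ch.subspaceI)
      show "0 \<in> M" unfolding memM
        using ch.span_zero ch.subspace_0[OF sub_A] ch.subspace_0[OF sub_E] by (auto intro!: bexI[of _ 0])
    next
      fix m m' assume "m \<in> M" "m' \<in> M"
      then have m: "m \<in> ch.span F" "\<exists>a\<in>A. Tb q a - m \<in> ?E" "m' \<in> ch.span F" "\<exists>a\<in>A. Tb q a - m' \<in> ?E"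
        by (simp_all only: memM)
      from m(2) obtain a where a: "a \<in> A" "Tb q a - m \<in> ?E" by (elim bexE)
      from m(4) obtain a' where a': "a' \<in> A" "Tb q a' - m' \<in> ?E" by (elim bexE)
      have "Tb q (a + a') - (m + m') \<in> ?E"
        using ch.subspace_add[OF sub_E a(2) a'(2)] by (simp add: ca.linext_add algebra_simps)
      then show "m + m' \<in> M" unfolding memM
        by (intro conjI ch.span_add[OF m(1,3)] bexI[OF _ ch.subspace_add[OF sub_A a(1) a'(1)]])
    next
      fix r m assume "m \<in> M"
      then have m: "m \<in> ch.span F" "\<exists>a\<in>A. Tb q a - m \<in> ?E" by (simp_all only: memM)
      from m(2) obtain a where a: "a \<in> A" "Tb q a - m \<in> ?E" by (elim bexE)
      have "Tb q (cscale r a) - cscale r m \<in> ?E"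
        using ch.subspace_scale[OF sub_E a(2), of r] by (simp add: ca.linext_cscale ch.scale_right_diff_distrib)
      then show "cscale r m \<in> M" unfolding memM
        by (intro conjI ch.span_scale[OF m(1)] bexI[OF _ ch.subspace_scale[OF sub_A a(1)]])
    qed
    have "M \<subseteq> ch.span F" by (simp add: M_def)
    from ch.fg_subspace[OF P F[THEN conjunct1] sub_M this] obtain G where G: "finite G \<and> M = ch.span G" ..
    have "\<forall>m\<in>G. \<exists>a. a \<in> A \<and> Tb q a - m \<in> ?E"
    proof
      fix m assume "m \<in> G"
      then have "m \<in> M" using G ch.span_base[of m G] by simp
      then have "\<exists>a\<in>A. Tb q a - m \<in> ?E" by (simp only: memM)
      then show "\<exists>a. a \<in> A \<and> Tb q a - m \<in> ?E" by (simp only: Bex_def)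
    qed
    from bchoice[OF this] obtain h where h: "\<forall>m\<in>G. h m \<in> A \<and> Tb q (h m) - m \<in> ?E" ..
    have "\<exists>g\<in>ch.span (h ` G). \<exists>e\<in>chains q (V1 \<inter> V2). Tb q (a - g) = Tb q e" if a: "a \<in> A" for a
    proof -
      obtain b where b: "a \<in> chains q W1" "b \<in> chains q W2" "Tb q (a + b) = 0" using a unfolding A_def by blast
      have "Tb q a = - Tb q b" using b(3) by (simp add: ca.linext_add eq_neg_iff_add_eq_0)
      moreover have "Tb q a \<in> chains p W1" "Tb q b \<in> chains p W2"
        unfolding Suc using b(1,2) Suc by (simp_all add: Tb_chains)
      ultimately have "Tb q a \<in> chains p (W1 \<inter> W2)"
        using ch.subspace_neg[OF subspace_chains] by (intro chains_Int) simp_all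
      moreover have "Tb p (Tb q a) = 0" using Tb_Tb[of a p W1] b(1) Suc by simp
      ultimately have "Tb q a \<in> cycles p (W1 \<inter> W2)" by (rule cyclesI)
      with F obtain m d where m: "m \<in> ch.span F" "d \<in> chains (Suc p) (V1 \<inter> V2)" "Tb q a = m + Tb (Suc p) d" by blast
      have "Tb q a - m \<in> ?E" using m(2,3) Suc by simp
      then have "m \<in> M" unfolding memM by (intro conjI m(1) bexI[OF _ a])
      then have "m \<in> ch.span ((\<lambda>x. x) ` G)" using G by simp
      then obtain c where c: "supp c \<subseteq> G" "m = linext cscale (\<lambda>x. x) c" unfolding ch.span_linext by blast
      let ?g = "linext cscale h c"
      have "?g \<in> ch.span (h ` G)" unfolding ch.span_linext by (intro exI[of _ c] conjI c(1) refl)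
      moreover have "Tb q ?g - m \<in> ?E"
      proof -
        have "Tb q ?g - m = linext cscale (\<lambda>x. Tb q (h x) - x) c"
          unfolding c(2) ca.linext_fun_diff ca.linext_linext ..
        also have "\<dots> \<in> ?E"
          by (rule ca.linext_in_subspace[OF sub_E]) (use h c(1) in blast)
        finally show ?thesis .
      qed
      then have "(Tb q a - m) - (Tb q ?g - m) \<in> ?E" by (rule ch.subspace_diff[OF sub_E \<open>Tb q a - m \<in> ?E\<close>])
      then have "Tb q (a - ?g) \<in> ?E" by (simp add: ca.linext_diff)
      then obtain e where "e \<in> chains q (V1 \<inter> V2)" "Tb q (a - ?g) = Tb q e" by blast
      ultimately show ?thesis by blast
    qed
    moreover have "h ` G \<subseteq> A" using h by blast
    ultimately show ?thesis using G by (intro exI[of _ "h ` G"]) simp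
  qed
  then obtain G where G: "finite G" "G \<subseteq> A"
    "\<forall>a\<in>A. \<exists>g\<in>ch.span G. \<exists>e\<in>chains q (V1 \<inter> V2). Tb q (a - g) = Tb q e" by (elim exE conjE)
  have "\<forall>g\<in>G. \<exists>b. b \<in> chains q W2 \<and> Tb q (g + b) = 0" using G(2) unfolding A_def by blast
  from bchoice[OF this] obtain \<beta> where beta: "\<forall>g\<in>G. \<beta> g \<in> chains q W2 \<and> Tb q (g + \<beta> g) = 0" ..
  let ?F = "F1 \<union> F2 \<union> (\<lambda>g. g + \<beta> g) ` G"
  have "\<exists>f\<in>ch.span ?F. \<exists>b\<in>chains (Suc q) U. c = f + Tb (Suc q) b" if c: "c \<in> cycles q (W1 \<union> W2)" for c
  proof -
    from small_cycle[OF W c] obtain a b d where abd: "a \<in> chains q W1" "b \<in> chains q W2"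
      "d \<in> chains (Suc q) (W1 \<union> W2)" "c = a + b + Tb (Suc q) d" by (elim bexE)
    have "Tb q c = Tb q (a + b) + Tb q (Tb (Suc q) d)" using abd(4) by (simp add: ca.linext_add)
    then have ab: "Tb q (a + b) = 0" using cyclesD(2)[OF c] Tb_Tb[OF abd(3)] by simp
    then have "a \<in> A" unfolding A_def using abd(1,2) by blast
    with G(3) obtain g e where g: "g \<in> ch.span G" "e \<in> chains q (V1 \<inter> V2)" "Tb q (a - g) = Tb q e" by blast
    have "g \<in> ch.span ((\<lambda>x. x) ` G)" using g(1) by simp
    then obtain k where k: "supp k \<subseteq> G" "g = linext cscale (\<lambda>x. x) k" unfolding ch.span_linext by blast
    let ?b = "linext cscale \<beta> k"
    have gW: "g \<in> chains q W1"
      unfolding k(2) by (rule ca.linext_in_subspace[OF subspace_chains]) (use k(1) G(2) in \<open>auto simp: A_def\<close>)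
    have bW: "?b \<in> chains q W2"
      by (rule ca.linext_in_subspace[OF subspace_chains]) (use k(1) beta in blast)
    have gb: "g + ?b = linext cscale (\<lambda>x. x + \<beta> x) k"
      unfolding k(2) ca.linext_fun_add ..
    have "Tb q (g + ?b) = linext cscale (\<lambda>x. Tb q (x + \<beta> x)) k" unfolding gb by (rule ca.linext_linext)
    also have "\<dots> = linext cscale (\<lambda>x. 0) k" by (rule linext_cong) (use k(1) beta in blast)
    finally have gb0: "Tb q (g + ?b) = 0" by simp
    have e1: "e \<in> chains q V1" and e2: "e \<in> chains q V2"
      using g(2) chains_mono[of "V1 \<inter> V2" V1 q] chains_mono[of "V1 \<inter> V2" V2 q] by blast+
    \<comment> \<open>\<open>g\<close> absorbs the connecting class of \<open>c\<close> and
      \<open>e\<close> the rest of the boundary. Up to the boundary of \<open>d\<close>, the cycle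
      \<open>c\<close> becomes a cycle of \<open>V1\<close>, plus a cycle of \<open>V2\<close>, plus
      the combination \<open>g + ?b\<close> of finitely many fixed cycles.\<close>
    have "a - g - e \<in> cycles q V1"
    proof (rule cyclesI)
      show "a - g - e \<in> chains q V1"
        using abd(1) gW e1 chains_mono[OF WV(1)] by (intro ch.subspace_diff[OF subspace_chains]) blast+
      show "Tb q (a - g - e) = 0" using g(3) by (simp add: ca.linext_diff)
    qed
    with F1 obtain f1 d1 where f1: "f1 \<in> ch.span F1" "d1 \<in> chains (Suc q) U" "a - g - e = f1 + Tb (Suc q) d1" by blast
    have "b - ?b + e \<in> cycles q V2"
    proof (rule cyclesI)
      show "b - ?b + e \<in> chains q V2"
        using abd(2) bW e2 chains_mono[OF WV(2)]
        by (intro ch.subspace_diff[OF subspace_chains] ch.subspace_add[OF subspace_chains]) blast+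
      have "Tb q (b - ?b + e) = Tb q (a + b) - Tb q (g + ?b) - (Tb q (a - g) - Tb q e)"
        by (simp add: ca.linext_diff ca.linext_add algebra_simps)
      then show "Tb q (b - ?b + e) = 0" by (simp only: ab gb0 g(3) diff_self diff_0_right)
    qed
    with F2 obtain f2 d2 where f2: "f2 \<in> ch.span F2" "d2 \<in> chains (Suc q) U" "b - ?b + e = f2 + Tb (Suc q) d2" by blast
    have "linext cscale (\<lambda>x. x + \<beta> x) k \<in> ch.span ?F"
    proof (rule ca.linext_in_subspace[OF ch.subspace_span], rule ch.span_base)
      fix x assume "x \<in> supp k"
      then have "x \<in> G" using k(1) by (rule subsetD[rotated])
      then show "x + \<beta> x \<in> ?F" by simp
    qed
    then have s3: "g + ?b \<in> ch.span ?F" by (simp only: gb)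
    have s1: "f1 \<in> ch.span ?F" by (rule subsetD[OF ch.span_mono f1(1)]) auto
    have s2: "f2 \<in> ch.span ?F" by (rule subsetD[OF ch.span_mono f2(1)]) auto
    have "f1 + f2 + (g + ?b) \<in> ch.span ?F" by (rule ch.span_add[OF ch.span_add[OF s1 s2] s3])
    moreover have "d1 + d2 + d \<in> chains (Suc q) U"
    proof (rule ch.subspace_add[OF subspace_chains ch.subspace_add[OF subspace_chains f1(2) f2(2)]])
      have "W1 \<union> W2 \<subseteq> U" using WV by auto
      then show "d \<in> chains (Suc q) U" by (rule subsetD[OF chains_mono abd(3)])
    qed
    moreover have "c = (a - g - e) + (b - ?b + e) + (g + ?b) + Tb (Suc q) d" using abd(4) by simp
    then have "c = f1 + f2 + (g + ?b) + Tb (Suc q) (d1 + d2 + d)"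
      unfolding f1(3) f2(3) by (simp add: ca.linext_add)
    ultimately show ?thesis by (intro bexI[of _ "f1 + f2 + (g + ?b)"] bexI[of _ "d1 + d2 + d"])
  qed
  moreover have "finite ?F" using F1 F2 G(1) by simp
  ultimately show ?thesis unfolding fg_image_def by (intro exI[of _ ?F]) simp
qed

lemma normal_separation:
  assumes "normal_space X" "closedin X S" "closedin X T" "S \<inter> T = {}"
  shows "\<exists>A B. openin X A \<and> openin X B \<and> S \<subseteq> A \<and> T \<subseteq> B \<and> A \<inter> B = {}"
  using assms unfolding normal_space_def disjnt_def by simp

text \<open>Induction over the family with \<open>fg_image_union\<close> as the step. Neighbourhoods
  of two closed sets may meet far away from the intersection of these sets, where the lower degree
  says nothing. A neighbourhood \<open>W\<close> of the intersection is therefore chosen first;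
  normality separates what the closed sets have outside \<open>W\<close>, and the trimmed
  neighbourhoods \<open>?W1\<close> and \<open>?W2\<close> meet only inside
  \<open>W\<close>.\<close>

lemma fg_image_finite_cover:
  assumes P: "principal_ring TYPE('r)" and N: "normal_space X" and U: "openin X U"
    and inter: "\<And>p K V. q = Suc p \<Longrightarrow> closedin X K \<Longrightarrow> openin X V \<Longrightarrow> K \<subseteq> V \<Longrightarrow>
      \<exists>W. openin X W \<and> K \<subseteq> W \<and> W \<subseteq> V \<and> fg_image p W V"
    and KK: "finite KK" "\<forall>K\<in>KK. closedin X K \<and> (\<exists>B. openin X B \<and> K \<subseteq> B \<and> B \<subseteq> U \<and> contractible_space (subtopology X B))"
  shows "\<exists>V. openin X V \<and> \<Union>KK \<subseteq> V \<and> V \<subseteq> U \<and> fg_image q V U"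
  using KK
proof (induction KK)
  case empty
  have "fg_image q {} U" by (rule fg_image_mono[OF fg_image_contractible[of "{}"]]) simp_all
  then show ?case by (intro exI[of _ "{}"]) simp
next
  case (insert K KK)
  have "\<forall>K\<in>KK. closedin X K \<and> (\<exists>B. openin X B \<and> K \<subseteq> B \<and> B \<subseteq> U \<and> contractible_space (subtopology X B))"
    using insert.prems by simp
  from insert.IH[OF this] obtain V2 where V2: "openin X V2" "\<Union>KK \<subseteq> V2" "V2 \<subseteq> U" "fg_image q V2 U"
    by (elim exE conjE)
  from insert.prems obtain V1 where V1: "openin X V1" "K \<subseteq> V1" "V1 \<subseteq> U" "contractible_space (subtopology X V1)" by auto
  have fg1: "fg_image q V1 U" by (rule fg_image_mono[OF fg_image_contractible[OF V1(4)] subset_refl V1(3)])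
  have c1: "closedin X K" using insert.prems by simp
  have c2: "closedin X (\<Union>KK)" by (rule closedin_Union) (use insert.prems insert.hyps(1) in auto)
  show ?case
  proof (cases q)
    case 0
    have "fg_image q (V1 \<union> V2) U"
      by (rule fg_image_union[OF P V1(1) V2(1) subset_refl subset_refl V1(3) V2(3) fg1 V2(4)]) (use 0 in simp)
    then show ?thesis using V1 V2 by (intro exI[of _ "V1 \<union> V2"]) auto
  next
    case (Suc p)
    have "\<exists>W. openin X W \<and> K \<inter> \<Union>KK \<subseteq> W \<and> W \<subseteq> V1 \<inter> V2 \<and> fg_image p W (V1 \<inter> V2)"
      by (rule inter[OF Suc]) (use c1 c2 V1 V2 in auto)
    then obtain W where W: "openin X W" "K \<inter> \<Union>KK \<subseteq> W" "W \<subseteq> V1 \<inter> V2" "fg_image p W (V1 \<inter> V2)" by (elim exE conjE)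
    have "\<exists>A B. openin X A \<and> openin X B \<and> K - W \<subseteq> A \<and> \<Union>KK - W \<subseteq> B \<and> A \<inter> B = {}"
      by (rule normal_separation[OF N]) (use c1 c2 W(1,2) in auto)
    then obtain A B where AB: "openin X A" "openin X B" "K - W \<subseteq> A" "\<Union>KK - W \<subseteq> B" "A \<inter> B = {}" by (elim exE conjE)
    let ?W1 = "V1 \<inter> (A \<union> W)" and ?W2 = "V2 \<inter> (B \<union> W)"
    have "fg_image q (?W1 \<union> ?W2) U"
    proof (rule fg_image_union[OF P _ _ _ _ V1(3) V2(3) fg1 V2(4)])
      show "openin X ?W1" by (rule openin_Int[OF V1(1) openin_Un[OF AB(1) W(1)]])
      show "openin X ?W2" by (rule openin_Int[OF V2(1) openin_Un[OF AB(2) W(1)]])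
      show "?W1 \<subseteq> V1" "?W2 \<subseteq> V2" by auto
      fix p' assume "q = Suc p'"
      then have "p' = p" using Suc by simp
      moreover have "?W1 \<inter> ?W2 \<subseteq> W" using AB(5) by auto
      ultimately show "fg_image p' (?W1 \<inter> ?W2) (V1 \<inter> V2)" using fg_image_mono[OF W(4)] by simp
    qed
    moreover have "openin X (?W1 \<union> ?W2)" using V1(1) V2(1) AB(1,2) W(1) by (intro openin_Int openin_Un)
    moreover have "\<Union>(insert K KK) \<subseteq> ?W1 \<union> ?W2" using V1(2) V2(2) AB(3,4) by auto
    moreover have "?W1 \<union> ?W2 \<subseteq> U" using V1(3) V2(3) by auto
    ultimately show ?thesis by (intro exI[of _ "?W1 \<union> ?W2"] conjI)
  qed
qed

text \<open>Each point gets an open set \<open>fst NC\<close> inside a closed set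
  \<open>snd NC\<close> inside a contractible open subset of \<open>U\<close>. Compactness selects
  finitely many open sets, and the closed ones give the pieces, which must be closed for the
  separation in \<open>fg_image_finite_cover\<close>.\<close>

lemma contractible_closed_cover:
  assumes X: "compact_space X" "Hausdorff_space X" "locally_contractible X"
    and K: "closedin X K" and U: "openin X U" and KU: "K \<subseteq> U"
  shows "\<exists>KK. finite KK \<and> \<Union>KK = K \<and>
    (\<forall>K\<in>KK. closedin X K \<and> (\<exists>B. openin X B \<and> K \<subseteq> B \<and> B \<subseteq> U \<and> contractible_space (subtopology X B)))"
proof -
  have N: "normal_space X" using compact_Hausdorff_or_regular_imp_normal_space[OF X(1)] X(2) by simp
  have "\<forall>x\<in>K. \<exists>NC. openin X (fst NC) \<and> x \<in> fst NC \<and> fst NC \<subseteq> snd NC \<and> closedin X (snd NC) \<and>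
     (\<exists>B. openin X B \<and> snd NC \<subseteq> B \<and> B \<subseteq> U \<and> contractible_space (subtopology X B))"
  proof
    fix x assume x: "x \<in> K"
    then have xU: "x \<in> U" using KU by blast
    have "\<exists>B. openin X B \<and> x \<in> B \<and> B \<subseteq> U \<and> contractible_space (subtopology X B)"
      using X(3) U xU unfolding locally_contractible_def by simp
    then obtain B where B: "openin X B" "x \<in> B" "B \<subseteq> U" "contractible_space (subtopology X B)" by (elim exE conjE)
    have xX: "x \<in> topspace X" using B(1,2) openin_subset by blast
    have "\<exists>A C. openin X A \<and> openin X C \<and> {x} \<subseteq> A \<and> topspace X - B \<subseteq> C \<and> A \<inter> C = {}"
      by (rule normal_separation[OF N]) (use closedin_Hausdorff_singleton[OF X(2) xX] B(1,2) in auto)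
    then obtain A C where AC: "openin X A" "openin X C" "{x} \<subseteq> A" "topspace X - B \<subseteq> C" "A \<inter> C = {}" by (elim exE conjE)
    have "A \<subseteq> topspace X - C" using AC(5) openin_subset[OF AC(1)] by blast
    moreover have "closedin X (topspace X - C)" using AC(2) by (simp add: closedin_diff)
    moreover have "topspace X - C \<subseteq> B" using AC(4) by blast
    ultimately show "\<exists>NC. openin X (fst NC) \<and> x \<in> fst NC \<and> fst NC \<subseteq> snd NC \<and> closedin X (snd NC) \<and>
     (\<exists>B. openin X B \<and> snd NC \<subseteq> B \<and> B \<subseteq> U \<and> contractible_space (subtopology X B))"
      using AC(1,3) B by (intro exI[of _ "(A, topspace X - C)"]) auto
  qed
  from bchoice[OF this] obtain f where f: "\<forall>x\<in>K. openin X (fst (f x)) \<and> x \<in> fst (f x) \<and> fst (f x) \<subseteq> snd (f x) \<and> closedin X (snd (f x)) \<and>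
     (\<exists>B. openin X B \<and> snd (f x) \<subseteq> B \<and> B \<subseteq> U \<and> contractible_space (subtopology X B))" ..
  have "compactin X K" by (rule closedin_compact_space[OF X(1) K])
  moreover have "\<forall>V\<in>(\<lambda>x. fst (f x)) ` K. openin X V" using f by blast
  moreover have "K \<subseteq> \<Union>((\<lambda>x. fst (f x)) ` K)" using f by blast
  ultimately have "\<exists>FF. finite FF \<and> FF \<subseteq> (\<lambda>x. fst (f x)) ` K \<and> K \<subseteq> \<Union>FF"
    unfolding compactin_def by simp
  then obtain FF where FF: "finite FF" "FF \<subseteq> (\<lambda>x. fst (f x)) ` K" "K \<subseteq> \<Union>FF" by (elim exE conjE)
  obtain I where I: "finite I" "I \<subseteq> K" "FF = (\<lambda>x. fst (f x)) ` I"
    using finite_subset_image[OF FF(1,2)] by (elim exE conjE)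
  let ?KK = "(\<lambda>x. K \<inter> snd (f x)) ` I"
  have "K \<subseteq> \<Union>?KK"
  proof
    fix y assume y: "y \<in> K"
    then obtain x where "x \<in> I" "y \<in> fst (f x)" using FF(3) I(3) by blast
    then have "y \<in> snd (f x)" using f I(2) by blast
    then show "y \<in> \<Union>?KK" using y \<open>x \<in> I\<close> by blast
  qed
  then have "\<Union>?KK = K" by blast
  moreover have "closedin X (K \<inter> snd (f x)) \<and> (\<exists>B. openin X B \<and> K \<inter> snd (f x) \<subseteq> B \<and> B \<subseteq> U \<and> contractible_space (subtopology X B))"
    if "x \<in> I" for x
  proof
    have fx: "closedin X (snd (f x))" "\<exists>B. openin X B \<and> snd (f x) \<subseteq> B \<and> B \<subseteq> U \<and> contractible_space (subtopology X B)"
      using f that I(2) by blast+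
    show "closedin X (K \<inter> snd (f x))" using K fx(1) by (rule closedin_Int)
    show "\<exists>B. openin X B \<and> K \<inter> snd (f x) \<subseteq> B \<and> B \<subseteq> U \<and> contractible_space (subtopology X B)" using fx(2) by blast
  qed
  ultimately show ?thesis using I(1) by (intro exI[of _ ?KK]) simp
qed

text \<open>The outer of two inductions, on the degree; the inner one, on the number of closed
  pieces, is \<open>fg_image_finite_cover\<close>. The claim is made for all pairs
  \<open>K \<subseteq> U\<close> because the lower degree is applied to intersections of
  pieces.\<close>

lemma fg_image_neighbourhood:
  assumes P: "principal_ring TYPE('r)" and X: "compact_space X" "Hausdorff_space X" "locally_contractible X"
  shows "\<forall>K U. closedin X K \<longrightarrow> openin X U \<longrightarrow> K \<subseteq> U \<longrightarrow> (\<exists>V. openin X V \<and> K \<subseteq> V \<and> V \<subseteq> U \<and> fg_image q V U)"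
proof (induction q)
  case 0
  show ?case
  proof (intro allI impI)
    fix K U assume KU: "closedin X K" "openin X U" "K \<subseteq> U"
    from contractible_closed_cover[OF X KU] obtain KK where KK: "finite KK" "\<Union>KK = K"
      "\<forall>K\<in>KK. closedin X K \<and> (\<exists>B. openin X B \<and> K \<subseteq> B \<and> B \<subseteq> U \<and> contractible_space (subtopology X B))" by (elim exE conjE)
    have N: "normal_space X" using compact_Hausdorff_or_regular_imp_normal_space[OF X(1)] X(2) by simp
    have "\<exists>V. openin X V \<and> \<Union>KK \<subseteq> V \<and> V \<subseteq> U \<and> fg_image 0 V U"
      by (rule fg_image_finite_cover[OF P N KU(2) _ KK(1,3)]) simp
    from this[unfolded KK(2)] show "\<exists>V. openin X V \<and> K \<subseteq> V \<and> V \<subseteq> U \<and> fg_image 0 V U" .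
  qed
next
  case (Suc q)
  show ?case
  proof (intro allI impI)
    fix K U assume KU: "closedin X K" "openin X U" "K \<subseteq> U"
    from contractible_closed_cover[OF X KU] obtain KK where KK: "finite KK" "\<Union>KK = K"
      "\<forall>K\<in>KK. closedin X K \<and> (\<exists>B. openin X B \<and> K \<subseteq> B \<and> B \<subseteq> U \<and> contractible_space (subtopology X B))" by (elim exE conjE)
    have N: "normal_space X" using compact_Hausdorff_or_regular_imp_normal_space[OF X(1)] X(2) by simp
    have "\<exists>V. openin X V \<and> \<Union>KK \<subseteq> V \<and> V \<subseteq> U \<and> fg_image (Suc q) V U"
    proof (rule fg_image_finite_cover[OF P N KU(2) _ KK(1,3)])
      fix p K' V assume "Suc q = Suc p" and *: "closedin X K'" "openin X V" "K' \<subseteq> V"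
      then have "p = q" by simp
      then show "\<exists>W. openin X W \<and> K' \<subseteq> W \<and> W \<subseteq> V \<and> fg_image p W V" using Suc * by simp
    qed
    from this[unfolded KK(2)] show "\<exists>V. openin X V \<and> K \<subseteq> V \<and> V \<subseteq> U \<and> fg_image (Suc q) V U" .
  qed
qed

text \<open>\<open>fg_image_neighbourhood\<close> with all of \<open>X\<close> for both
  \<open>K\<close> and \<open>U\<close>. The chains in \<open>F\<close> need not be cycles, but the
  cycles in their span form a submodule \<open>M\<close>, finitely generated by
  \<open>fg_subspace\<close>.\<close>

theorem fg_homology:
  assumes P: "principal_ring TYPE('r)" and X: "compact_space X" "Hausdorff_space X" "locally_contractible X"
  shows "fg_complex (\<lambda>q. singular_simplex_set q X) tb"
proof -
  have B: "based_complex (\<lambda>q. singular_simplex_set q X) tb"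
    using based_complex_twisted[of "topspace X"] by simp
  have chX: "chains q (topspace X) = chains_on (singular_simplex_set q X)" for q by (simp add: chains_def)
  have "\<exists>F. finite F \<and> (\<forall>f\<in>F. supp f \<subseteq> singular_simplex_set q X \<and> Tb q f = 0) \<and>
       (\<forall>c. supp c \<subseteq> singular_simplex_set q X \<and> Tb q c = 0 \<longrightarrow>
         (\<exists>f\<in>ch.span F. \<exists>b. supp b \<subseteq> singular_simplex_set (Suc q) X \<and> c = f + Tb (Suc q) b))" for q
  proof -
    let ?Z = "cycles q (topspace X)" and ?B = "Tb (Suc q) ` chains (Suc q) (topspace X)"
    have "\<exists>V. openin X V \<and> topspace X \<subseteq> V \<and> V \<subseteq> topspace X \<and> fg_image q V (topspace X)"
      using fg_image_neighbourhood[OF P X, of q] by simp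
    then obtain V where "topspace X \<subseteq> V" "V \<subseteq> topspace X" "fg_image q V (topspace X)" by (elim exE conjE)
    then have "fg_image q (topspace X) (topspace X)" by (simp add: subset_antisym)
    then obtain F where F: "finite F \<and> (\<forall>c\<in>?Z. \<exists>f\<in>ch.span F. \<exists>b\<in>chains (Suc q) (topspace X). c = f + Tb (Suc q) b)"
      unfolding fg_image_def ..
    have BZ: "?B \<subseteq> ?Z" using Tb_chains Tb_Tb by (auto intro!: cyclesI)
    define M where "M = ch.span F \<inter> ?Z"
    have sM: "ch.subspace M" unfolding M_def by (rule ch.subspace_inter[OF ch.subspace_span subspace_cycles])
    have "M \<subseteq> ch.span F" by (simp add: M_def)
    from ch.fg_subspace[OF P F[THEN conjunct1] sM this] obtain G where G: "finite G \<and> M = ch.span G" ..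
    have "G \<subseteq> M" using G ch.span_superset[of G] by simp
    then have "G \<subseteq> ?Z" by (simp add: M_def)
    then have G1: "\<forall>f\<in>G. supp f \<subseteq> singular_simplex_set q X \<and> Tb q f = 0"
      by (auto simp: cycles_def chX)
    have "\<exists>f\<in>ch.span G. \<exists>b. supp b \<subseteq> singular_simplex_set (Suc q) X \<and> c = f + Tb (Suc q) b"
      if c: "supp c \<subseteq> singular_simplex_set q X" "Tb q c = 0" for c
    proof -
      have cZ: "c \<in> ?Z" using c by (intro cyclesI) (simp_all add: chX)
      with F obtain f b where fb: "f \<in> ch.span F" "b \<in> chains (Suc q) (topspace X)" "c = f + Tb (Suc q) b" by blast
      have "Tb (Suc q) b \<in> ?Z" using BZ fb(2) by blast
      then have "c - Tb (Suc q) b \<in> ?Z" by (rule ch.subspace_diff[OF subspace_cycles cZ])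
      then have "f \<in> M" using fb(1,3) by (simp add: M_def)
      then have "f \<in> ch.span G" using G by simp
      moreover have "supp b \<subseteq> singular_simplex_set (Suc q) X" using fb(2) by (simp add: chX)
      ultimately show ?thesis using fb(3) by blast
    qed
    then show ?thesis using G G1 by (intro exI[of _ G]) simp
  qed
  then show ?thesis
    using B P by (intro fg_complex.intro fg_complex_axioms.intro)
qed

end

section \<open>Local contractibility of manifolds\<close>

lemma box_neighbourhood:
  assumes "openin (powertop_real UNIV) W" "x \<in> W"
  shows "\<exists>C. openin (powertop_real UNIV) C \<and> x \<in> C \<and> C \<subseteq> W \<and>
    (\<forall>a b t. a \<in> C \<longrightarrow> b \<in> C \<longrightarrow> 0 \<le> t \<longrightarrow> t \<le> 1 \<longrightarrow> (\<lambda>i. (1 - t) * a i + t * b i) \<in> C)"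
proof -
  from assms obtain V where V: "finite {i. V i \<noteq> (UNIV :: real set)}" "\<forall>i. open (V i)" "\<forall>i. x i \<in> V i" "Pi\<^sub>E UNIV V \<subseteq> W"
    unfolding openin_product_topology_alt by (auto simp: PiE_iff)
  have "\<forall>i. \<exists>e>0. ball (x i) e \<subseteq> V i" using V(2,3) open_contains_ball by blast
  from choice[OF this] obtain e where e: "\<forall>i. e i > 0 \<and> ball (x i) (e i) \<subseteq> V i" ..
  \<comment> \<open>Only finitely many factors are shrunk to intervals; the others stay the whole
    line, as openness in the product topology demands.\<close>
  define D where "D i = (if V i = UNIV then UNIV else ball (x i) (e i))" for i
  have "{i. D i \<noteq> UNIV} \<subseteq> {i. V i \<noteq> UNIV}" by (auto simp: D_def)
  then have "finite {i. D i \<noteq> UNIV}" using V(1) by (rule finite_subset)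
  moreover have oD: "open (D i)" for i by (simp add: D_def)
  ultimately have 1: "openin (powertop_real UNIV) (Pi\<^sub>E UNIV D)"
    by (simp add: openin_PiE_gen)
  have 2: "x \<in> Pi\<^sub>E UNIV D"
  proof -
    have "x i \<in> D i" for i using e by (cases "V i = UNIV") (simp_all add: D_def)
    then show ?thesis by (simp add: PiE_iff)
  qed
  have e1: "e i > 0" and e2: "ball (x i) (e i) \<subseteq> V i" for i using e by blast+
  have DVi: "D i \<subseteq> V i" for i
  proof (cases "V i = UNIV")
    case False
    then have "D i = ball (x i) (e i)" by (simp only: D_def if_False)
    then show ?thesis using e2[of i] by (simp only:)
  qed simp
  have 3: "Pi\<^sub>E UNIV D \<subseteq> W" by (rule order.trans[OF PiE_mono V(4)]) (rule DVi)
  have cD: "convex (D i)" for i by (simp add: D_def)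
  have "(\<lambda>i. (1 - t) * a i + t * b i) \<in> Pi\<^sub>E UNIV D" if "a \<in> Pi\<^sub>E UNIV D" "b \<in> Pi\<^sub>E UNIV D" "0 \<le> t" "t \<le> 1" for a b t
  proof -
    have "(1 - t) * a i + t * b i \<in> D i" for i
      using convexD[OF cD[of i], of "a i" "b i" "1 - t" t] that by (simp add: PiE_iff)
    then show ?thesis by (simp add: PiE_iff)
  qed
  then show ?thesis using 1 2 3 by (intro exI[of _ "Pi\<^sub>E UNIV D"]) simp
qed

text \<open>A chart moves the problem to \<open>Euclidean_space n\<close>, the sequences that vanish
  from index \<open>n\<close> on. A convex box of the product space meets this linear subspace in a
  convex, hence contractible, set, whose image under the inverse chart \<open>g\<close> is the
  neighbourhood.\<close>

lemma manifold_locally_contractible: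
  assumes "topological_manifold n X"
  shows "locally_contractible X"
  unfolding locally_contractible_def
proof (intro allI impI, elim conjE)
  fix U x assume U: "openin X U" "x \<in> U"
  then have xX: "x \<in> topspace X" using openin_subset by blast
  have "\<exists>U V. openin X U \<and> x \<in> U \<and> openin (Euclidean_space n) V \<and>
        subtopology X U homeomorphic_space subtopology (Euclidean_space n) V"
    using assms xX unfolding topological_manifold_def by simp
  then obtain O' V where OV: "openin X O'" "x \<in> O'" "openin (Euclidean_space n) V"
    "subtopology X O' homeomorphic_space subtopology (Euclidean_space n) V" by (elim exE conjE)
  then obtain f g where fg: "homeomorphic_maps (subtopology X O') (subtopology (Euclidean_space n) V) f g"
    unfolding homeomorphic_space_def by (elim exE)
  have cf: "continuous_map (subtopology X O') (subtopology (Euclidean_space n) V) f"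
    and cg: "continuous_map (subtopology (Euclidean_space n) V) (subtopology X O') g"
    and gf: "\<And>x. x \<in> topspace (subtopology X O') \<Longrightarrow> g (f x) = x"
    and fg': "\<And>y. y \<in> topspace (subtopology (Euclidean_space n) V) \<Longrightarrow> f (g y) = y"
    using fg by (simp_all add: homeomorphic_maps_def)
  have O'X: "O' \<subseteq> topspace X" and VE: "V \<subseteq> topspace (Euclidean_space n)"
    using OV(1,3) openin_subset by blast+
  let ?L = "{x :: nat \<Rightarrow> real. \<forall>i\<ge>n. x i = 0}"
  have tV: "topspace (subtopology (Euclidean_space n) V) = V" using VE by auto
  have "openin (subtopology (Euclidean_space n) V) {y \<in> topspace (subtopology (Euclidean_space n) V). g y \<in> O' \<inter> U}"
    by (rule openin_continuous_map_preimage[OF cg]) (use U OV(1) in \<open>simp add: openin_subtopology_Int2\<close>)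
  then have "openin (Euclidean_space n) {y \<in> V. g y \<in> O' \<inter> U}"
    unfolding tV using openin_open_subtopology[OF OV(3)] by blast
  then obtain W where W: "openin (powertop_real UNIV) W" "{y \<in> V. g y \<in> O' \<inter> U} = W \<inter> ?L"
    unfolding Euclidean_space_def openin_subtopology by blast
  have xO: "x \<in> topspace (subtopology X O')" using xX OV(2) by simp
  have fx: "f x \<in> V" using subsetD[OF continuous_map_image_subset_topspace[OF cf] imageI[OF xO]] by (simp only: tV)
  have "g (f x) = x" using xO by (rule gf)
  then have "f x \<in> {y \<in> V. g y \<in> O' \<inter> U}" using fx OV(2) U(2) by simp
  then have "f x \<in> W \<inter> ?L" by (simp only: W(2))
  note fxW = IntD1[OF this] and fxL = IntD2[OF this]
  from box_neighbourhood[OF W(1) fxW] obtain C where C: "openin (powertop_real UNIV) C" "f x \<in> C" "C \<subseteq> W"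
    "\<forall>a b t. a \<in> C \<longrightarrow> b \<in> C \<longrightarrow> 0 \<le> t \<longrightarrow> t \<le> 1 \<longrightarrow> (\<lambda>i. (1 - t) * a i + t * b i) \<in> C" by (elim exE conjE)
  let ?D = "C \<inter> ?L"
  have "?D \<subseteq> W \<inter> ?L" using C(3) by (rule Int_mono) (rule order.refl)
  then have DW: "?D \<subseteq> {y \<in> V. g y \<in> O' \<inter> U}" by (simp only: W(2))
  have DV: "?D \<subseteq> V" by (rule order.trans[OF DW]) (rule Collect_restrict)
  have DU: "g y \<in> O' \<inter> U" if "y \<in> ?D" for y using subsetD[OF DW that] by (simp only: mem_Collect_eq)
  have cD: "contractible_space (subtopology (powertop_real UNIV) ?D)"
    by (rule contractible_convex) (use C(4) in simp)
  have oD: "openin (subtopology (Euclidean_space n) V) ?D"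
  proof -
    have "openin (Euclidean_space n) ?D" unfolding Euclidean_space_def using C(1) by (auto simp: openin_subtopology)
    then show ?thesis using DV by (simp only: openin_open_subtopology[OF OV(3)] simp_thms)
  qed
  let ?B = "g ` ?D"
  have hm: "homeomorphic_map (subtopology (Euclidean_space n) V) (subtopology X O') g"
    using fg unfolding homeomorphic_maps_map by (elim conjE)
  have "openin (subtopology X O') ?B"
    by (rule mp[OF spec[OF homeomorphic_imp_open_map[OF hm, unfolded open_map_def]] oD])
  then have oB: "openin X ?B" by (simp only: openin_open_subtopology[OF OV(1)])
  have "homeomorphic_map (subtopology (subtopology (Euclidean_space n) V) ?D) (subtopology (subtopology X O') ?B) g"
  proof (rule homeomorphic_map_subtopologies_alt[OF hm])
    fix y assume y: "y \<in> topspace (subtopology (Euclidean_space n) V)" "g y \<in> topspace (subtopology X O')"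
    show "g y \<in> ?B \<longleftrightarrow> y \<in> ?D"
    proof
      assume "g y \<in> ?B"
      then obtain y' where y': "g y = g y'" "y' \<in> ?D" by (rule imageE)
      have "y' \<in> topspace (subtopology (Euclidean_space n) V)" unfolding tV by (rule subsetD[OF DV y'(2)])
      then have "f (g y') = y'" by (rule fg')
      with arg_cong[OF y'(1), of f] fg'[OF y(1)] have "y = y'" by (rule box_equals)
      show "y \<in> ?D" unfolding \<open>y = y'\<close> by (rule y'(2))
    qed (rule imageI)
  qed
  then have "homeomorphic_map (subtopology (powertop_real UNIV) ?D) (subtopology X ?B) g"
  proof -
    have "V \<inter> ?D = ?D" by (rule Int_absorb1[OF DV])
    moreover have "?L \<inter> V \<inter> ?D = ?D" by (rule Int_absorb1[OF Int_greatest[OF Int_lower2 DV]])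
    moreover have "?B \<subseteq> O'" by (rule image_subsetI) (rule IntD1[OF DU])
    then have "O' \<inter> ?B = ?B" by (rule Int_absorb1)
    ultimately show ?thesis
      using \<open>homeomorphic_map (subtopology (subtopology (Euclidean_space n) V) ?D) (subtopology (subtopology X O') ?B) g\<close>
      by (simp add: subtopology_subtopology Euclidean_space_def)
  qed
  then have "subtopology (powertop_real UNIV) ?D homeomorphic_space subtopology X ?B"
    by (rule homeomorphic_map_imp_homeomorphic_space)
  from iffD1[OF homeomorphic_space_contractibility[OF this] cD]
  have "contractible_space (subtopology X ?B)" .
  moreover have "x \<in> ?B" using \<open>g (f x) = x\<close> C(2) fxL by (intro image_eqI[of _ _ "f x"]) auto
  moreover have "?B \<subseteq> U" by (rule image_subsetI) (rule IntD2[OF DU])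
  ultimately show "\<exists>B. openin X B \<and> x \<in> B \<and> B \<subseteq> U \<and> contractible_space (subtopology X B)"
    using oB by (intro exI[of _ ?B] conjI)
qed

section \<open>Laurent polynomials\<close>

lemma coef_sgl_mult: 
  fixes x :: "int \<Rightarrow>\<^sub>0 'r::comm_ring_1"
  shows "coef (sgl k c * x) m = c * coef x (m - k)"
proof -
  have "sgl k c * x = sgl k c * (\<Sum>b\<in>supp x. sgl b (coef x b))"
    using linext_id[of x] by (simp add: linext_def)
  also have "\<dots> = (\<Sum>b\<in>supp x. sgl (k + b) (c * coef x b))"
    by (simp add: sum_distrib_left mult_single)
  finally have "coef (sgl k c * x) m = (\<Sum>b\<in>supp x. c * coef x b when k + b = m)"
    by (simp add: lookup_sum lookup_single)
  also have "\<dots> = (\<Sum>b\<in>supp x. if b = m - k then c * coef x b else 0)"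
    by (rule sum.cong) (auto simp: when_def)
  also have "\<dots> = c * coef x (m - k)" by (auto simp: in_keys_iff)
  finally show ?thesis .
qed

lemma laurent_induct [case_names zero single add]:
  fixes x :: "int \<Rightarrow>\<^sub>0 'r::comm_ring_1"
  assumes "P 0" "\<And>k c. P (sgl k c)" "\<And>x y. P x \<Longrightarrow> P y \<Longrightarrow> P (x + y)"
  shows "P x"
proof -
  have "P (\<Sum>b\<in>I. sgl b (coef x b))" if "finite I" for I
    using that by (induct I) (auto intro: assms)
  from this[OF finite_keys[of x]] show ?thesis using linext_id[of x] by (simp add: linext_def)
qed

text \<open>The substitution of \<open>a\<close> for t with coefficients mapped by
  \<open>\<iota>\<close>. It is used with \<open>of_rat\<close> and a nonzero complex number, and
  with \<open>const_fract\<close> and \<open>ratfun_var\<close>.\<close>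

locale laurent_eval = ring_map \<iota> for \<iota> :: "'r::comm_ring_1 \<Rightarrow> 'f::field" +
  fixes a :: 'f
  assumes a0: "a \<noteq> 0"
begin

definition eval :: "(int \<Rightarrow>\<^sub>0 'r) \<Rightarrow> 'f" where
  "eval = linext (\<lambda>r y. \<iota> r * y) (\<lambda>k. a powi k)"

lemma eval_single: "eval (sgl k c) = \<iota> c * a powi k"
  unfolding eval_def by (rule ring_action.linext_single[OF ring_action_ev])

lemma eval_plus: "eval (x + y) = eval x + eval y"
  unfolding eval_def by (rule ring_action.linext_add[OF ring_action_ev])

lemma eval_zero: "eval 0 = 0"
  unfolding eval_def by (rule ring_action.linext_0[OF ring_action_ev])

lemma eval_times: "eval (x * y) = eval x * eval y"
proof (induct x rule: laurent_induct)
  case zero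
  show ?case by (simp add: eval_zero)
next
  case (single k c)
  show ?case
  proof (induct y rule: laurent_induct)
    case zero
    show ?case by (simp add: eval_zero)
  next
    case (single l d)
    show ?case by (simp add: mult_single eval_single ev_mult power_int_add[OF disjI1[OF a0]])
  next
    case (add x y)
    then show ?case by (simp add: distrib_left eval_plus)
  qed
next
  case (add x y')
  then show ?case by (simp add: distrib_right eval_plus)
qed

lemma ring_map_eval: "ring_map eval"
proof
  show "eval 1 = 1" using eval_single[of 0 1] by simp
qed (simp_all add: eval_plus eval_times)

end

definition laurent_poly :: "'r::comm_ring_1 poly \<Rightarrow> int \<Rightarrow>\<^sub>0 'r" where
  "laurent_poly p = (\<Sum>i\<le>degree p. sgl (int i) (Polynomial.coeff p i))"

lemma coef_laurent_poly: "coef (laurent_poly p) k = (if k \<ge> 0 then Polynomial.coeff p (nat k) else 0)"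
proof -
  have "coef (laurent_poly p) k = (\<Sum>i\<le>degree p. if i = nat k \<and> k \<ge> 0 then Polynomial.coeff p i else 0)"
    unfolding laurent_poly_def lookup_sum by (rule sum.cong) (auto simp: lookup_single when_def)
  also have "\<dots> = (if k \<ge> 0 then Polynomial.coeff p (nat k) else 0)"
    by (cases "k \<ge> 0") (auto simp: coeff_eq_0)
  finally show ?thesis .
qed

lemma laurent_poly_0 [simp]: "laurent_poly 0 = 0"
  by (rule poly_mapping_eqI) (simp add: coef_laurent_poly)

lemma laurent_poly_add: "laurent_poly (p + q) = laurent_poly p + laurent_poly q"
  by (rule poly_mapping_eqI) (simp add: coef_laurent_poly lookup_add)

lemma laurent_poly_smult: "laurent_poly (Polynomial.smult c p) = sgl 0 c * laurent_poly p"
  by (rule poly_mapping_eqI) (simp add: coef_laurent_poly coef_sgl_mult)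

lemma laurent_poly_pCons0: "laurent_poly (pCons 0 p) = sgl 1 1 * laurent_poly p"
proof (rule poly_mapping_eqI)
  fix k :: int
  show "coef (laurent_poly (pCons 0 p)) k = coef (sgl 1 1 * laurent_poly p) k"
  proof (cases "k \<ge> 1")
    case True
    define m where "m = nat (k - 1)"
    have m: "nat k = Suc m" "k - 1 = int m" using True by (simp_all add: m_def)
    have "coef (laurent_poly (pCons 0 p)) k = Polynomial.coeff p m" using True m(1) by (simp add: coef_laurent_poly)
    moreover have "coef (sgl 1 1 * laurent_poly p) k = Polynomial.coeff p m"
      unfolding coef_sgl_mult m(2) coef_laurent_poly by simp
    ultimately show ?thesis by simp
  next
    case False
    then have "coef (sgl 1 1 * laurent_poly p) k = 0" by (simp add: coef_laurent_poly coef_sgl_mult)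
    moreover have "coef (laurent_poly (pCons 0 p)) k = 0" using False by (simp add: coef_laurent_poly)
    ultimately show ?thesis by simp
  qed
qed

lemma laurent_poly_const: "laurent_poly [:c:] = sgl 0 c"
  by (simp add: laurent_poly_def)

lemma laurent_poly_pCons: "laurent_poly (pCons c p) = sgl 0 c + sgl 1 1 * laurent_poly p"
proof -
  have "pCons c p = [:c:] + pCons 0 p" by simp
  then show ?thesis by (simp only: laurent_poly_add laurent_poly_const laurent_poly_pCons0)
qed

lemma laurent_poly_mult: "laurent_poly (p * q) = laurent_poly p * laurent_poly q"
proof (induct p)
  case (pCons c p)
  then show ?case
    by (simp add: laurent_poly_add laurent_poly_smult laurent_poly_pCons0 laurent_poly_pCons distrib_right mult.assoc)
qed simp

text \<open>Powers of t are units, so questions about a Laurent polynomial reduce to a polynomial.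
  The shift \<open>n\<close> is a crude bound for the exponents: the sum of their absolute
  values.\<close>

lemma laurent_cases:
  fixes x :: "int \<Rightarrow>\<^sub>0 'r::comm_ring_1"
  shows "\<exists>n p. x = sgl (- int n) 1 * laurent_poly p \<and> laurent_poly p = sgl (int n) 1 * x"
proof -
  define n where "n = nat (\<Sum>k\<in>supp x. \<bar>k\<bar>)"
  have n: "\<bar>k\<bar> \<le> int n" if "k \<in> supp x" for k
  proof -
    have "\<bar>k\<bar> \<le> (\<Sum>k\<in>supp x. \<bar>k\<bar>)" by (rule member_le_sum[OF that]) simp_all
    then show ?thesis by (simp add: n_def)
  qed
  define p where "p = (\<Sum>i\<le>2 * n. Polynomial.monom (coef x (int i - int n)) i)"
  have cp: "Polynomial.coeff p i = (if i \<le> 2 * n then coef x (int i - int n) else 0)" for i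
    by (simp add: p_def coeff_sum if_distrib cong: if_cong)
  have 1: "laurent_poly p = sgl (int n) 1 * x"
  proof (rule poly_mapping_eqI)
    fix k
    have "coef x (k - int n) = 0" if "k < 0 \<or> k > 2 * int n"
    proof (rule ccontr)
      assume "coef x (k - int n) \<noteq> 0"
      then have "\<bar>k - int n\<bar> \<le> int n" by (intro n) (simp add: in_keys_iff)
      then show False using that by linarith
    qed
    then show "coef (laurent_poly p) k = coef (sgl (int n) 1 * x) k"
      by (auto simp: coef_laurent_poly coef_sgl_mult cp)
  qed
  have "x = sgl (- int n) 1 * laurent_poly p"
    unfolding 1 by (simp add: mult.assoc[symmetric] mult_single)
  then show ?thesis using 1 by blast
qed

text \<open>By \<open>laurent_cases\<close> an ideal is generated by the polynomials in it, and
  Euclidean division shows that a nonzero one of least degree divides all of them.\<close>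

lemma principal_laurent: "principal_ring TYPE(int \<Rightarrow>\<^sub>0 'k::field)"
  unfolding principal_ring_def
proof (intro allI impI)
  fix I :: "(int \<Rightarrow>\<^sub>0 'k) set" assume I: "Modules.module.subspace (*) I"
  note I' = I[unfolded Modules.module.subspace_def[OF module_times]]
  have I0: "0 \<in> I" and Iadd: "\<And>x y. x \<in> I \<Longrightarrow> y \<in> I \<Longrightarrow> x + y \<in> I" and Imult: "\<And>c x. x \<in> I \<Longrightarrow> c * x \<in> I"
    using I' by simp_all
  show "\<exists>g. I = range (\<lambda>r. r * g)"
  proof (cases "\<exists>p. p \<noteq> 0 \<and> laurent_poly p \<in> I")
    case False
    have "x = 0" if x: "x \<in> I" for x
    proof -
      from laurent_cases[of x] obtain n where "\<exists>p. x = sgl (- int n) 1 * laurent_poly p \<and> laurent_poly p = sgl (int n) 1 * x" ..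
      then obtain p where np: "x = sgl (- int n) 1 * laurent_poly p \<and> laurent_poly p = sgl (int n) 1 * x" ..
      have "laurent_poly p \<in> I" unfolding conjunct2[OF np] by (rule Imult[OF x])
      then have "p = 0" using False by blast
      then show ?thesis using conjunct1[OF np] by simp
    qed
    then have "I = {0}" using I0 by blast
    then show ?thesis by (intro exI[of _ 0]) simp
  next
    case True
    define p where "p = arg_min degree (\<lambda>p. p \<noteq> 0 \<and> laurent_poly p \<in> I)"
    from True obtain p0 where p0: "p0 \<noteq> 0 \<and> laurent_poly p0 \<in> I" ..
    have p: "p \<noteq> 0 \<and> laurent_poly p \<in> I"
      unfolding p_def by (rule arg_min_natI[where P = "\<lambda>p. p \<noteq> 0 \<and> laurent_poly p \<in> I"]) (rule p0)
    have pmin: "degree p \<le> degree q" if "q \<noteq> 0 \<and> laurent_poly q \<in> I" for q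
      unfolding p_def by (rule arg_min_nat_le) (rule that)
    have "x \<in> range (\<lambda>r. r * laurent_poly p)" if x: "x \<in> I" for x
    proof -
      from laurent_cases[of x] obtain n where "\<exists>q. x = sgl (- int n) 1 * laurent_poly q \<and> laurent_poly q = sgl (int n) 1 * x" ..
      then obtain q where q: "x = sgl (- int n) 1 * laurent_poly q \<and> laurent_poly q = sgl (int n) 1 * x" ..
      have "laurent_poly q \<in> I" unfolding conjunct2[OF q] by (rule Imult[OF x])
      moreover have "laurent_poly (q mod p) = laurent_poly q + laurent_poly (- (q div p)) * laurent_poly p"
      proof -
        have "q mod p = q + (- (q div p)) * p" using div_mult_mod_eq[of q p] by (simp add: algebra_simps)
        then show ?thesis by (simp only: laurent_poly_add laurent_poly_mult)
      qed
      ultimately have r: "laurent_poly (q mod p) \<in> I" using Iadd Imult p by simp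
      have "q mod p = 0"
      proof (rule ccontr)
        assume nz: "q mod p \<noteq> 0"
        then have "degree p \<le> degree (q mod p)" using pmin r by simp
        moreover have "degree (q mod p) < degree p" using degree_mod_less[of p q] p nz by simp
        ultimately show False by simp
      qed
      then have "q = (q div p) * p" using div_mult_mod_eq[of q p] by simp
      then have "laurent_poly q = laurent_poly (q div p) * laurent_poly p" by (metis laurent_poly_mult)
      then have "x = (sgl (- int n) 1 * laurent_poly (q div p)) * laurent_poly p" using conjunct1[OF q] by (simp add: mult.assoc)
      then show ?thesis by (rule range_eqI)
    qed
    moreover have "range (\<lambda>r. r * laurent_poly p) \<subseteq> I" using Imult p by auto
    ultimately show ?thesis by (intro exI[of _ "laurent_poly p"]) auto
  qed
qed

context laurent_eval
begin

lemma eval_shift: "eval (sgl k 1 * x) = a powi k * eval x"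
  by (simp add: eval_times eval_single)

lemma eval_laurent_poly: "eval (laurent_poly p) = poly (map_poly \<iota> p) a"
proof (induct p)
  case (pCons c p)
  then show ?case
    by (simp add: laurent_poly_pCons eval_plus eval_times eval_single map_poly_pCons)
qed (simp add: eval_zero)

end

section \<open>Evaluation at complex numbers and at the indeterminate\<close>

lemma ring_map_of_rat: "ring_map (of_rat :: rat \<Rightarrow> complex)"
  by unfold_locales (simp_all add: of_rat_add of_rat_mult)

text \<open>Up to a power of t, \<open>d\<close> is a nonzero polynomial \<open>p\<close> with
  rational coefficients, and the nonzero zeros of \<open>d\<close> are among its roots.\<close>

lemma algebraic_eval_zeros:
  fixes d :: "int \<Rightarrow>\<^sub>0 rat"
  assumes "d \<noteq> 0"
  shows "finite {a::complex. a \<noteq> 0 \<and> laurent_eval.eval of_rat a d = 0}"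
    "\<And>a::complex. a \<noteq> 0 \<Longrightarrow> laurent_eval.eval of_rat a d = 0 \<Longrightarrow> algebraic a"
proof -
  from laurent_cases[of d] obtain n where "\<exists>p. d = sgl (- int n) 1 * laurent_poly p \<and> laurent_poly p = sgl (int n) 1 * d" ..
  then obtain p where d: "d = sgl (- int n) 1 * laurent_poly p \<and> laurent_poly p = sgl (int n) 1 * d" ..
  let ?p = "map_poly of_rat p :: complex poly"
  have p: "p \<noteq> 0"
  proof
    assume "p = 0"
    then have "d = 0" using conjunct1[OF d] by simp
    then show False using assms by simp
  qed
  then have p0: "?p \<noteq> 0" by (simp add: map_poly_eq_0_iff)
  have root: "poly ?p a = 0" if a: "a \<noteq> 0" "laurent_eval.eval of_rat a d = 0" for a :: complex
  proof -
    interpret laurent_eval "of_rat :: rat \<Rightarrow> complex" a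
      by (intro laurent_eval.intro ring_map_of_rat laurent_eval_axioms.intro a(1))
    have "eval (laurent_poly p) = 0" using a(2) by (simp add: conjunct2[OF d] eval_shift)
    then show ?thesis by (simp add: eval_laurent_poly)
  qed
  have "finite {a. poly ?p a = 0}" using p0 by (rule poly_roots_finite)
  then show "finite {a::complex. a \<noteq> 0 \<and> laurent_eval.eval of_rat a d = 0}"
    by (rule finite_subset[rotated]) (use root in blast)
  show "algebraic a" if "a \<noteq> 0" "laurent_eval.eval of_rat a d = 0" for a :: complex
    unfolding algebraic_altdef
    by (intro exI[of _ ?p] conjI allI p0 root[OF that]) (simp add: coeff_map_poly)
qed

definition const_fract :: "rat \<Rightarrow> rat poly fract" where
  "const_fract r = Fract [:r:] 1"

lemma ring_map_const_fract: "ring_map const_fract"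
  by unfold_locales (simp_all add: const_fract_def One_fract_def one_pCons mult.commute)

lemma ratfun_var_nonzero: "ratfun_var \<noteq> 0"
  by (simp add: ratfun_var_def Zero_fract_def eq_fract)

lemma laurent_eval_ratfun: "laurent_eval const_fract ratfun_var"
  by (intro laurent_eval.intro ring_map_const_fract laurent_eval_axioms.intro ratfun_var_nonzero)

interpretation rf: laurent_eval const_fract ratfun_var
  by (rule laurent_eval_ratfun)

lemma eval_ratfun_poly: "rf.eval (laurent_poly p) = Fract p 1"
proof (induct p)
  case 0
  show ?case by (simp add: rf.eval_zero Zero_fract_def)
next
  case (pCons c p)
  have "Fract (pCons c p) 1 = Fract [:c:] 1 + Fract [:0, 1:] 1 * Fract p 1"
    by simp
  then show ?case
    using pCons(2) by (simp add: laurent_poly_pCons rf.eval_plus rf.eval_times rf.eval_single const_fract_def[symmetric] ratfun_var_def[symmetric] rf.ev_1)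
qed

text \<open>The indeterminate is transcendental: a Laurent polynomial vanishing there becomes, after
  multiplication by a power of t, a polynomial that is 0 in its fraction field.\<close>

lemma inj_eval_ratfun: "inj rf.eval"
proof -
  have *: "x = 0" if x: "rf.eval x = 0" for x
  proof -
    from laurent_cases[of x] obtain n where "\<exists>p. x = sgl (- int n) 1 * laurent_poly p \<and> laurent_poly p = sgl (int n) 1 * x" ..
    then obtain p where d: "x = sgl (- int n) 1 * laurent_poly p \<and> laurent_poly p = sgl (int n) 1 * x" ..
    have "rf.eval (laurent_poly p) = 0" using x by (simp add: conjunct2[OF d] rf.eval_shift)
    then have "p = 0" by (simp add: eval_ratfun_poly Zero_fract_def eq_fract)
    then show ?thesis using conjunct1[OF d] by simp
  qed
  show ?thesis
  proof (rule injI)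
    fix x y assume "rf.eval x = rf.eval y"
    moreover have "rf.eval x = rf.eval (x - y) + rf.eval y" using rf.eval_plus[of "x - y" y] by simp
    ultimately have "x - y = 0" by (intro *) simp
    then show "x = y" by simp
  qed
qed

lemma ratfun_fraction: "\<exists>r s. rf.eval s \<noteq> 0 \<and> x * rf.eval s = rf.eval r"
proof (cases x rule: Fract_cases)
  case (Fract p q)
  then show ?thesis
    by (intro exI[of _ "laurent_poly p"] exI[of _ "laurent_poly q"])
      (simp add: eval_ratfun_poly Zero_fract_def eq_fract)
qed

section \<open>Dimensions of quotient modules\<close>

context
  fixes M :: "('k::comm_ring_1, 'v) module"
  assumes M: "module class_ring M"
begin

interpretation M: module class_ring M by (rule M)

lemma module_smult_closed: "x \<in> carrier M \<Longrightarrow> c \<odot>\<^bsub>M\<^esub> x \<in> carrier M"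
  by (rule M.smult_closed) simp_all

lemma module_smult_assoc: "x \<in> carrier M \<Longrightarrow> (c * d) \<odot>\<^bsub>M\<^esub> x = c \<odot>\<^bsub>M\<^esub> (d \<odot>\<^bsub>M\<^esub> x)"
  using M.smult_assoc1[of c d x] by simp

lemma module_smult_add: "x \<in> carrier M \<Longrightarrow> (c + d) \<odot>\<^bsub>M\<^esub> x = c \<odot>\<^bsub>M\<^esub> x \<oplus>\<^bsub>M\<^esub> d \<odot>\<^bsub>M\<^esub> x"
  using M.smult_l_distr[of c d x] by simp

lemma module_smult_one: "x \<in> carrier M \<Longrightarrow> 1 \<odot>\<^bsub>M\<^esub> x = x"
  using M.smult_one[of x] by simp

lemma module_smult_zero: "x \<in> carrier M \<Longrightarrow> 0 \<odot>\<^bsub>M\<^esub> x = \<zero>\<^bsub>M\<^esub>"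
  using M.smult_l_null[of x] by simp

lemma module_finsum_smult:
  assumes "x \<in> carrier M" "finite I"
  shows "(\<Oplus>\<^bsub>M\<^esub>i\<in>I. c i \<odot>\<^bsub>M\<^esub> x) = (\<Sum>i\<in>I. c i) \<odot>\<^bsub>M\<^esub> x"
  using assms(2)
proof (induct I)
  case empty
  show ?case using assms(1) by (simp add: module_smult_zero)
next
  case (insert i I)
  then show ?case
    by (subst M.M.finsum_insert) (auto simp: assms(1) module_smult_closed module_smult_add)
qed

end

text \<open>\<open>W\<close> is an index set rather than a set of vectors. That \<open>u\<close> is
  injective on it follows from \<open>li\<close>: two indices with the same vector would admit the
  relation with coefficients 1 and - 1.\<close>

lemma vs_dim_eqI:
  fixes V :: "('k::field, 'v) module"
  assumes V: "module class_ring V" and W: "finite W" and u: "\<And>w. w \<in> W \<Longrightarrow> u w \<in> carrier V"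
    and sp: "\<And>y. y \<in> carrier V \<Longrightarrow> \<exists>c. y = (\<Oplus>\<^bsub>V\<^esub>w\<in>W. c w \<odot>\<^bsub>V\<^esub> u w)"
    and li: "\<And>c w. (\<Oplus>\<^bsub>V\<^esub>w\<in>W. c w \<odot>\<^bsub>V\<^esub> u w) = \<zero>\<^bsub>V\<^esub> \<Longrightarrow> w \<in> W \<Longrightarrow> c w = 0"
  shows "vs_dim V = enat (card W)"
proof -
  interpret vectorspace class_ring V
    using V class_field by (simp add: vectorspace_def)
  have sc: "c \<odot>\<^bsub>V\<^esub> u w \<in> carrier V" if "w \<in> W" for c w using u[OF that] by (rule module_smult_closed[OF V])
  have inj: "inj_on u W"
  proof (rule inj_onI, rule ccontr)
    fix w w' assume w: "w \<in> W" "w' \<in> W" "u w = u w'" "w \<noteq> w'"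
    let ?c = "\<lambda>v. if v = w then 1 else if v = w' then - 1 else (0::'k)"
    have fin: "finite (W - {w, w'})" using W by simp
    have "W = insert w (insert w' (W - {w, w'}))" using w by blast
    then have "(\<Oplus>\<^bsub>V\<^esub>v\<in>W. ?c v \<odot>\<^bsub>V\<^esub> u v) = (\<Oplus>\<^bsub>V\<^esub>v\<in>insert w (insert w' (W - {w, w'})). ?c v \<odot>\<^bsub>V\<^esub> u v)" by simp
    also have "\<dots> = ?c w \<odot>\<^bsub>V\<^esub> u w \<oplus>\<^bsub>V\<^esub> (?c w' \<odot>\<^bsub>V\<^esub> u w' \<oplus>\<^bsub>V\<^esub> (\<Oplus>\<^bsub>V\<^esub>v\<in>W - {w, w'}. ?c v \<odot>\<^bsub>V\<^esub> u v))"
      using w fin by (subst M.finsum_insert, simp_all add: sc Pi_iff)+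
    also have "(\<Oplus>\<^bsub>V\<^esub>v\<in>W - {w, w'}. ?c v \<odot>\<^bsub>V\<^esub> u v) = (\<Oplus>\<^bsub>V\<^esub>v\<in>W - {w, w'}. \<zero>\<^bsub>V\<^esub>)"
      by (rule M.finsum_cong') (auto simp: u module_smult_zero[OF V])
    also have "\<dots> = \<zero>\<^bsub>V\<^esub>" by (rule M.finsum_zero)
    also have "?c w \<odot>\<^bsub>V\<^esub> u w \<oplus>\<^bsub>V\<^esub> (?c w' \<odot>\<^bsub>V\<^esub> u w' \<oplus>\<^bsub>V\<^esub> \<zero>\<^bsub>V\<^esub>) = \<zero>\<^bsub>V\<^esub>"
    proof -
      have "?c w = 1" "?c w' = - 1" using w(4) by simp_all
      moreover have "(1::'k) \<odot>\<^bsub>V\<^esub> u w' \<oplus>\<^bsub>V\<^esub> (- 1) \<odot>\<^bsub>V\<^esub> u w' = \<zero>\<^bsub>V\<^esub>"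
        by (simp only: module_smult_add[OF V u[OF w(2)], symmetric] right_minus module_smult_zero[OF V u[OF w(2)]])
      ultimately show ?thesis by (simp only: w(3) M.r_zero[OF sc[OF w(2)]])
    qed
    finally have "?c w = 0" using w(1) by (rule li)
    then show False by simp
  qed
  let ?B = "u ` W"
  have Bc: "?B \<subseteq> carrier V" using u by auto
  have lc: "lincomb c ?B = (\<Oplus>\<^bsub>V\<^esub>w\<in>W. c (u w) \<odot>\<^bsub>V\<^esub> u w)" for c
    unfolding lincomb_def by (rule M.finsum_reindex[OF _ inj]) (use sc in auto)
  have "y \<in> span ?B" if "y \<in> carrier V" for y
  proof -
    from sp[OF that] obtain c where c: "y = (\<Oplus>\<^bsub>V\<^esub>w\<in>W. c w \<odot>\<^bsub>V\<^esub> u w)" ..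
    have "y = lincomb (\<lambda>b. c (inv_into W u b)) ?B"
      unfolding lc c by (rule M.finsum_cong') (use inj sc in auto)
    then show ?thesis unfolding span_def using W by (intro CollectI exI conjI) auto
  qed
  then have g: "gen_set ?B" using span_is_subset2[OF Bc] by blast
  have "\<not> lin_dep ?B"
  proof
    assume "lin_dep ?B"
    then obtain A c b where A: "finite A" "A \<subseteq> ?B" "lincomb c A = \<zero>\<^bsub>V\<^esub>" "b \<in> A" "c b \<noteq> 0"
      unfolding lin_dep_def by auto
    let ?c = "\<lambda>b. if b \<in> A then c b else 0"
    have "lincomb c A = lincomb ?c ?B"
      unfolding lincomb_def
    proof (rule M.add.finprod_mono_neutral_cong_left)
      show "finite ?B" "A \<subseteq> ?B" using W A(2) by simp_all
      show "?c b \<odot>\<^bsub>V\<^esub> b = \<zero>\<^bsub>V\<^esub>" if "b \<in> ?B - A" for b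
        using that subsetD[OF Bc, of b] by (simp add: module_smult_zero[OF V])
      show "c b \<odot>\<^bsub>V\<^esub> b = ?c b \<odot>\<^bsub>V\<^esub> b" if "b \<in> A" for b using that by simp
      show "(\<lambda>b. ?c b \<odot>\<^bsub>V\<^esub> b) \<in> ?B \<rightarrow> carrier V"
        by (rule funcsetI) (rule module_smult_closed[OF V subsetD[OF Bc]])
    qed
    from this[symmetric] A(3) have "lincomb ?c ?B = \<zero>\<^bsub>V\<^esub>" by (rule trans)
    with lc[symmetric] have "(\<Oplus>\<^bsub>V\<^esub>w\<in>W. ?c (u w) \<odot>\<^bsub>V\<^esub> u w) = \<zero>\<^bsub>V\<^esub>" by (rule trans)
    moreover from A(2,4) obtain w where w: "b = u w" "w \<in> W" by blast
    ultimately have "?c (u w) = 0" by (intro li[of "\<lambda>w. ?c (u w)"])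
    then show False using A(4,5) w by simp
  qed
  then have "basis ?B" using g Bc by (simp add: basis_def)
  then have "dim = card W" using dim_basis[of ?B] W card_image[OF inj] by simp
  moreover have "fin_dim" unfolding fin_dim_def using g Bc W by (intro exI[of _ ?B]) simp
  ultimately show ?thesis by (simp add: vs_dim_def)
qed

text \<open>The module laws are inherited from scalar functions through a surjection \<Phi> that
  respects the operations, so they need not be checked on cosets.\<close>

lemma module_of_functions:
  fixes V :: "('k::field, 'm) module" and \<Phi> :: "('s \<Rightarrow> 'k) \<Rightarrow> 'm"
  assumes Z: "(\<lambda>s. 0) \<in> Z" "\<And>f g. f \<in> Z \<Longrightarrow> g \<in> Z \<Longrightarrow> (\<lambda>s. f s + g s) \<in> Z" "\<And>c f. f \<in> Z \<Longrightarrow> (\<lambda>s. c * f s) \<in> Z"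
    and V: "carrier V = \<Phi> ` Z" "zero V = \<Phi> (\<lambda>s. 0)"
      "\<And>f g. f \<in> Z \<Longrightarrow> g \<in> Z \<Longrightarrow> \<Phi> f \<oplus>\<^bsub>V\<^esub> \<Phi> g = \<Phi> (\<lambda>s. f s + g s)"
      "\<And>c f. f \<in> Z \<Longrightarrow> c \<odot>\<^bsub>V\<^esub> \<Phi> f = \<Phi> (\<lambda>s. c * f s)"
  shows "module class_ring V"
    and "finite W \<Longrightarrow> (\<And>w. w \<in> W \<Longrightarrow> F w \<in> Z) \<Longrightarrow> (\<Oplus>\<^bsub>V\<^esub>w\<in>W. c w \<odot>\<^bsub>V\<^esub> \<Phi> (F w)) = \<Phi> (\<lambda>s. \<Sum>w\<in>W. c w * F w s)"
proof -
  show m: "module class_ring V"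
  proof (rule moduleI)
    show "cring (class_ring :: 'k ring)" by (rule class_cring.is_cring)
    show "abelian_group V"
    proof (rule abelian_groupI)
      fix x assume "x \<in> carrier V"
      then obtain f where f: "x = \<Phi> f" "f \<in> Z" unfolding V(1) by (rule imageE)
      have m: "(\<lambda>s. - 1 * f s) \<in> Z" by (rule Z(3)[OF f(2)])
      have "\<Phi> (\<lambda>s. - 1 * f s) \<oplus>\<^bsub>V\<^esub> x = \<zero>\<^bsub>V\<^esub>" unfolding f(1) V(3)[OF m f(2)] V(2) by simp
      moreover have "\<Phi> (\<lambda>s. - 1 * f s) \<in> carrier V" unfolding V(1) using m by (rule imageI)
      ultimately show "\<exists>y\<in>carrier V. y \<oplus>\<^bsub>V\<^esub> x = \<zero>\<^bsub>V\<^esub>" ..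
    qed (auto simp: V Z algebra_simps)
  qed (auto simp: V Z algebra_simps)
  assume "finite W" "\<And>w. w \<in> W \<Longrightarrow> F w \<in> Z"
  then have "(\<Oplus>\<^bsub>V\<^esub>w\<in>W. c w \<odot>\<^bsub>V\<^esub> \<Phi> (F w)) = \<Phi> (\<lambda>s. \<Sum>w\<in>W. c w * F w s) \<and> (\<lambda>s. \<Sum>w\<in>W. c w * F w s) \<in> Z"
  proof (induct W)
    case empty
    interpret module class_ring V by (rule m)
    show ?case by (simp add: V Z)
  next
    case (insert w W)
    interpret module class_ring V by (rule m)
    have c: "c w \<odot>\<^bsub>V\<^esub> \<Phi> (F w) \<in> carrier V" if "w \<in> insert w W" "F w \<in> Z" for w
      using that(2) by (simp add: V Z)
    have "(\<Oplus>\<^bsub>V\<^esub>w\<in>insert w W. c w \<odot>\<^bsub>V\<^esub> \<Phi> (F w)) = c w \<odot>\<^bsub>V\<^esub> \<Phi> (F w) \<oplus>\<^bsub>V\<^esub> (\<Oplus>\<^bsub>V\<^esub>w\<in>W. c w \<odot>\<^bsub>V\<^esub> \<Phi> (F w))"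
      by (rule M.finsum_insert) (use insert c in auto)
    then show ?case using insert by (simp add: V Z)
  qed
  then show "(\<Oplus>\<^bsub>V\<^esub>w\<in>W. c w \<odot>\<^bsub>V\<^esub> \<Phi> (F w)) = \<Phi> (\<lambda>s. \<Sum>w\<in>W. c w * F w s)" ..
qed

text \<open>\<open>\<theta>\<close> parametrises \<open>M\<close> by functions and identifies those
  that agree on the relevant simplices. Hence \<open>inj\<close> places the difference of two
  functions with equal image in \<open>B\<close> instead of demanding their equality.\<close>

lemma vs_dim_quotient_module:
  fixes M :: "('k::field, 'm) module" and \<theta> :: "('s \<Rightarrow> 'k) \<Rightarrow> 'm"
  assumes Z: "(\<lambda>s. 0) \<in> Z" "\<And>f g. f \<in> Z \<Longrightarrow> g \<in> Z \<Longrightarrow> (\<lambda>s. f s + g s) \<in> Z" "\<And>c f. f \<in> Z \<Longrightarrow> (\<lambda>s. c * f s) \<in> Z"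
    and B: "(\<lambda>s. 0) \<in> B" "\<And>f g. f \<in> B \<Longrightarrow> g \<in> B \<Longrightarrow> (\<lambda>s. f s + g s) \<in> B" "\<And>c f. f \<in> B \<Longrightarrow> (\<lambda>s. c * f s) \<in> B"
    and M: "carrier M = \<theta> ` Z" "N = \<theta> ` B"
      "\<And>f g. \<theta> f \<oplus>\<^bsub>M\<^esub> \<theta> g = \<theta> (\<lambda>s. f s + g s)" "\<And>c f. c \<odot>\<^bsub>M\<^esub> \<theta> f = \<theta> (\<lambda>s. c * f s)"
    and inj: "\<And>f g. \<theta> f = \<theta> g \<Longrightarrow> (\<lambda>s. f s - g s) \<in> B"
    and W: "finite W" "\<And>w. w \<in> W \<Longrightarrow> F w \<in> Z"
      "\<And>f. f \<in> Z \<Longrightarrow> \<exists>c. (\<lambda>s. f s - (\<Sum>w\<in>W. c w * F w s)) \<in> B"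
      "\<And>c. (\<lambda>s. \<Sum>w\<in>W. c w * F w s) \<in> B \<Longrightarrow> \<forall>w\<in>W. c w = 0"
  shows "vs_dim (quotient_module M N) = enat (card W)"
proof -
  \<comment> \<open>The coset of \<open>\<theta> f\<close>, written through functions;
    \<open>coset\<close> proves the agreement.\<close>
  define \<Phi> where "\<Phi> f = \<theta> ` {g. (\<lambda>s. g s - f s) \<in> B}" for f
  let ?V = "quotient_module M N"
  have Bd: "(\<lambda>s. f s - g s) \<in> B" if "f \<in> B" "g \<in> B" for f g
    using B(2)[OF that(1) B(3)[OF that(2), of "- 1"]] by simp
  have coset: "N +>\<^bsub>M\<^esub> \<theta> f = \<Phi> f" for f
  proof -
    have "N +>\<^bsub>M\<^esub> \<theta> f = (\<lambda>h. \<theta> (\<lambda>s. h s + f s)) ` B"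
      by (auto simp: a_r_coset_def r_coset_def M)
    also have "\<dots> = \<Phi> f"
      unfolding \<Phi>_def
    proof (intro equalityI subsetI)
      fix y assume "y \<in> \<theta> ` {g. (\<lambda>s. g s - f s) \<in> B}"
      then obtain g where g: "y = \<theta> g" "g \<in> {g. (\<lambda>s. g s - f s) \<in> B}" by (rule imageE)
      show "y \<in> (\<lambda>h. \<theta> (\<lambda>s. h s + f s)) ` B"
        by (rule image_eqI[of _ _ "\<lambda>s. g s - f s"]) (use g in simp_all)
    next
      fix y assume "y \<in> (\<lambda>h. \<theta> (\<lambda>s. h s + f s)) ` B"
      then obtain h where h: "y = \<theta> (\<lambda>s. h s + f s)" "h \<in> B" by (rule imageE)
      show "y \<in> \<theta> ` {g. (\<lambda>s. g s - f s) \<in> B}"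
        unfolding h(1) by (rule imageI) (use h(2) in simp)
    qed
    finally show ?thesis .
  qed
  have \<Phi>_cong: "\<Phi> f = \<Phi> g" if d: "(\<lambda>s. f s - g s) \<in> B" for f g
  proof -
    have "(\<lambda>s. h s - f s) \<in> B \<longleftrightarrow> (\<lambda>s. h s - g s) \<in> B" for h
      using B(2)[OF _ d, of "\<lambda>s. h s - f s"] Bd[OF _ d, of "\<lambda>s. h s - g s"] by auto
    then show ?thesis by (simp add: \<Phi>_def)
  qed
  have \<Phi>_0: "f \<in> B" if "\<Phi> f = \<Phi> (\<lambda>s. 0)" for f
  proof -
    have "\<theta> f \<in> \<Phi> f" unfolding \<Phi>_def by (rule imageI) (simp add: B)
    then have "\<theta> f \<in> \<theta> ` {g. (\<lambda>s. g s - 0) \<in> B}" unfolding that unfolding \<Phi>_def .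
    then obtain g where g: "\<theta> f = \<theta> g" "g \<in> B" by auto
    from B(2)[OF inj[OF g(1)] g(2)] show ?thesis by simp
  qed
  have N0: "N = \<Phi> (\<lambda>s. 0)" by (simp add: \<Phi>_def M)
  have V1: "carrier ?V = \<Phi> ` Z"
    by (auto simp: quotient_module_def A_RCOSETS_def' M(1) coset)
  have V3: "\<Phi> f \<oplus>\<^bsub>?V\<^esub> \<Phi> g = \<Phi> (\<lambda>s. f s + g s)" for f g
  proof -
    have "\<Phi> f \<oplus>\<^bsub>?V\<^esub> \<Phi> g = {\<theta> (\<lambda>s. h s + k s) | h k. (\<lambda>s. h s - f s) \<in> B \<and> (\<lambda>s. k s - g s) \<in> B}"
      by (auto simp: quotient_module_def set_add_def set_mult_def \<Phi>_def M(3))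
    also have "\<dots> = \<Phi> (\<lambda>s. f s + g s)"
    proof (intro equalityI subsetI)
      fix y assume "y \<in> {\<theta> (\<lambda>s. h s + k s) | h k. (\<lambda>s. h s - f s) \<in> B \<and> (\<lambda>s. k s - g s) \<in> B}"
      then obtain h k where hk: "y = \<theta> (\<lambda>s. h s + k s)" "(\<lambda>s. h s - f s) \<in> B" "(\<lambda>s. k s - g s) \<in> B" by (elim CollectE exE conjE)
      show "y \<in> \<Phi> (\<lambda>s. f s + g s)"
        unfolding \<Phi>_def hk(1) by (rule imageI) (use B(2)[OF hk(2,3)] in \<open>simp add: algebra_simps\<close>)
    next
      fix y assume "y \<in> \<Phi> (\<lambda>s. f s + g s)"
      then obtain h where h: "y = \<theta> h" "h \<in> {h. (\<lambda>s. h s - (f s + g s)) \<in> B}" unfolding \<Phi>_def by (rule imageE)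
      show "y \<in> {\<theta> (\<lambda>s. h s + k s) | h k. (\<lambda>s. h s - f s) \<in> B \<and> (\<lambda>s. k s - g s) \<in> B}"
        by (intro CollectI exI[of _ f] exI[of _ "\<lambda>s. h s - f s"]) (use h B(1) in \<open>simp add: algebra_simps\<close>)
    qed
    finally show ?thesis .
  qed
  have V4: "c \<odot>\<^bsub>?V\<^esub> \<Phi> f = \<Phi> (\<lambda>s. c * f s)" for c f
  proof -
    have "c \<odot>\<^bsub>?V\<^esub> \<Phi> f = (\<Union>a\<in>\<Phi> f. N +>\<^bsub>M\<^esub> (c \<odot>\<^bsub>M\<^esub> a))" by (simp add: quotient_module_def)
    also have "\<dots> = (\<Union>g\<in>{g. (\<lambda>s. g s - f s) \<in> B}. \<Phi> (\<lambda>s. c * g s))"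
      by (simp add: \<Phi>_def[of f] M(4) coset)
    also have "\<dots> = (\<Union>g\<in>{g. (\<lambda>s. g s - f s) \<in> B}. \<Phi> (\<lambda>s. c * f s))"
    proof (rule SUP_cong[OF refl], rule \<Phi>_cong)
      fix g assume "g \<in> {g. (\<lambda>s. g s - f s) \<in> B}"
      then have "(\<lambda>s. c * (g s - f s)) \<in> B" using B(3) by simp
      then show "(\<lambda>s. c * g s - c * f s) \<in> B" by (simp add: right_diff_distrib)
    qed
    also have "\<dots> = \<Phi> (\<lambda>s. c * f s)"
      by (rule SUP_const) (use B(1) in \<open>auto intro!: exI[of _ f]\<close>)
    finally show ?thesis .
  qed
  have V2: "zero ?V = \<Phi> (\<lambda>s. 0)" by (simp add: quotient_module_def N0)
  have mod: "module class_ring ?V"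
    by (rule module_of_functions(1)[of Z ?V \<Phi>]) (assumption | rule Z V1 V2 V3 V4)+
  have sum: "(\<Oplus>\<^bsub>?V\<^esub>w\<in>W. c w \<odot>\<^bsub>?V\<^esub> \<Phi> (F w)) = \<Phi> (\<lambda>s. \<Sum>w\<in>W. c w * F w s)" for c
    by (rule module_of_functions(2)[of Z ?V \<Phi>]) (assumption | rule Z V1 V2 V3 V4 W(1) W(2))+
  show ?thesis
  proof (rule vs_dim_eqI[where u = "\<lambda>w. \<Phi> (F w)"])
    show "module class_ring ?V" "finite W" by (rule mod, rule W(1))
  next
    fix w assume "w \<in> W"
    then show "\<Phi> (F w) \<in> carrier ?V" unfolding V1 by (intro imageI W(2))
  next
    fix y assume "y \<in> carrier ?V"
    then obtain f where f: "y = \<Phi> f" "f \<in> Z" unfolding V1 by (rule imageE)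
    from W(3)[OF f(2)] obtain c where "(\<lambda>s. f s - (\<Sum>w\<in>W. c w * F w s)) \<in> B" ..
    then have "y = \<Phi> (\<lambda>s. \<Sum>w\<in>W. c w * F w s)" unfolding f(1) by (rule \<Phi>_cong)
    also have "\<dots> = (\<Oplus>\<^bsub>?V\<^esub>w\<in>W. c w \<odot>\<^bsub>?V\<^esub> \<Phi> (F w))" by (rule sum[symmetric])
    finally show "\<exists>c. y = (\<Oplus>\<^bsub>?V\<^esub>w\<in>W. c w \<odot>\<^bsub>?V\<^esub> \<Phi> (F w))" by (rule exI[where x = c])
  next
    fix c w assume "(\<Oplus>\<^bsub>?V\<^esub>w\<in>W. c w \<odot>\<^bsub>?V\<^esub> \<Phi> (F w)) = \<zero>\<^bsub>?V\<^esub>" and w: "w \<in> W"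
    then have "\<Phi> (\<lambda>s. \<Sum>w\<in>W. c w * F w s) = \<Phi> (\<lambda>s. 0)" by (simp only: sum V2)
    then have "(\<lambda>s. \<Sum>w\<in>W. c w * F w s) \<in> B" by (rule \<Phi>_0)
    from W(4)[OF this] show "c w = 0" using w ..
  qed
qed

text \<open>A free generator of a module of rank one.\<close>

definition frame :: "('k::comm_ring_1, 'v) module \<Rightarrow> 'v \<Rightarrow> bool" where
  "frame M v \<longleftrightarrow> v \<in> carrier M \<and> (\<forall>y\<in>carrier M. \<exists>c. y = c \<odot>\<^bsub>M\<^esub> v) \<and>
     (\<forall>c d. c \<odot>\<^bsub>M\<^esub> v = d \<odot>\<^bsub>M\<^esub> v \<longrightarrow> c = d)"

lemma frame_exists:
  fixes M :: "('k::field, 'v) module"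
  assumes M: "module class_ring M" and "vs_dim M = 1"
  shows "\<exists>v. frame M v"
proof -
  interpret vectorspace class_ring M
    using M class_field by (simp add: vectorspace_def)
  have fd: "fin_dim" and d: "dim = 1" using assms(2) by (auto simp: vs_dim_def one_enat_def split: if_splits)
  from finite_basis_exists[OF fd] obtain B where B: "finite B" "basis B" by blast
  then have "card B = 1" using dim_basis[of B] d by simp
  then obtain v where v: "B = {v}" by (rule card_1_singletonE)
  have vc: "v \<in> carrier M" and g: "gen_set {v}" and li: "\<not> lin_dep {v}" using B(2) by (auto simp: basis_def v)
  have sv: "c \<odot>\<^bsub>M\<^esub> v \<in> carrier M" for c by (rule module_smult_closed[OF M vc])
  have "\<exists>c. y = c \<odot>\<^bsub>M\<^esub> v" if "y \<in> carrier M" for y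
  proof -
    from that g have "y \<in> span {v}" by simp
    then obtain c A where A: "y = lincomb c A" "A \<subseteq> {v}" unfolding span_def by auto
    from A(2) consider "A = {}" | "A = {v}" by blast
    then show ?thesis
    proof cases
      case 1
      then have "y = 0 \<odot>\<^bsub>M\<^esub> v" using A(1) by (simp add: lincomb_def module_smult_zero[OF M vc])
      then show ?thesis ..
    next
      case 2
      then have "y = c v \<odot>\<^bsub>M\<^esub> v" using A(1) sv by (simp add: lincomb_def)
      then show ?thesis ..
    qed
  qed
  moreover have "c = d" if "c \<odot>\<^bsub>M\<^esub> v = d \<odot>\<^bsub>M\<^esub> v" for c d
  proof (rule ccontr)
    assume "c \<noteq> d"
    have "(c - d) \<odot>\<^bsub>M\<^esub> v = c \<odot>\<^bsub>M\<^esub> v \<oplus>\<^bsub>M\<^esub> (- d) \<odot>\<^bsub>M\<^esub> v"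
      using module_smult_add[OF M vc, of c "- d"] by simp
    also have "\<dots> = d \<odot>\<^bsub>M\<^esub> v \<oplus>\<^bsub>M\<^esub> (- d) \<odot>\<^bsub>M\<^esub> v" by (simp only: that)
    also have "\<dots> = \<zero>\<^bsub>M\<^esub>"
      using module_smult_add[OF M vc, of d "- d"] by (simp add: module_smult_zero[OF M vc])
    finally have "lin_dep {v}"
      unfolding lin_dep_def using \<open>c \<noteq> d\<close> sv
      by (intro exI[of _ "{v}"] exI[of _ "\<lambda>_. c - d"] exI[of _ v]) (simp add: lincomb_def)
    then show False using li by simp
  qed
  ultimately show ?thesis unfolding frame_def using vc by (intro exI[of _ v]) simp
qed

section \<open>Sections of rank one local systems\<close>

definition reverse_path :: "(real \<Rightarrow> 'x) \<Rightarrow> real \<Rightarrow> 'x" where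
  "reverse_path g = (\<lambda>t. g (1 - t))"

lemma reverse_path_simps [simp]: "reverse_path g 0 = g 1" "reverse_path g 1 = g 0"
  "reverse_path (reverse_path g) = g"
  by (simp_all add: reverse_path_def)

lemma path_concat_simps [simp]: "path_concat g h 0 = g 0" "path_concat g h 1 = h 1"
  by (simp_all add: path_concat_def)

lemma pathin_reverse_path:
  assumes "pathin X g"
  shows "pathin X (reverse_path g)"
proof -
  have "continuous_map (top_of_set {0..1::real}) (top_of_set {0..1}) (\<lambda>t. 1 - t)"
    by (auto intro!: continuous_intros)
  from continuous_map_compose[OF this assms[unfolded pathin_def]]
  show ?thesis by (simp add: pathin_def reverse_path_def o_def)
qed

lemma pathin_in_topspace: "pathin X g \<Longrightarrow> 0 \<le> t \<Longrightarrow> t \<le> 1 \<Longrightarrow> g t \<in> topspace X"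
  by (auto simp: pathin_def continuous_map_def)

lemma frame_scale:
  fixes M :: "('k::field, 'v) module"
  assumes M: "module class_ring M" and v: "frame M v" and c: "c \<noteq> 0"
  shows "frame M (c \<odot>\<^bsub>M\<^esub> v)"
proof -
  have vc: "v \<in> carrier M" and gen: "\<And>y. y \<in> carrier M \<Longrightarrow> \<exists>c. y = c \<odot>\<^bsub>M\<^esub> v"
    and uniq: "\<And>c d. c \<odot>\<^bsub>M\<^esub> v = d \<odot>\<^bsub>M\<^esub> v \<Longrightarrow> c = d" using v by (simp_all add: frame_def)
  note assoc = module_smult_assoc[OF M vc, symmetric]
  have "\<exists>d. y = d \<odot>\<^bsub>M\<^esub> (c \<odot>\<^bsub>M\<^esub> v)" if "y \<in> carrier M" for y
  proof -
    from gen[OF that] obtain d where d: "y = d \<odot>\<^bsub>M\<^esub> v" ..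
    show ?thesis by (rule exI[of _ "d / c"]) (simp add: assoc d c)
  qed
  moreover have "d = d'" if "d \<odot>\<^bsub>M\<^esub> (c \<odot>\<^bsub>M\<^esub> v) = d' \<odot>\<^bsub>M\<^esub> (c \<odot>\<^bsub>M\<^esub> v)" for d d'
    using uniq[of "d * c" "d' * c"] that c by (simp add: assoc)
  ultimately show ?thesis unfolding frame_def using module_smult_closed[OF M vc] by simp
qed

text \<open>Monodromy is expressed by a cocycle instead of a class. On loops the two agree, see
  \<open>monodromy_systemI\<close>, but the cocycle also has values on open paths, which
  \<open>parallel_frame\<close> needs.\<close>

locale monodromy_system =
  fixes X :: "'x topology" and L :: "('x, 'k::field, 'v) local_system_data"
    and z :: "((nat \<Rightarrow> real) \<Rightarrow> 'x) \<Rightarrow> int" and a :: 'k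
  assumes rank_one: "rank_one_local_system X L"
    and z: "z \<in> cocycles X (constant_system regular_module) 1"
    and a0: "a \<noteq> 0"
    and mono: "\<And>g w. pathin X g \<Longrightarrow> g 0 = g 1 \<Longrightarrow> w \<in> carrier (fibre L (g 0)) \<Longrightarrow>
      transport L g w = (a powi z (path_simplex g)) \<odot>\<^bsub>fibre L (g 0)\<^esub> w"
begin

abbreviation "\<zeta> g \<equiv> z (path_simplex g)"

lemma local_sys: "local_system X L"
  using rank_one by (simp add: rank_one_local_system_def)

lemma module_fibre: "x \<in> topspace X \<Longrightarrow> module class_ring (fibre L x)"
  using local_sys by (simp add: local_system_def)

lemma module_ends: "pathin X g \<Longrightarrow> module class_ring (fibre L (g 0))" "pathin X g \<Longrightarrow> module class_ring (fibre L (g 1))"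
  by (simp_all add: module_fibre pathin_in_topspace)

lemma transport_hom: "pathin X g \<Longrightarrow> transport L g \<in> module_hom class_ring (fibre L (g 0)) (fibre L (g 1))"
  using local_sys by (simp add: local_system_def)

lemma transport_closed: "pathin X g \<Longrightarrow> w \<in> carrier (fibre L (g 0)) \<Longrightarrow> transport L g w \<in> carrier (fibre L (g 1))"
  using transport_hom[of g] by (auto simp: module_hom_def)

lemma transport_smult: "pathin X g \<Longrightarrow> w \<in> carrier (fibre L (g 0)) \<Longrightarrow>
    transport L g (c \<odot>\<^bsub>fibre L (g 0)\<^esub> w) = c \<odot>\<^bsub>fibre L (g 1)\<^esub> transport L g w"
  using transport_hom[of g] by (simp add: module_hom_def)

lemma transport_concat: "pathin X g \<Longrightarrow> pathin X h \<Longrightarrow> g 1 = h 0 \<Longrightarrow> w \<in> carrier (fibre L (g 0)) \<Longrightarrow>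
    transport L (path_concat g h) w = transport L h (transport L g w)"
  using local_sys by (simp add: local_system_def)

text \<open>Going along \<open>h\<close> and back along \<open>k\<close> is a loop, to which
  \<open>mono\<close> applies.\<close>

lemma transport_reverse:
  assumes h: "pathin X h" and k: "pathin X k" and hk: "h 0 = k 0" "h 1 = k 1" and w: "w \<in> carrier (fibre L (h 0))"
  shows "transport L (reverse_path k) (transport L h w) = a powi (\<zeta> h + \<zeta> (reverse_path k)) \<odot>\<^bsub>fibre L (h 0)\<^esub> w"
proof -
  note rk = pathin_reverse_path[OF k]
  have e: "h 1 = reverse_path k 0" by (simp add: hk)
  have "transport L (reverse_path k) (transport L h w) = transport L (path_concat h (reverse_path k)) w"
    by (rule transport_concat[OF h rk e w, symmetric])
  also have "\<dots> = a powi \<zeta> (path_concat h (reverse_path k)) \<odot>\<^bsub>fibre L (h 0)\<^esub> w"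
    using mono[OF pathin_path_concat[OF h rk e], of w] w hk by simp
  also have "\<zeta> (path_concat h (reverse_path k)) = \<zeta> h + \<zeta> (reverse_path k)"
    by (rule cocycle_concat[OF z h rk e])
  finally show ?thesis .
qed

text \<open>Transport along \<open>h\<close>, back along \<open>k\<close> and forward along
  \<open>k\<close> again is computed in two ways: the first two paths form a loop, and so do the
  last two. The value of the cocycle on \<open>reverse_path k\<close> cancels.\<close>

lemma transport_compare:
  assumes h: "pathin X h" and k: "pathin X k" and hk: "h 0 = k 0" "h 1 = k 1" and w: "w \<in> carrier (fibre L (h 0))"
  shows "transport L h w = a powi (\<zeta> h - \<zeta> k) \<odot>\<^bsub>fibre L (h 1)\<^esub> transport L k w"
proof -
  note rk = pathin_reverse_path[OF k]
  note M = module_ends(2)[OF h]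
  have Th: "transport L h w \<in> carrier (fibre L (h 1))" by (rule transport_closed[OF h w])
  have wk: "w \<in> carrier (fibre L (k 0))" using w by (simp only: hk)
  have Tk: "transport L k w \<in> carrier (fibre L (h 1))" using transport_closed[OF k wk] by (simp only: hk)
  have "a powi (\<zeta> (reverse_path k) + \<zeta> k) \<odot>\<^bsub>fibre L (h 1)\<^esub> transport L h w =
      transport L k (transport L (reverse_path k) (transport L h w))"
    using transport_reverse[OF rk rk refl refl, of "transport L h w"] Th by (simp add: hk)
  also have "\<dots> = transport L k (a powi (\<zeta> h + \<zeta> (reverse_path k)) \<odot>\<^bsub>fibre L (k 0)\<^esub> w)"
    by (simp only: transport_reverse[OF h k hk w] hk)
  also have "\<dots> = a powi (\<zeta> h + \<zeta> (reverse_path k)) \<odot>\<^bsub>fibre L (h 1)\<^esub> transport L k w"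
    by (simp only: transport_smult[OF k wk] hk)
  finally have "a powi (- \<zeta> (reverse_path k) - \<zeta> k) \<odot>\<^bsub>fibre L (h 1)\<^esub> (a powi (\<zeta> (reverse_path k) + \<zeta> k) \<odot>\<^bsub>fibre L (h 1)\<^esub> transport L h w) =
     a powi (- \<zeta> (reverse_path k) - \<zeta> k) \<odot>\<^bsub>fibre L (h 1)\<^esub> (a powi (\<zeta> h + \<zeta> (reverse_path k)) \<odot>\<^bsub>fibre L (h 1)\<^esub> transport L k w)"
    by (rule arg_cong)
  then show ?thesis
    by (simp add: module_smult_assoc[OF M, symmetric] Th Tk power_int_add[OF disjI1[OF a0], symmetric] module_smult_one[OF M])
qed

text \<open>By \<open>transport_reverse\<close>, transport along the reversed path inverts
  \<open>transport L g\<close> up to a nonzero scalar, on both sides.\<close>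

lemma frame_transport:
  assumes g: "pathin X g" and v: "frame (fibre L (g 0)) v"
  shows "frame (fibre L (g 1)) (transport L g v)"
proof -
  note rg = pathin_reverse_path[OF g]
  note M0 = module_ends(1)[OF g] and M1 = module_ends(2)[OF g]
  let ?r = "transport L (reverse_path g)" and ?m = "\<zeta> g + \<zeta> (reverse_path g)"
  have vc: "v \<in> carrier (fibre L (g 0))" and gen: "\<And>y. y \<in> carrier (fibre L (g 0)) \<Longrightarrow> \<exists>c. y = c \<odot>\<^bsub>fibre L (g 0)\<^esub> v"
    and uniq: "\<And>c d. c \<odot>\<^bsub>fibre L (g 0)\<^esub> v = d \<odot>\<^bsub>fibre L (g 0)\<^esub> v \<Longrightarrow> c = d" using v by (simp_all add: frame_def)
  have Tv: "transport L g v \<in> carrier (fibre L (g 1))" by (rule transport_closed[OF g vc])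
  have backw: "?r (c \<odot>\<^bsub>fibre L (g 1)\<^esub> transport L g v) = (c * a powi ?m) \<odot>\<^bsub>fibre L (g 0)\<^esub> v" for c
    using transport_smult[OF rg, of "transport L g v" c] Tv transport_reverse[OF g g refl refl vc]
    by (simp add: module_smult_assoc[OF M0 vc])
  have "c = d" if "c \<odot>\<^bsub>fibre L (g 1)\<^esub> transport L g v = d \<odot>\<^bsub>fibre L (g 1)\<^esub> transport L g v" for c d
    using uniq[of "c * a powi ?m" "d * a powi ?m"] backw[of c] backw[of d] that a0 by simp
  moreover have "\<exists>c. y = c \<odot>\<^bsub>fibre L (g 1)\<^esub> transport L g v" if y: "y \<in> carrier (fibre L (g 1))" for y
  proof -
    have "?r y \<in> carrier (fibre L (g 0))" using transport_closed[OF rg, of y] y by simp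
    from gen[OF this] obtain c where c: "?r y = c \<odot>\<^bsub>fibre L (g 0)\<^esub> v" ..
    have "a powi (\<zeta> (reverse_path g) + \<zeta> g) \<odot>\<^bsub>fibre L (g 1)\<^esub> y = transport L g (?r y)"
      using transport_reverse[OF rg rg refl refl, of y] y by simp
    also have "\<dots> = c \<odot>\<^bsub>fibre L (g 1)\<^esub> transport L g v" unfolding c by (rule transport_smult[OF g vc])
    finally have "a powi (- \<zeta> (reverse_path g) - \<zeta> g) \<odot>\<^bsub>fibre L (g 1)\<^esub> (a powi (\<zeta> (reverse_path g) + \<zeta> g) \<odot>\<^bsub>fibre L (g 1)\<^esub> y) =
      a powi (- \<zeta> (reverse_path g) - \<zeta> g) \<odot>\<^bsub>fibre L (g 1)\<^esub> (c \<odot>\<^bsub>fibre L (g 1)\<^esub> transport L g v)"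
      by (rule arg_cong)
    then have "y = (a powi (- \<zeta> (reverse_path g) - \<zeta> g) * c) \<odot>\<^bsub>fibre L (g 1)\<^esub> transport L g v"
      by (simp add: module_smult_assoc[OF M1, symmetric] y Tv power_int_add[OF disjI1[OF a0], symmetric] module_smult_one[OF M1])
    then show ?thesis ..
  qed
  ultimately show ?thesis unfolding frame_def using Tv by simp
qed

text \<open>A section is chosen by transporting a generator over one base point in each path component;
  rescaling by \<^term>\<open>a powi (- \<zeta> g)\<close> makes the transport along every path a power of \<^term>\<open>a\<close>.\<close>

theorem parallel_frame:
  "\<exists>v. (\<forall>x\<in>topspace X. frame (fibre L x) (v x)) \<and>
     (\<forall>g. pathin X g \<longrightarrow> transport L g (v (g 0)) = a powi \<zeta> g \<odot>\<^bsub>fibre L (g 1)\<^esub> v (g 1))"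
proof -
  define r where "r x = (SOME y. path_component_of X y x)" for x
  have r_rel: "path_component_of X (r x) x" if "x \<in> topspace X" for x
    unfolding r_def by (rule someI[of _ x]) (simp add: path_component_of_refl that)
  have r_eq: "r (g 0) = r (g 1)" if "pathin X g" for g
  proof -
    have "path_component_of X (g 0) (g 1)" unfolding path_component_of_def using that by (intro exI[of _ g]) simp
    then have "path_component_of X y (g 0) \<longleftrightarrow> path_component_of X y (g 1)" for y
      by (meson path_component_of_sym path_component_of_trans)
    then show ?thesis by (simp only: r_def)
  qed
  have "\<forall>x. \<exists>g. x \<in> topspace X \<longrightarrow> pathin X g \<and> g 0 = r x \<and> g 1 = x"
    using r_rel unfolding path_component_of_def by simp
  from choice[OF this] obtain \<gamma> where \<gamma>: "\<forall>x. x \<in> topspace X \<longrightarrow> pathin X (\<gamma> x) \<and> \<gamma> x 0 = r x \<and> \<gamma> x 1 = x" ..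
  have \<gamma>p: "pathin X (\<gamma> x)" and \<gamma>0: "\<gamma> x 0 = r x" and \<gamma>1: "\<gamma> x 1 = x" if "x \<in> topspace X" for x
    using \<gamma> that by simp_all
  have "\<forall>y. \<exists>v. y \<in> topspace X \<longrightarrow> frame (fibre L y) v"
    using frame_exists[OF module_fibre] rank_one by (simp add: rank_one_local_system_def)
  from choice[OF this] obtain b where b: "\<forall>y. y \<in> topspace X \<longrightarrow> frame (fibre L y) (b y)" ..
  have rX: "r x \<in> topspace X" if "x \<in> topspace X" for x
    using pathin_in_topspace[OF \<gamma>p[OF that], of 0] \<gamma>0[OF that] by simp
  have fb: "frame (fibre L (r x)) (b (r x))" and bc: "b (r x) \<in> carrier (fibre L (r x))" if "x \<in> topspace X" for x
    using b rX[OF that] by (simp_all add: frame_def)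
  define v where "v x = a powi (- \<zeta> (\<gamma> x)) \<odot>\<^bsub>fibre L x\<^esub> transport L (\<gamma> x) (b (r x))" for x
  have "frame (fibre L x) (v x)" if x: "x \<in> topspace X" for x
  proof -
    have "frame (fibre L x) (transport L (\<gamma> x) (b (r x)))"
      using frame_transport[OF \<gamma>p[OF x], of "b (r x)"] fb[OF x] by (simp only: \<gamma>0[OF x] \<gamma>1[OF x])
    then show ?thesis unfolding v_def by (rule frame_scale[OF module_fibre[OF x]]) (simp add: a0)
  qed
  moreover have "transport L g (v (g 0)) = a powi \<zeta> g \<odot>\<^bsub>fibre L (g 1)\<^esub> v (g 1)" if g: "pathin X g" for g
  proof -
    have x: "g 0 \<in> topspace X" and y: "g 1 \<in> topspace X" using pathin_in_topspace[OF g] by simp_all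
    note M = module_fibre[OF y]
    let ?b = "b (r (g 0))"
    have bx: "?b \<in> carrier (fibre L (\<gamma> (g 0) 0))" using bc[OF x] by (simp only: \<gamma>0[OF x])
    have Tb: "transport L (\<gamma> (g 0)) ?b \<in> carrier (fibre L (g 0))"
      using transport_closed[OF \<gamma>p[OF x] bx] by (simp only: \<gamma>1[OF x])
    have e: "\<gamma> (g 0) 1 = g 0" by (rule \<gamma>1[OF x])
    note ph = pathin_path_concat[OF \<gamma>p[OF x] g e]
    have s: "path_concat (\<gamma> (g 0)) g 0 = \<gamma> (g 1) 0" by (simp add: \<gamma>0[OF x] \<gamma>0[OF y] r_eq[OF g])
    have t: "path_concat (\<gamma> (g 0)) g 1 = \<gamma> (g 1) 1" by (simp add: \<gamma>1[OF y])
    have by': "b (r (g 1)) = ?b" by (simp only: r_eq[OF g])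
    have Tby: "transport L (\<gamma> (g 1)) ?b \<in> carrier (fibre L (g 1))"
      using transport_closed[OF \<gamma>p[OF y], of ?b] bc[OF y] by (simp only: \<gamma>0[OF y] \<gamma>1[OF y] by')
    have "transport L g (v (g 0)) = a powi (- \<zeta> (\<gamma> (g 0))) \<odot>\<^bsub>fibre L (g 1)\<^esub> transport L g (transport L (\<gamma> (g 0)) ?b)"
      unfolding v_def by (rule transport_smult[OF g Tb])
    also have "transport L g (transport L (\<gamma> (g 0)) ?b) = transport L (path_concat (\<gamma> (g 0)) g) ?b"
      by (rule transport_concat[OF \<gamma>p[OF x] g e bx, symmetric])
    also have "\<dots> = a powi (\<zeta> (path_concat (\<gamma> (g 0)) g) - \<zeta> (\<gamma> (g 1))) \<odot>\<^bsub>fibre L (g 1)\<^esub> transport L (\<gamma> (g 1)) ?b"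
      using transport_compare[OF ph \<gamma>p[OF y] s t, of ?b] bx by simp
    also have "\<zeta> (path_concat (\<gamma> (g 0)) g) = \<zeta> (\<gamma> (g 0)) + \<zeta> g"
      by (rule cocycle_concat[OF z \<gamma>p[OF x] g e])
    also have "a powi (- \<zeta> (\<gamma> (g 0))) \<odot>\<^bsub>fibre L (g 1)\<^esub> (a powi (\<zeta> (\<gamma> (g 0)) + \<zeta> g - \<zeta> (\<gamma> (g 1))) \<odot>\<^bsub>fibre L (g 1)\<^esub> transport L (\<gamma> (g 1)) ?b)
       = a powi \<zeta> g \<odot>\<^bsub>fibre L (g 1)\<^esub> (a powi (- \<zeta> (\<gamma> (g 1))) \<odot>\<^bsub>fibre L (g 1)\<^esub> transport L (\<gamma> (g 1)) ?b)"
      by (simp add: module_smult_assoc[OF M Tby, symmetric] power_int_add[OF disjI1[OF a0], symmetric])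
    finally show ?thesis by (simp only: v_def by')
  qed
  ultimately show ?thesis by (intro exI[of _ v]) simp
qed

end

text \<open>The members of \<xi> differ from \<open>z\<close> by coboundaries, and these vanish on
  loops.\<close>

lemma monodromy_systemI:
  assumes L: "rank_one_local_system X L" "has_monodromy X \<xi> a L" and a: "a \<noteq> 0"
    and \<xi>: "\<xi> \<in> carrier (integral_cohomology X 1)"
    and z: "z \<in> cocycles X (constant_system regular_module) 1" "\<xi> \<noteq> {}"
      "\<And>f. f \<in> \<xi> \<Longrightarrow> \<exists>b\<in>coboundaries X (constant_system regular_module) 1.
       \<forall>s\<in>singular_simplex_set 1 X. f s = b s + z s"
  shows "monodromy_system X L z a"
proof
  fix g w assume g: "pathin X g" "g 0 = g 1" and w: "w \<in> carrier (fibre L (g 0))"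
  from z(2) obtain f where f: "f \<in> \<xi>" by blast
  from z(3)[OF f] obtain b where b: "b \<in> coboundaries X (constant_system regular_module) 1"
    "\<forall>s\<in>singular_simplex_set 1 X. f s = b s + z s" ..
  have "pairing \<xi> g = z (path_simplex g)"
    using pairing_eq[OF \<xi> g f] b(2) path_simplex_singular[OF g(1)] coboundary_loop[OF g b(1)] by simp
  then show "transport L g w = a powi z (path_simplex g) \<odot>\<^bsub>fibre L (g 0)\<^esub> w"
    using L(2) g w by (simp add: has_monodromy_def)
qed (fact L(1) a z(1))+

section \<open>Dimensions of twisted cohomology\<close>

lemma cochains_simps:
  "carrier (cochains X L q) = (\<Pi>\<^sub>E s\<in>singular_simplex_set q X. carrier (fibre L (s (vertex 0))))"
  "zero (cochains X L q) = (\<lambda>s\<in>singular_simplex_set q X. \<zero>\<^bsub>fibre L (s (vertex 0))\<^esub>)"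
  "f \<oplus>\<^bsub>cochains X L q\<^esub> g = (\<lambda>s\<in>singular_simplex_set q X. f s \<oplus>\<^bsub>fibre L (s (vertex 0))\<^esub> g s)"
  "c \<odot>\<^bsub>cochains X L q\<^esub> f = (\<lambda>s\<in>singular_simplex_set q X. c \<odot>\<^bsub>fibre L (s (vertex 0))\<^esub> f s)"
  by (simp_all add: cochains_def Let_def)

context twisted
begin

text \<open>The section \<open>v\<close> identifies scalar functions on simplices with cochains,
  through \<open>\<theta>\<close>. By \<open>T\<close> the coboundary turns into evaluation on
  \<open>tb\<close>, so the cohomology is the one that \<open>cohomology_basis\<close>
  describes.\<close>

theorem vs_dim_cohomology:
  fixes L :: "('x, 'k::field, 'v) local_system_data" and ev :: "'r \<Rightarrow> 'k"
  assumes sc: "specialised_complex (\<lambda>q. singular_simplex_set q X) tb xs ev"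
    and ev_e: "\<And>k. ev (e k) = a powi k"
    and L: "local_system X L"
    and v: "\<And>x. x \<in> topspace X \<Longrightarrow> frame (fibre L x) (v x)"
    and T: "\<And>g. pathin X g \<Longrightarrow> transport L g (v (g 0)) = a powi z (path_simplex g) \<odot>\<^bsub>fibre L (g 1)\<^esub> v (g 1)"
  shows "vs_dim (cohomology X L q) = enat (attached_complex.betti xs q ev)"
proof -
  interpret sc: specialised_complex "\<lambda>q. singular_simplex_set q X" tb xs ev by (rule sc)
  let ?S = "\<lambda>q. singular_simplex_set q X"
  define Fs where "Fs s = fibre L (s (vertex 0))" for s :: "(nat \<Rightarrow> real) \<Rightarrow> 'x"
  define vs where "vs s = v (s (vertex 0))" for s :: "(nat \<Rightarrow> real) \<Rightarrow> 'x"
  define \<theta> where "\<theta> q f = (\<lambda>s\<in>?S q. f s \<odot>\<^bsub>Fs s\<^esub> vs s)" for q f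
  have top: "s (vertex 0) \<in> topspace X" if "s \<in> ?S q" for s q
  proof -
    have "continuous_map (simplex_space q) X s" using that by (simp add: singular_simplex_def)
    from continuous_map_image_subset_topspace[OF this] show ?thesis by (auto simp: image_subset_iff)
  qed
  have M: "module class_ring (Fs s)" if "s \<in> ?S q" for s q
    using L top[OF that] by (simp add: local_system_def Fs_def)
  have fr: "frame (Fs s) (vs s)" if "s \<in> ?S q" for s q
    using v[OF top[OF that]] by (simp add: Fs_def vs_def)
  have vc: "vs s \<in> carrier (Fs s)" if "s \<in> ?S q" for s q
    using fr[OF that] by (simp add: frame_def)
  have uniq: "c = d" if "c \<odot>\<^bsub>Fs s\<^esub> vs s = d \<odot>\<^bsub>Fs s\<^esub> vs s" "s \<in> ?S q" for c d s q
    using fr[OF that(2)] that(1) by (simp add: frame_def)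
  have carr: "carrier (cochains X L q) = (\<Pi>\<^sub>E s\<in>?S q. carrier (Fs s))" for q
    by (simp only: cochains_simps Fs_def)
  have \<theta>_carrier: "\<theta> q f \<in> carrier (cochains X L q)" for q f
  proof -
    have "\<forall>s\<in>?S q. f s \<odot>\<^bsub>Fs s\<^esub> vs s \<in> carrier (Fs s)"
      by (rule ballI) (rule module_smult_closed[OF M vc])
    then show ?thesis unfolding carr \<theta>_def by (simp only: restrict_PiE_iff)
  qed
  have \<theta>_surj: "\<exists>f. h = \<theta> q f" if h: "h \<in> carrier (cochains X L q)" for h q
  proof -
    have "\<forall>s\<in>?S q. \<exists>c. h s = c \<odot>\<^bsub>Fs s\<^esub> vs s"
    proof
      fix s assume s: "s \<in> ?S q"
      have "h s \<in> carrier (Fs s)" using h[unfolded carr] s by (rule PiE_mem)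
      then show "\<exists>c. h s = c \<odot>\<^bsub>Fs s\<^esub> vs s" using fr[OF s] by (simp add: frame_def)
    qed
    from bchoice[OF this] obtain f where f: "\<forall>s\<in>?S q. h s = f s \<odot>\<^bsub>Fs s\<^esub> vs s" ..
    have "h = \<theta> q f"
    proof (rule extensionalityI[of _ "?S q"])
      show "h \<in> extensional (?S q)" using h[unfolded carr] by (simp add: PiE_def)
      show "\<theta> q f \<in> extensional (?S q)" by (simp add: \<theta>_def)
      show "h s = \<theta> q f s" if "s \<in> ?S q" for s using bspec[OF f that] that by (simp only: \<theta>_def restrict_apply')
    qed
    then show ?thesis by (rule exI[where x = f])
  qed
  have \<theta>_cong: "\<theta> q f = \<theta> q g" if "\<And>s. s \<in> ?S q \<Longrightarrow> f s = g s" for q f g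
    unfolding \<theta>_def by (rule restrict_ext) (simp only: that)
  have \<theta>_inj: "f s = g s" if "\<theta> q f = \<theta> q g" "s \<in> ?S q" for q f g s
  proof (rule uniq[OF _ that(2)])
    show "f s \<odot>\<^bsub>Fs s\<^esub> vs s = g s \<odot>\<^bsub>Fs s\<^esub> vs s"
      using fun_cong[OF that(1), of s] that(2) by (simp only: \<theta>_def restrict_apply')
  qed
  have \<theta>_add: "\<theta> q f \<oplus>\<^bsub>cochains X L q\<^esub> \<theta> q g = \<theta> q (\<lambda>s. f s + g s)" for q f g
  proof -
    have "\<theta> q f \<oplus>\<^bsub>cochains X L q\<^esub> \<theta> q g = (\<lambda>s\<in>?S q. \<theta> q f s \<oplus>\<^bsub>Fs s\<^esub> \<theta> q g s)"
      by (simp only: cochains_simps Fs_def)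
    also have "\<dots> = \<theta> q (\<lambda>s. f s + g s)"
      unfolding \<theta>_def by (rule restrict_ext) (simp only: restrict_apply' module_smult_add[OF M vc])
    finally show ?thesis .
  qed
  have \<theta>_smult: "c \<odot>\<^bsub>cochains X L q\<^esub> \<theta> q f = \<theta> q (\<lambda>s. c * f s)" for q c f
  proof -
    have "c \<odot>\<^bsub>cochains X L q\<^esub> \<theta> q f = (\<lambda>s\<in>?S q. c \<odot>\<^bsub>Fs s\<^esub> \<theta> q f s)"
      by (simp only: cochains_simps Fs_def)
    also have "\<dots> = \<theta> q (\<lambda>s. c * f s)"
      unfolding \<theta>_def by (rule restrict_ext) (simp only: restrict_apply' module_smult_assoc[OF M vc])
    finally show ?thesis .
  qed
  have \<theta>_0: "\<zero>\<^bsub>cochains X L q\<^esub> = \<theta> q (\<lambda>s. 0)" for q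
  proof -
    have "\<zero>\<^bsub>cochains X L q\<^esub> = (\<lambda>s\<in>?S q. \<zero>\<^bsub>Fs s\<^esub>)" by (simp only: cochains_simps Fs_def)
    also have "\<dots> = \<theta> q (\<lambda>s. 0)"
      unfolding \<theta>_def by (rule restrict_ext) (simp only: module_smult_zero[OF M vc])
    finally show ?thesis .
  qed
  have ev_sign: "ev ((- 1) ^ i) = (- 1) ^ i" for i
  proof -
    have "ev (- x) = - ev x" for x using sc.ev_add[of "- x" x] by (simp add: sc.ev_0 eq_neg_iff_add_eq_0)
    then show ?thesis by (induct i) (simp_all add: sc.ev_1)
  qed
  have pair_tb: "sc.pair f (tb (Suc q) s) = a powi weight s * f (singular_face (Suc q) 0 s) +
      (\<Sum>i\<in>{1..Suc q}. (- 1) ^ i * f (singular_face (Suc q) i s))" for f q s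
  proof -
    have "sc.pair f (tb (Suc q) s) = act ev (e (weight s)) (f (singular_face (Suc q) 0 s)) +
      (\<Sum>i\<in>{1..Suc q}. act ev ((- 1) ^ i) (f (singular_face (Suc q) i s)))"
      by (simp only: tb_def nat.simps if_False sc.e.linext_add sc.e.linext_sum sc.e.linext_single)
    then show ?thesis by (simp only: act_def ev_e ev_sign)
  qed
  \<comment> \<open>Only face 0 has another leading vertex. Its value is transported along the
    leading edge, and there \<open>T\<close> supplies the weight; all other faces share the fibre
    and the frame of \<open>s\<close>.\<close>
  have \<theta>_coboundary: "coboundary X L q (\<theta> q f) = \<theta> (Suc q) (\<lambda>s. sc.pair f (tb (Suc q) s))" for q f
    unfolding coboundary_def \<theta>_def[of "Suc q"] Let_def
  proof (rule restrict_ext)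
    fix s assume s: "s \<in> ?S (Suc q)"
    let ?f = "\<lambda>i. singular_face (Suc q) i s"
    have fS: "?f i \<in> ?S q" if "i \<le> Suc q" for i
      using singular_simplex_singular_face[of "Suc q" X s i] s that by simp
    have p: "pathin X (leading_edge s)" using pathin_leading_edge s by simp
    have l0: "leading_edge s 0 = s (vertex 1)" and l1: "leading_edge s 1 = s (vertex 0)"
      by (simp_all add: leading_edge_def)
    have f0: "?f 0 (vertex 0) = s (vertex 1)" using singular_face_vertex[of 0 q s] by simp
    have fi: "?f i (vertex 0) = s (vertex 0)" if "i \<in> {1..Suc q}" for i using singular_face_vertex[of i q s] that by simp
    have v1: "v (s (vertex 1)) \<in> carrier (fibre L (s (vertex 1)))"
      using vc[OF fS[of 0]] by (simp add: Fs_def vs_def f0)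
    have "transport L (leading_edge s) \<in> module_hom class_ring (fibre L (s (vertex 1))) (Fs s)"
      using L p unfolding local_system_def Fs_def l0[symmetric] l1[symmetric] by simp
    then have "transport L (leading_edge s) (f (?f 0) \<odot>\<^bsub>fibre L (s (vertex 1))\<^esub> v (s (vertex 1))) =
        f (?f 0) \<odot>\<^bsub>Fs s\<^esub> transport L (leading_edge s) (v (s (vertex 1)))"
      using v1 by (simp add: module_hom_def)
    also have "transport L (leading_edge s) (v (s (vertex 1))) = a powi weight s \<odot>\<^bsub>Fs s\<^esub> vs s"
      using T[OF p] by (simp add: l0 l1 weight_def Fs_def vs_def)
    also have "f (?f 0) \<odot>\<^bsub>Fs s\<^esub> (a powi weight s \<odot>\<^bsub>Fs s\<^esub> vs s) = (a powi weight s * f (?f 0)) \<odot>\<^bsub>Fs s\<^esub> vs s"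
      by (simp only: module_smult_assoc[OF M[OF s] vc[OF s], symmetric] mult.commute)
    finally have first: "transport L (leading_edge s) (\<theta> q f (?f 0)) = (a powi weight s * f (?f 0)) \<odot>\<^bsub>Fs s\<^esub> vs s"
      using fS[of 0] by (simp add: \<theta>_def Fs_def vs_def f0)
    interpret Ms: module class_ring "Fs s" by (rule M[OF s])
    have summand: "(- 1) ^ i \<odot>\<^bsub>Fs s\<^esub> \<theta> q f (?f i) = ((- 1) ^ i * f (?f i)) \<odot>\<^bsub>Fs s\<^esub> vs s" if "i \<in> {1..Suc q}" for i
    proof -
      have "Fs (?f i) = Fs s" "vs (?f i) = vs s" by (simp_all only: Fs_def vs_def fi[OF that])
      moreover have "?f i \<in> ?S q" using that by (intro fS) simp
      ultimately show ?thesis by (simp only: \<theta>_def restrict_apply' module_smult_assoc[OF M[OF s] vc[OF s]])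
    qed
    have "(\<Oplus>\<^bsub>Fs s\<^esub>i\<in>{1..Suc q}. (- 1) ^ i \<odot>\<^bsub>Fs s\<^esub> \<theta> q f (?f i)) =
        (\<Oplus>\<^bsub>Fs s\<^esub>i\<in>{1..Suc q}. ((- 1) ^ i * f (?f i)) \<odot>\<^bsub>Fs s\<^esub> vs s)"
      by (rule Ms.M.finsum_cong') (simp_all add: summand module_smult_closed[OF M[OF s] vc[OF s]] del: sum.cl_ivl_Suc)
    also have "\<dots> = (\<Sum>i\<in>{1..Suc q}. (- 1) ^ i * f (?f i)) \<odot>\<^bsub>Fs s\<^esub> vs s"
      by (rule module_finsum_smult[OF M[OF s] vc[OF s]]) simp
    finally show "transport L (leading_edge s) (\<theta> q f (?f 0)) \<oplus>\<^bsub>fibre L (s (vertex 0))\<^esub>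
        (\<Oplus>\<^bsub>fibre L (s (vertex 0))\<^esub>i\<in>{1..Suc q}. (- 1) ^ i \<odot>\<^bsub>fibre L (s (vertex 0))\<^esub> \<theta> q f (?f i)) =
        sc.pair f (tb (Suc q) s) \<odot>\<^bsub>Fs s\<^esub> vs s"
      by (simp only: first pair_tb module_smult_add[OF M[OF s] vc[OF s]] Fs_def[symmetric])
  qed
  have range_\<theta>: "carrier (cochains X L q) = range (\<theta> q)" for q
  proof (intro equalityI subsetI)
    fix h assume "h \<in> carrier (cochains X L q)"
    from \<theta>_surj[OF this] obtain f where f: "h = \<theta> q f" ..
    show "h \<in> range (\<theta> q)" unfolding f by (rule rangeI)
  next
    fix h assume "h \<in> range (\<theta> q)"
    then obtain f where "h = \<theta> q f" by (rule rangeE)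
    then show "h \<in> carrier (cochains X L q)" by (simp only: \<theta>_carrier)
  qed
  have cocycle_iff: "coboundary X L q (\<theta> q f) = \<zero>\<^bsub>cochains X L (Suc q)\<^esub> \<longleftrightarrow> sc.cocycle q f" for f
  proof
    assume "coboundary X L q (\<theta> q f) = \<zero>\<^bsub>cochains X L (Suc q)\<^esub>"
    then have "\<theta> (Suc q) (\<lambda>s. sc.pair f (tb (Suc q) s)) = \<theta> (Suc q) (\<lambda>s. 0)" by (simp only: \<theta>_coboundary \<theta>_0)
    from \<theta>_inj[OF this] show "sc.cocycle q f" unfolding sc.cocycle_def by (intro ballI)
  next
    assume "sc.cocycle q f"
    then have "\<And>s. s \<in> ?S (Suc q) \<Longrightarrow> sc.pair f (tb (Suc q) s) = 0" unfolding sc.cocycle_def by (rule bspec)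
    then have "\<theta> (Suc q) (\<lambda>s. sc.pair f (tb (Suc q) s)) = \<theta> (Suc q) (\<lambda>s. 0)" by (rule \<theta>_cong)
    then show "coboundary X L q (\<theta> q f) = \<zero>\<^bsub>cochains X L (Suc q)\<^esub>" by (simp only: \<theta>_coboundary \<theta>_0)
  qed
  have cocycles: "cocycles X L q = \<theta> q ` {f. sc.cocycle q f}"
    unfolding cocycles_def range_\<theta>
  proof (intro equalityI subsetI)
    fix h assume h: "h \<in> {h \<in> range (\<theta> q). coboundary X L q h = \<zero>\<^bsub>cochains X L (Suc q)\<^esub>}"
    then obtain f where f: "h = \<theta> q f" by (elim CollectE conjE rangeE)
    show "h \<in> \<theta> q ` {f. sc.cocycle q f}" unfolding f
      by (rule imageI) (use h f cocycle_iff in \<open>simp only: mem_Collect_eq\<close>)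
  next
    fix h assume "h \<in> \<theta> q ` {f. sc.cocycle q f}"
    then obtain f where f: "h = \<theta> q f" "f \<in> {f. sc.cocycle q f}" by (rule imageE)
    then show "h \<in> {h \<in> range (\<theta> q). coboundary X L q h = \<zero>\<^bsub>cochains X L (Suc q)\<^esub>}"
      by (simp only: mem_Collect_eq cocycle_iff) simp
  qed
  have coboundaries: "coboundaries X L q = \<theta> q ` {f. sc.coboundary q f}"
  proof (cases q)
    case 0
    have c: "sc.coboundary 0 f \<longleftrightarrow> (\<forall>s\<in>?S 0. f s = 0)" for f by (simp add: sc.coboundary_def tb_def)
    have "\<theta> 0 ` {f. sc.coboundary 0 f} = {\<theta> 0 (\<lambda>s. 0)}"
    proof (intro equalityI subsetI)
      fix y assume "y \<in> \<theta> 0 ` {f. sc.coboundary 0 f}"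
      then obtain f where f: "y = \<theta> 0 f" "f \<in> {f. sc.coboundary 0 f}" by (rule imageE)
      have "\<theta> 0 f = \<theta> 0 (\<lambda>s. 0)" by (rule \<theta>_cong) (use f(2) c in simp)
      then show "y \<in> {\<theta> 0 (\<lambda>s. 0)}" using f(1) by simp
    next
      fix y assume "y \<in> {\<theta> 0 (\<lambda>s. 0)}"
      then show "y \<in> \<theta> 0 ` {f. sc.coboundary 0 f}" by (intro image_eqI[of _ _ "\<lambda>s. 0"]) (simp_all add: c)
    qed
    then show ?thesis by (simp add: coboundaries_def 0 \<theta>_0)
  next
    case (Suc p)
    have "coboundaries X L q = range (\<lambda>g. \<theta> q (\<lambda>s. sc.pair g (tb q s)))"
      by (simp only: coboundaries_def Suc nat.case range_\<theta> image_image \<theta>_coboundary)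
    also have "\<dots> = \<theta> q ` {f. sc.coboundary q f}"
    proof (intro equalityI subsetI)
      fix y assume "y \<in> range (\<lambda>g. \<theta> q (\<lambda>s. sc.pair g (tb q s)))"
      then obtain g where g: "y = \<theta> q (\<lambda>s. sc.pair g (tb q s))" by (rule rangeE)
      have "sc.coboundary q (\<lambda>s. sc.pair g (tb q s))" unfolding sc.coboundary_def by (intro exI[of _ g]) simp
      then show "y \<in> \<theta> q ` {f. sc.coboundary q f}" unfolding g by (intro imageI) simp
    next
      fix y assume "y \<in> \<theta> q ` {f. sc.coboundary q f}"
      then obtain f where f: "y = \<theta> q f" "f \<in> {f. sc.coboundary q f}" by (rule imageE)
      then have "\<exists>g. \<forall>s\<in>?S q. f s = sc.pair g (tb q s)" by (simp add: sc.coboundary_def)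
      then obtain g where g: "\<forall>s\<in>?S q. f s = sc.pair g (tb q s)" ..
      have yg: "y = \<theta> q (\<lambda>s. sc.pair g (tb q s))" unfolding f(1) by (rule \<theta>_cong) (rule bspec[OF g])
      show "y \<in> range (\<lambda>g. \<theta> q (\<lambda>s. sc.pair g (tb q s)))"
        unfolding yg by (rule rangeI[where f = "\<lambda>g. \<theta> q (\<lambda>s. sc.pair g (tb q s))"])
    qed
    finally show ?thesis .
  qed
  have pair_scale: "sc.pair (\<lambda>s. c * f s) x = c * sc.pair f x" for c f x
    by (simp add: linext_def act_def sum_distrib_left mult.left_commute)
  have pair_0: "sc.pair (\<lambda>s. 0) x = 0" for x
    by (simp add: linext_def act_def)
  from sc.cohomology_basis[of q] obtain W :: "(nat \<Rightarrow>\<^sub>0 'k) set" and F where W: "finite W" "card W = sc.betti q ev"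
    "\<forall>w\<in>W. sc.cocycle q (F w)"
    "\<forall>f. sc.cocycle q f \<longrightarrow> (\<exists>c. sc.coboundary q (\<lambda>s. f s - (\<Sum>w\<in>W. c w * F w s)))"
    "\<forall>c. sc.coboundary q (\<lambda>s. \<Sum>w\<in>W. c w * F w s) \<longrightarrow> (\<forall>w\<in>W. c w = 0)" by (elim exE conjE)
  have "vs_dim (cohomology X L q) = enat (card W)"
    unfolding cohomology_def
  proof (rule vs_dim_quotient_module[of "{f. sc.cocycle q f}" "{f. sc.coboundary q f}" _ "\<theta> q" _ W F])
    show "(\<lambda>s. 0) \<in> {f. sc.cocycle q f}" by (simp add: sc.cocycle_def pair_0)
    show "(\<lambda>s. f s + g s) \<in> {f. sc.cocycle q f}" if "f \<in> {f. sc.cocycle q f}" "g \<in> {f. sc.cocycle q f}" for f g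
      using that by (simp add: sc.cocycle_def sc.e.linext_fun_add)
    show "(\<lambda>s. c * f s) \<in> {f. sc.cocycle q f}" if "f \<in> {f. sc.cocycle q f}" for c f
      using that by (simp add: sc.cocycle_def pair_scale)
    show "(\<lambda>s. 0) \<in> {f. sc.coboundary q f}"
      unfolding sc.coboundary_def by (intro CollectI exI[of _ "\<lambda>s. 0"]) (simp add: pair_0)
    show "(\<lambda>s. f s + g s) \<in> {f. sc.coboundary q f}" if fg: "f \<in> {f. sc.coboundary q f}" "g \<in> {f. sc.coboundary q f}" for f g
    proof -
      from fg(1) obtain f' where f': "\<forall>s\<in>?S q. f s = sc.pair f' (tb q s)" unfolding sc.coboundary_def by (elim CollectE exE)
      from fg(2) obtain g' where g': "\<forall>s\<in>?S q. g s = sc.pair g' (tb q s)" unfolding sc.coboundary_def by (elim CollectE exE)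
      show ?thesis unfolding sc.coboundary_def
        by (intro CollectI exI[of _ "\<lambda>s. f' s + g' s"]) (simp add: sc.e.linext_fun_add bspec[OF f'] bspec[OF g'])
    qed
    show "(\<lambda>s. c * f s) \<in> {f. sc.coboundary q f}" if f: "f \<in> {f. sc.coboundary q f}" for c f
    proof -
      from f obtain f' where f': "\<forall>s\<in>?S q. f s = sc.pair f' (tb q s)" unfolding sc.coboundary_def by (elim CollectE exE)
      show ?thesis unfolding sc.coboundary_def
        by (intro CollectI exI[of _ "\<lambda>s. c * f' s"]) (simp add: pair_scale bspec[OF f'])
    qed
    show "(\<lambda>s. f s - g s) \<in> {f. sc.coboundary q f}" if fg: "\<theta> q f = \<theta> q g" for f g
      unfolding sc.coboundary_def
      by (intro CollectI exI[of _ "\<lambda>s. 0"]) (simp add: pair_0 \<theta>_inj[OF fg])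
    show "finite W" by (rule W(1))
    show "F w \<in> {f. sc.cocycle q f}" if "w \<in> W" for w using W(3) that by simp
    show "\<exists>c. (\<lambda>s. f s - (\<Sum>w\<in>W. c w * F w s)) \<in> {f. sc.coboundary q f}" if "f \<in> {f. sc.cocycle q f}" for f
      unfolding mem_Collect_eq by (rule mp[OF spec[OF W(4)]]) (use that in \<open>simp only: mem_Collect_eq\<close>)
    show "\<forall>w\<in>W. c w = 0" if "(\<lambda>s. \<Sum>w\<in>W. c w * F w s) \<in> {f. sc.coboundary q f}" for c
      by (rule mp[OF spec[OF W(5)]]) (use that in \<open>simp only: mem_Collect_eq\<close>)
  qed (simp_all add: cocycles coboundaries \<theta>_add \<theta>_smult)
  then show ?thesis by (simp only: W(2))
qed

end

section \<open>Generic dimension and jump points\<close>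

lemma (in attached_complex) finite_columns: "finite (columns q)"
  by (simp add: columns_def)

text \<open>Ranks enter \<open>betti\<close> with a negative sign, so the larger ranks at the
  generic point give the smaller dimension.\<close>

lemma (in attached_complex) betti_specialise:
  fixes evK :: "'r \<Rightarrow> 'k::field" and ev :: "'r \<Rightarrow> 'f::field"
  assumes le: "\<And>A :: (nat \<Rightarrow>\<^sub>0 'r) set. finite A \<Longrightarrow> fv.dim (Poly_Mapping.map ev ` A) \<le> fv.dim (Poly_Mapping.map evK ` A)"
  shows "betti q evK \<le> betti q ev"
  unfolding betti_def by (intro diff_le_mono2 add_mono le finite_columns)

text \<open>One attachment \<open>xs\<close> serves all local systems with monodromy governed by
  \<xi>, over \<complex> as well as over \<rat>(\<tau>); only the evaluation changes.\<close>

lemma vs_dim_cohomology_laurent: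
  fixes L :: "('x, 'k::field, 'v) local_system_data" and \<iota> :: "rat \<Rightarrow> 'k"
  assumes at: "attached_complex (\<lambda>q. singular_simplex_set q X) (twisted.tb z (\<lambda>k. sgl k (1::rat))) xs"
    and \<xi>: "\<xi> \<in> carrier (integral_cohomology X 1)"
    and z: "z \<in> cocycles X (constant_system regular_module) 1" "\<xi> \<noteq> {}"
      "\<forall>f\<in>\<xi>. \<exists>b\<in>coboundaries X (constant_system regular_module) 1.
       \<forall>s\<in>singular_simplex_set 1 X. f s = b s + z s"
    and L: "rank_one_local_system X L" "has_monodromy X \<xi> a L" and le: "laurent_eval \<iota> a"
  shows "vs_dim (cohomology X L q) = enat (attached_complex.betti xs q (laurent_eval.eval \<iota> a))"
proof -
  interpret twisted X z "\<lambda>k. sgl k (1::rat)"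
    by unfold_locales (rule z(1), simp_all add: mult_single)
  interpret le: laurent_eval \<iota> a by (rule le)
  interpret ms: monodromy_system X L z a
    by (rule monodromy_systemI[OF L le.a0 \<xi> z(1,2)]) (rule bspec[OF z(3)])
  from ms.parallel_frame obtain v where v: "\<forall>x\<in>topspace X. frame (fibre L x) (v x)"
    "\<forall>g. pathin X g \<longrightarrow> transport L g (v (g 0)) = a powi z (path_simplex g) \<odot>\<^bsub>fibre L (g 1)\<^esub> v (g 1)"
    by (elim exE conjE)
  have sc: "specialised_complex (\<lambda>q. singular_simplex_set q X) tb xs le.eval"
    by (intro specialised_complex.intro at le.ring_map_eval)
  show ?thesis
  proof (rule vs_dim_cohomology[OF sc _ ms.local_sys])
    show "le.eval (sgl k 1) = a powi k" for k by (simp add: le.eval_single le.ev_1)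
    show "frame (fibre L x) (v x)" if "x \<in> topspace X" for x using v(1) that ..
    show "transport L g (v (g 0)) = a powi z (path_simplex g) \<odot>\<^bsub>fibre L (g 1)\<^esub> v (g 1)" if "pathin X g" for g
      using v(2) that by (elim allE impE)
  qed
qed

theorem theorem2:
  fixes X :: "'x topology"
    and n q :: nat
    and \<xi> :: "(((nat \<Rightarrow> real) \<Rightarrow> 'x) \<Rightarrow> int) set"
    and E :: "complex \<Rightarrow> ('x, complex, 'v) local_system_data"
    and L :: "('x, rat poly fract, 'w) local_system_data"
  assumes "closed_manifold n X"
    and "\<xi> \<in> carrier (integral_cohomology X 1)"
    and "\<And>a. a \<noteq> 0 \<Longrightarrow> rank_one_local_system X (E a)"
    and "\<And>a. a \<noteq> 0 \<Longrightarrow> has_monodromy X \<xi> a (E a)"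
    and "rank_one_local_system X L"
    and "has_monodromy X \<xi> ratfun_var L"
  shows "\<exists>J. finite J \<and> 0 \<notin> J \<and>
           (\<forall>a. a \<noteq> 0 \<and> a \<notin> J \<longrightarrow> vs_dim (cohomology X (E a) q) = vs_dim (cohomology X L q)) \<and>
           (\<forall>a\<in>J. vs_dim (cohomology X (E a) q) > vs_dim (cohomology X L q)) \<and>
           (\<forall>a\<in>J. algebraic a)"
proof -
  obtain z where z: "z \<in> cocycles X (constant_system regular_module) 1" "\<xi> \<noteq> {}"
    "\<forall>f\<in>\<xi>. \<exists>b\<in>coboundaries X (constant_system regular_module) 1.
       \<forall>s\<in>singular_simplex_set 1 X. f s = b s + z s"
    using cohomology_class[OF assms(2)] by metis
  interpret twisted X z "\<lambda>k. sgl k (1::rat)"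
    by unfold_locales (rule z(1), simp_all add: mult_single)
  have X: "compact_space X" "Hausdorff_space X" "locally_contractible X"
    using assms(1) manifold_locally_contractible[of n X]
    by (simp_all add: closed_manifold_def topological_manifold_def)
  note fg = fg_homology[OF principal_laurent X]
  from fg interpret fg: fg_complex "\<lambda>q. singular_simplex_set q X" tb .
  obtain xs where xs: "based_complex (\<lambda>q. attach_basis (singular_simplex_set q X) (xs q)) (\<lambda>q. attach_bd (tb q) (xs q))"
    "based_complex.acyclic (\<lambda>q. attach_basis (singular_simplex_set q X) (xs q)) (\<lambda>q. attach_bd (tb q) (xs q))"
    by (rule fg.attach_acyclic)
  interpret at: attached_complex "\<lambda>q. singular_simplex_set q X" tb xs
    by (intro attached_complex.intro attached_complex_axioms.intro fg.based_complex_axioms xs)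
  note dim = vs_dim_cohomology_laurent[OF at.attached_complex_axioms assms(2) z]
  have evC: "laurent_eval (of_rat :: rat \<Rightarrow> complex) a" if "a \<noteq> 0" for a
    by (intro laurent_eval.intro ring_map_of_rat laurent_eval_axioms.intro that)
  let ?ev = "\<lambda>a. laurent_eval.eval (of_rat :: rat \<Rightarrow> complex) a"
  have map_ev: "ring_map (?ev a)" if "a \<noteq> 0" for a by (rule laurent_eval.ring_map_eval[OF evC[OF that]])
  let ?b = "\<lambda>a. at.betti q (?ev a)" and ?bL = "at.betti q rf.eval"
  have dimE: "vs_dim (cohomology X (E a) q) = enat (?b a)" if "a \<noteq> 0" for a
    by (rule dim[OF assms(3,4)[OF that] evC[OF that]])
  have dimL: "vs_dim (cohomology X L q) = enat ?bL"
    by (rule dim[OF assms(5,6) laurent_eval_ratfun])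
  have ge: "?bL \<le> ?b a" if "a \<noteq> 0" for a
    by (rule at.betti_specialise,
        rule rank_specialise_le[OF principal_laurent rf.ring_map_eval inj_eval_ratfun ratfun_fraction map_ev[OF that]])
  \<comment> \<open>The dimension involves the ranks of \<open>columns q\<close> and
    \<open>columns (Suc q)\<close>, each with an exceptional Laurent polynomial of its own; the
    product \<open>d1 * d2\<close> covers both.\<close>
  note gen = rank_generic[OF rf.ring_map_eval inj_eval_ratfun ratfun_fraction at.finite_columns, where 'f = complex]
  from gen[of q] obtain d1 where d1: "d1 \<noteq> 0" "\<forall>ev :: _ \<Rightarrow> complex. ring_map ev \<longrightarrow> ev d1 \<noteq> 0 \<longrightarrow>
     fv.dim (Poly_Mapping.map rf.eval ` at.columns q) \<le> fv.dim (Poly_Mapping.map ev ` at.columns q)" by (elim exE conjE)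
  from gen[of "Suc q"] obtain d2 where d2: "d2 \<noteq> 0" "\<forall>ev :: _ \<Rightarrow> complex. ring_map ev \<longrightarrow> ev d2 \<noteq> 0 \<longrightarrow>
     fv.dim (Poly_Mapping.map rf.eval ` at.columns (Suc q)) \<le> fv.dim (Poly_Mapping.map ev ` at.columns (Suc q))" by (elim exE conjE)
  have d: "d1 * d2 \<noteq> 0" using d1(1) d2(1) by simp
  \<comment> \<open>The exact exceptional set. Equality outside it holds by definition and the
    strict inequality on it follows from \<open>ge\<close>; the zeros of \<open>d1 * d2\<close> only
    contain it, which still yields finiteness and algebraicity.\<close>
  define J where "J = {a. a \<noteq> 0 \<and> ?b a \<noteq> ?bL}"
  have J: "?ev a (d1 * d2) = 0" if "a \<in> J" for a
  proof (rule ccontr)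
    assume nz: "?ev a (d1 * d2) \<noteq> 0"
    have a: "a \<noteq> 0" "?b a \<noteq> ?bL" using that by (simp_all add: J_def)
    interpret r: ring_map "?ev a" by (rule map_ev[OF a(1)])
    have "?ev a d1 \<noteq> 0" "?ev a d2 \<noteq> 0" using nz by (auto simp: r.ev_mult)
    then have "?b a \<le> ?bL" unfolding at.betti_def
      using d1(2) d2(2) map_ev[OF a(1)] by (intro diff_le_mono2 add_mono) simp_all
    then show False using ge[OF a(1)] a(2) by simp
  qed
  show ?thesis
  proof (intro exI[of _ J] conjI allI impI ballI)
    show "finite J" by (rule finite_subset[OF _ algebraic_eval_zeros(1)[OF d]]) (use J in \<open>auto simp: J_def\<close>)
    show "0 \<notin> J" by (simp add: J_def)
    show "vs_dim (cohomology X (E a) q) = vs_dim (cohomology X L q)" if "a \<noteq> 0 \<and> a \<notin> J" for a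
      using that by (auto simp: dimE dimL J_def)
    show "vs_dim (cohomology X L q) < vs_dim (cohomology X (E a) q)" if "a \<in> J" for a
      using that ge[of a] by (simp add: dimE dimL J_def)
    show "algebraic a" if "a \<in> J" for a
      by (rule algebraic_eval_zeros(2)[OF d _ J[OF that]]) (use that in \<open>simp add: J_def\<close>)
  qed
qed

end
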